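(* Let $\ell_r$ ($r\ge1$) be the functions defined in the context, viewed in the ring $\mathcal{H}(\Omega)$ of holomorphic functions on the open unit disc $\Omega=\{|z|<1\}$. Let $L:=\mathrm{span}_{\mathbb{C}}\{\ell_r\}_{r\ge1}$ and $E:=\mathrm{span}_{\mathbb{C}}\{e^{\ell_r}\}_{r\ge1}$, and let $\mathbb{C}[L]$ and $\mathbb{C}[E]$ be the $\mathbb{C}$-subalgebras of $\mathcal{H}(\Omega)$ that they respectively generate. Then: (1) The family $(\ell_r)_{r\ge1}$ is $\mathbb{C}$-linearly free and free from $1_{\mathcal{H}(\Omega)}$. (2) The families $(\ell_r)_{r\ge1}$ and $(e^{\ell_r})_{r\ge1}$ are each $\mathbb{C}$-linearly free and free from $1_{\mathcal{H}(\Omega)}$. (3) The families $(\ell_r)_{r\ge1}$ and $(e^{\ell_r})_{r\ge1}$ are each $\mathbb{C}$-algebraically independent. (4) For every $r\ge1$: (a) the functions $\ell_r$ and $e^{\ell_r}$ are $\mathbb{C}$-algebraically independent; (b) the function $\ell_r$ is holomorphic on the open unit disc; (c) the function $e^{\ell_r}$ (resp. $e^{-\ell_r}$) is entire (resp. meromorphic on $\mathbb{C}$), and admits a countable set of isolated zeroes (resp. poles) in the complex plane, which is $\biguplus_{\chi\in G_r}\chi\,\mathbb{Z}_{\le-1}$. (5) One has $E\cap L=\{0\}$ and, more generally, $\mathbb{C}[E]\cap\mathbb{C}[L]=\mathbb{C}\cdot1_{\mathcal{H}(\Omega)}$.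
   Context: $\zeta$ is the Riemann zeta function, $\gamma$ Euler's constant. For $|z|<1$ put $$\ell_1(z):=\gamma z-\sum_{k\ge2}\zeta(k)\frac{(-z)^k}{k},\qquad \ell_r(z):=-\sum_{k\ge1}\zeta(kr)\frac{(-z^r)^k}{k}\ \text{ for } r\ge2.$$ $G_r:=\{\chi\in\mathbb{C}\mid\chi^r=(-1)^{r-1}\}$. A family is "free from $1$" if it remains $\mathbb{C}$-linearly independent after adjoining the constant function $1$. In (4)(c), saying that $e^{\pm\ell_r}$ is entire or meromorphic means that it extends as such from the unit disc to $\mathbb{C}$. The symbol $\biguplus$ denotes disjoint union, and $\mathbb{Z}_{\le-1}$ the set of negative integers. *)

theory Defs
  imports "HOL-Complex_Analysis.Complex_Analysis" "HOL-Library.Poly_Mapping"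
begin

section \<open>The ring of holomorphic functions on the open unit disc\<close>

text \<open>
  HOL functions are total, so a holomorphic function on the disc is represented by its extension by
  zero; thus equality in this type is equality on the disc.
\<close>

typedef hol_disc =
  "{f :: complex \<Rightarrow> complex. f holomorphic_on ball 0 1 \<and> (\<forall>z. z \<notin> ball 0 1 \<longrightarrow> f z = 0)}"
  morphisms hol_fun Abs_hol_disc
  by (rule exI[of _ "\<lambda>_. 0"]) auto

setup_lifting type_definition_hol_disc

instantiation hol_disc :: comm_ring_1
begin

lift_definition zero_hol_disc :: hol_disc is "\<lambda>_. 0"
  by auto

lift_definition one_hol_disc :: hol_disc is "\<lambda>z. if z \<in> ball 0 1 then 1 else 0"
  by (auto intro: holomorphic_transform[of "\<lambda>_. 1"])

lift_definition plus_hol_disc :: "hol_disc \<Rightarrow> hol_disc \<Rightarrow> hol_disc" is "\<lambda>f g z. f z + g z"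
  by (auto intro: holomorphic_intros)

lift_definition minus_hol_disc :: "hol_disc \<Rightarrow> hol_disc \<Rightarrow> hol_disc" is "\<lambda>f g z. f z - g z"
  by (auto intro: holomorphic_intros)

lift_definition uminus_hol_disc :: "hol_disc \<Rightarrow> hol_disc" is "\<lambda>f z. - f z"
  by (auto intro: holomorphic_intros)

lift_definition times_hol_disc :: "hol_disc \<Rightarrow> hol_disc \<Rightarrow> hol_disc" is "\<lambda>f g z. f z * g z"
  by (auto intro: holomorphic_intros)

instance
proof
  show "(0::hol_disc) \<noteq> 1"
    by transfer (auto simp: fun_eq_iff intro!: exI[of _ 0])
qed (transfer; force simp: fun_eq_iff algebra_simps)+

end

lift_definition hol_scale :: "complex \<Rightarrow> hol_disc \<Rightarrow> hol_disc" is "\<lambda>c f z. c * f z"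
  by (auto intro: holomorphic_intros)

interpretation hol: vector_space hol_scale
  by standard (transfer; auto simp: fun_eq_iff algebra_simps)+

lift_definition hol_exp :: "hol_disc \<Rightarrow> hol_disc" is
  "\<lambda>f z. if z \<in> ball 0 1 then exp (f z) else 0"
proof -
  fix f :: "complex \<Rightarrow> complex"
  assume "f holomorphic_on ball 0 1 \<and> (\<forall>z. z \<notin> ball 0 1 \<longrightarrow> f z = 0)"
  then show "(\<lambda>z. if z \<in> ball 0 1 then exp (f z) else 0) holomorphic_on ball 0 1 \<and>
      (\<forall>z. z \<notin> ball 0 1 \<longrightarrow> (if z \<in> ball 0 1 then exp (f z) else 0) = 0)"
    by (auto intro!: holomorphic_intros intro: holomorphic_transform[of "\<lambda>z. exp (f z)"])
qed

text \<open>The class in \<open>hol_disc\<close> of a function; meaningful only if \<open>f\<close> is holomorphic on the disc.\<close>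

definition to_hol :: "(complex \<Rightarrow> complex) \<Rightarrow> hol_disc" where
  "to_hol f = Abs_hol_disc (\<lambda>z. if z \<in> ball 0 1 then f z else 0)"


section \<open>Linear and algebraic independence of families\<close>

definition lin_free :: "'i set \<Rightarrow> ('i \<Rightarrow> hol_disc) \<Rightarrow> bool" where
  "lin_free I f \<longleftrightarrow> (\<forall>J c. finite J \<longrightarrow> J \<subseteq> I \<longrightarrow>
     (\<Sum>j\<in>J. hol_scale (c j) (f j)) = 0 \<longrightarrow> (\<forall>j\<in>J. c j = 0))"

text \<open>The constant \<open>1\<close> is adjoined to the family at the new index \<open>None\<close>.\<close>

definition free_from_one :: "'i set \<Rightarrow> ('i \<Rightarrow> hol_disc) \<Rightarrow> bool" where
  "free_from_one I f \<longleftrightarrow> lin_free (insert None (Some ` I)) (case_option 1 f)"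

text \<open>
  A polynomial in indeterminates indexed by \<open>'i\<close> is a finitely supported map from monomials to
  coefficients, a monomial being a finitely supported map from indeterminates to exponents.
\<close>

type_synonym 'i cpoly = "('i \<Rightarrow>\<^sub>0 nat) \<Rightarrow>\<^sub>0 complex"

definition cpoly_eval :: "('i \<Rightarrow> hol_disc) \<Rightarrow> 'i cpoly \<Rightarrow> hol_disc" where
  "cpoly_eval f p = (\<Sum>m\<in>Poly_Mapping.keys p. hol_scale (Poly_Mapping.lookup p m)
     (\<Prod>i\<in>Poly_Mapping.keys m. f i ^ Poly_Mapping.lookup m i))"

definition alg_free :: "'i set \<Rightarrow> ('i \<Rightarrow> hol_disc) \<Rightarrow> bool" where
  "alg_free I f \<longleftrightarrow>
     (\<forall>p :: 'i cpoly. (\<forall>m\<in>Poly_Mapping.keys p. Poly_Mapping.keys m \<subseteq> I) \<longrightarrow>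
        cpoly_eval f p = 0 \<longrightarrow> p = 0)"

definition is_subalgebra :: "hol_disc set \<Rightarrow> bool" where
  "is_subalgebra A \<longleftrightarrow> hol.subspace A \<and> 1 \<in> A \<and> (\<forall>f\<in>A. \<forall>g\<in>A. f * g \<in> A)"

definition generated_algebra :: "hol_disc set \<Rightarrow> hol_disc set" where
  "generated_algebra S = is_subalgebra hull S"


section \<open>The functions and their zero sets\<close>

text \<open>Only used for \<open>k \<ge> 2\<close>, where the series converges.\<close>

definition zeta_nat :: "nat \<Rightarrow> complex" where
  "zeta_nat k = suminf (\<lambda>n. 1 / of_nat (Suc n) ^ k)"

text \<open>
  The sums start at \<open>k = 2\<close> and \<open>k = 1\<close> respectively, whence the index shifts; the definition
  is relevant for \<open>r \<ge> 1\<close> and \<open>norm z < 1\<close>.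
\<close>

definition ell :: "nat \<Rightarrow> complex \<Rightarrow> complex" where
  "ell r z =
     (if r = 1
      then euler_mascheroni * z - suminf (\<lambda>k. zeta_nat (k + 2) * (- z) ^ (k + 2) / of_nat (k + 2))
      else - suminf (\<lambda>k. zeta_nat ((k + 1) * r) * (- (z ^ r)) ^ (k + 1) / of_nat (k + 1)))"

definition ell_hol :: "nat \<Rightarrow> hol_disc" where
  "ell_hol r = to_hol (ell r)"

definition exp_ell_hol :: "nat \<Rightarrow> hol_disc" where
  "exp_ell_hol r = hol_exp (ell_hol r)"

definition L_space :: "hol_disc set" where
  "L_space = hol.span (ell_hol ` {1..})"

definition E_space :: "hol_disc set" where
  "E_space = hol.span (exp_ell_hol ` {1..})"

definition G_set :: "nat \<Rightarrow> complex set" where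
  "G_set r = {\<omega>. \<omega> ^ r = (- 1) ^ (r - 1)}"

definition neg_multiples :: "complex \<Rightarrow> complex set" where
  "neg_multiples \<omega> = (\<lambda>n::int. \<omega> * of_int n) ` {..-1}"

end

theory Submission
  imports Defs "HOL-Real_Asymp.Real_Asymp"
begin

text \<open>
  On the disc, \<open>\<ell>\<^sub>r(z) = - (\<Sum>q. ln \<Gamma>(1 - z/q))\<close> and
  \<open>exp \<ell>\<^sub>r = F\<^sub>r := \<Prod>q. 1/\<Gamma>(1 - z/q)\<close>, where \<open>q\<close> runs over the roots of \<open>q^r = -1\<close>; this gives (4)(b) and (4)(c).

  At \<open>p = exp(i\<pi>/R)\<close> only \<open>\<ell>\<^sub>R\<close> is singular among \<open>\<ell>\<^sub>1, \<dots>, \<ell>\<^sub>R\<close>, with a logarithmic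
  singularity, and \<open>log\<close> is transcendental over the germs of holomorphic functions at \<open>p\<close>. Induction on \<open>R\<close> gives
  the independence of the \<open>\<ell>\<^sub>r\<close>, (4)(a), and the fact that an entire function in \<open>\<complex>[L]\<close> is constant, hence (5).

  For the \<open>F\<^sub>r\<close>, choose a generic direction \<open>d\<close> near \<open>p\<close>. By the reflection formula and Stirling, on the sector
  of opening \<open>\<pi> + 2\<eta>\<close> around \<open>d\<close> each \<open>F\<^sub>r\<close> is a finite sum of exponentials \<open>exp(\<lambda>z)\<close> (times a power of
  \<open>exp(- z log z)\<close>) with coefficients of polynomial growth. Over such coefficients the exponentials are linearly
  independent because the opening exceeds \<open>\<pi>\<close> (Watson's lemma). So multiplying each \<open>exp(\<lambda>z)\<close> by \<open>\<kappa>(\<lambda>)\<close>, for a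
  character \<open>\<kappa>\<close> of the exponents, preserves every algebraic relation. Since \<open>1/p\<close> is not in the rational span of the
  roots of \<open>q^s = -1\<close>, \<open>s < R\<close>, there is a one-parameter family of characters that fixes \<open>F\<^sub>1, \<dots>, F\<^sub>R\<^sub>-\<^sub>1\<close> and moves \<open>F\<^sub>R\<close>
  through infinitely many functions: \<open>F\<^sub>R\<close> is transcendental over \<open>\<complex>(F\<^sub>1, \<dots>, F\<^sub>R\<^sub>-\<^sub>1)\<close>.
\<close>

section \<open>Rational relations between roots of unity\<close>

text \<open>Unlike the \<open>ell r\<close>, the functions \<open>Efun r\<close> are entire, so no
  singularity tells them apart; only their growth does. Their exponents involve roots of unity with
  many rational relations (the sum of \<open>1 / q\<close> over \<open>neg1_roots s\<close> is 0 for
  \<open>s \<ge> 2\<close>), so terms of a relation can merge and cancel in complicated ways. The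
  remedy is to act on all exponents at once. A map \<open>\<mu>\<close>, linear over the rationals,
  that is 0 on the roots of \<open>y^s = -1\<close> for \<open>s < R\<close> and 1 at
  \<open>1 / p\<close> yields the characters, up to a correction for logarithmic terms. They turn
  the factor \<open>sin w\<close> of \<open>Efun R\<close> that belongs to \<open>q = p\<close> into
  \<open>sin (w - i * t)\<close>. Where \<open>Efun R\<close> is nonzero, the twisted value is
  nonzero at \<open>t = 0\<close> and zero for a suitable \<open>t\<close>, so it takes infinitely
  many values at one point. The existence of \<open>\<mu>\<close> is a fact about cyclotomic fields,
  here expressed by integer polynomials evaluated at roots of unity.

  The opening must exceed \<open>pi\<close> because \<open>exp (- u)\<close> is bounded on a
  half-plane and exponentially small around its axis. The coordinate \<open>v = log u\<close> makes
  logarithms and powers of \<open>u\<close> entire.\<close>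

definition ieval :: "int poly \<Rightarrow> complex \<Rightarrow> complex" where
  "ieval f x = poly (map_poly of_int f) x"

lemma ieval_0 [simp]: "ieval 0 x = 0"
  by (simp add: ieval_def)

lemma ieval_pCons [simp]: "ieval (pCons a f) x = of_int a + x * ieval f x"
  by (simp add: ieval_def map_poly_pCons)

lemma ieval_1 [simp]: "ieval 1 x = 1"
  by (simp add: ieval_def)

lemma ieval_add [simp]: "ieval (f + g) x = ieval f x + ieval g x"
  by (induction f g rule: poly_induct2) (auto simp: algebra_simps)

lemma ieval_smult [simp]: "ieval (smult c f) x = of_int c * ieval f x"
  by (induction f) (auto simp: algebra_simps)

lemma ieval_minus [simp]: "ieval (- f) x = - ieval f x"
  using ieval_smult[of "-1" f x] by simp

lemma ieval_diff [simp]: "ieval (f - g) x = ieval f x - ieval g x"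
  using ieval_add[of f "- g" x] by simp

lemma ieval_mult [simp]: "ieval (f * g) x = ieval f x * ieval g x"
  by (induction f) (auto simp: algebra_simps)

lemma ieval_power [simp]: "ieval (f ^ n) x = ieval f x ^ n"
  by (induction n) auto

lemma ieval_monom [simp]: "ieval (monom c n) x = of_int c * x ^ n"
  by (simp add: ieval_def map_poly_monom poly_monom)

lemma ieval_sum [simp]: "ieval (\<Sum>i\<in>A. f i) x = (\<Sum>i\<in>A. ieval (f i) x)"
  by (induction A rule: infinite_finite_induct) auto

lemma ieval_pcompose [simp]: "ieval (pcompose f g) x = ieval f (ieval g x)"
  by (induction f) (auto simp: pcompose_pCons)

section \<open>Conjugates of a root of unity: Frobenius and Gauss's lemma\<close>

lemma of_nat_prime_dvd_freshman:
  fixes x y :: "'a::comm_ring_1"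
  assumes "prime p"
  shows "of_nat p dvd (x + y) ^ p - x ^ p - y ^ p"
proof -
  have p: "p > 0" using assms prime_gt_0_nat by blast
  have "(x + y) ^ p = (\<Sum>k\<le>p. of_nat (p choose k) * x ^ k * y ^ (p - k))"
    by (rule binomial_ring)
  also have "{..p} = insert 0 (insert p {0<..<p})"
    using p by auto
  also have "(\<Sum>k\<in>\<dots>. of_nat (p choose k) * x ^ k * y ^ (p - k)) =
     y ^ p + (x ^ p + (\<Sum>k\<in>{0<..<p}. of_nat (p choose k) * x ^ k * y ^ (p - k)))"
    using p by simp
  finally have eq: "(x + y) ^ p - x ^ p - y ^ p =
     (\<Sum>k\<in>{0<..<p}. of_nat (p choose k) * x ^ k * y ^ (p - k))"
    by simp
  have "of_nat p dvd of_nat (p choose k) * x ^ k * y ^ (p - k)" if "k \<in> {0<..<p}" for k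
  proof -
    have "p dvd (p choose k)"
      using that assms by (intro dvd_choose_prime) auto
    then have "(of_nat p :: 'a) dvd of_nat (p choose k)"
      by (metis dvd_def of_nat_mult)
    then show ?thesis by (simp add: mult.assoc)
  qed
  then show ?thesis
    unfolding eq by (intro dvd_sum) auto
qed

lemma int_prime_dvd_fermat:
  fixes a :: int
  assumes "prime p"
  shows "int p dvd a ^ p - a"
proof -
  have p: "p > 0" using assms prime_gt_0_nat by blast
  have nn: "int p dvd int n ^ p - int n" for n
  proof (induction n)
    case 0
    then show ?case using p by (simp add: power_0_left)
  next
    case (Suc n)
    have "int p dvd (int n + 1) ^ p - int n ^ p - 1 ^ p"
      using of_nat_prime_dvd_freshman[OF assms, of "int n" 1] by simp
    from dvd_add[OF this Suc] show ?case by (simp add: algebra_simps)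
  qed
  have m: "int p dvd a ^ p - (a mod int p) ^ p"
  proof -
    have "a - a mod int p dvd a ^ p - (a mod int p) ^ p"
      by (simp add: power_diff_sumr2)
    then show ?thesis
      using dvd_minus_mod dvd_trans by blast
  qed
  have "a mod int p = int (nat (a mod int p))" using p by simp
  then have "int p dvd (a mod int p) ^ p - a mod int p" using nn by metis
  from dvd_add[OF m this] have "int p dvd a ^ p - a mod int p" by simp
  from dvd_diff[OF this, of "a - a mod int p"] show ?thesis
    by (simp add: dvd_minus_mod)
qed

text \<open>Modulo \<open>p\<close>, taking \<open>p\<close>-th powers is additive and by Fermat
  fixes the integers, so it acts on a polynomial only through the variable.\<close>

lemma int_poly_frobenius:
  fixes f :: "int poly"
  assumes "prime p"
  shows "of_nat p dvd f ^ p - pcompose f (monom 1 p)"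
proof (induction f)
  case 0
  then show ?case using prime_gt_0_nat[OF assms] by (simp add: power_0_left)
next
  case (pCons a f)
  have eq: "pCons a f = [:a:] + monom 1 1 * f" by (simp add: monom_Suc)
  have 1: "of_nat p dvd (pCons a f) ^ p - [:a:] ^ p - (monom 1 1 * f) ^ p"
    unfolding eq by (rule of_nat_prime_dvd_freshman[OF assms])
  have 2: "(of_nat p :: int poly) dvd [:a:] ^ p - [:a:]"
  proof -
    obtain b where "a ^ p - a = int p * b"
      using int_prime_dvd_fermat[OF assms] by (auto elim: dvdE)
    then have "[:a:] ^ p - [:a:] = of_nat p * [:b:]"
      by (simp add: poly_const_pow of_nat_poly)
    then show ?thesis by (metis dvd_triv_left)
  qed
  have 3: "of_nat p dvd (monom 1 1 * f) ^ p - monom 1 p * pcompose f (monom 1 p)"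
  proof -
    have "(monom 1 1 * f) ^ p - monom 1 p * pcompose f (monom 1 p)
      = monom 1 p * (f ^ p - pcompose f (monom 1 p))"
      by (simp add: power_mult_distrib monom_power algebra_simps)
    then show ?thesis using pCons by simp
  qed
  have "d dvd X - (a + c)" if "d dvd X - A - B" "d dvd A - a" "d dvd B - c" for d X A B a c :: "int poly"
    using dvd_add[OF dvd_add[OF that(1,2)] that(3)] by (simp add: algebra_simps)
  from this[OF 1 2 3] show ?case by (simp only: pcompose_pCons)
qed

text \<open>Take a primitive polynomial of least degree vanishing at \<open>x\<close>.
  Pseudo-division shows that it divides some \<open>smult c f\<close>; multiplicativity of the
  content then removes \<open>c\<close>, so the divisibility holds over the integers.\<close>

lemma minimal_int_poly:
  fixes x :: complex and f0 :: "int poly"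
  assumes "f0 \<noteq> 0" "ieval f0 x = 0"
  obtains M where "M \<noteq> 0" "ieval M x = 0" "\<And>f. ieval f x = 0 \<Longrightarrow> M dvd f"
proof -
  define d where "d = (LEAST n. \<exists>f. f \<noteq> 0 \<and> ieval f x = 0 \<and> degree f = n)"
  have ex: "\<exists>f. f \<noteq> 0 \<and> ieval f x = 0 \<and> degree f = d"
    unfolding d_def by (rule LeastI[of _ "degree f0"]) (use assms in auto)
  have least: "d \<le> degree f" if "f \<noteq> 0" "ieval f x = 0" for f
    unfolding d_def by (rule Least_le) (use that in auto)
  obtain M0 where M0: "M0 \<noteq> 0" "ieval M0 x = 0" "degree M0 = d" using ex by blast
  define M where "M = primitive_part M0"
  have M0_eq: "M0 = smult (content M0) M" by (simp add: M_def)
  have M: "M \<noteq> 0" "content M = 1" "degree M = d"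
    using M0 by (auto simp: M_def)
  have "of_int (content M0) * ieval M x = 0"
    using M0(2) by (metis M0_eq ieval_smult)
  then have Mx: "ieval M x = 0" using M0 by simp
  show ?thesis
  proof
    fix f assume f: "ieval f x = 0"
    obtain c q where cq: "c \<noteq> 0" "smult c f = M * q + pseudo_mod f M"
      using pseudo_mod(1)[OF M(1)] by blast
    define r where "r = pseudo_mod f M"
    have "ieval r x = 0"
      using arg_cong[OF cq(2), of "\<lambda>g. ieval g x"] f Mx by (simp add: r_def)
    then have "r = 0"
      using pseudo_mod(2)[OF M(1), of f] least[of r] M(3) unfolding r_def by force
    then have eq: "smult c f = M * q" using cq r_def by simp
    have "content (smult c f) = content q"
      unfolding eq content_mult by (simp add: M)
    then have "c dvd content q" by (metis content_smult dvd_triv_left normalize_dvd_iff)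
    then have "[:c:] dvd q" by (simp add: const_poly_dvd_iff_dvd_content)
    then obtain q' where "q = smult c q'" by (auto elim!: dvdE)
    then have "smult c f = smult c (M * q')" using eq by simp
    then have "f = M * q'" using cq(1) by (metis smult_cancel)
    then show "M dvd f" by simp
  qed (use M Mx in auto)
qed

text \<open>\<open>M\<close> keeps its positive degree modulo \<open>p\<close>, so the ideal of
  \<open>M\<close> and \<open>p\<close> contains no constants but multiples of \<open>p\<close>.
  Concretely, \<open>p\<close> divides the leading coefficient of \<open>k\<close>, so the leading
  term of \<open>k\<close> can be moved into \<open>g\<close>; the descent is on the degree of
  \<open>k\<close>.\<close>

lemma prime_dvd_const_of_combination:
  fixes M :: "int poly"
  assumes "is_unit (lead_coeff M)" "degree M > 0"
  assumes "[:c:] = M * k + smult p g"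
  shows "p dvd c"
  using assms(3)
proof (induction "degree k" arbitrary: k g rule: less_induct)
  case less
  show ?case
  proof (cases "k = 0")
    case True
    then have "coeff [:c:] 0 = coeff (smult p g) 0" using less by simp
    then show ?thesis by simp
  next
    case False
    have "coeff [:c:] (degree M + degree k) = coeff (M * k + smult p g) (degree M + degree k)"
      using less by simp
    then have "0 = lead_coeff M * lead_coeff k + p * coeff g (degree M + degree k)"
      using assms(2) by (simp add: coeff_mult_degree_sum coeff_pCons split: nat.splits)
    then have "p dvd lead_coeff M * lead_coeff k"
      by (metis dvd_0_right dvd_add_left_iff dvd_triv_left)
    then have "p dvd lead_coeff k"
      using assms(1) by (metis dvd_mult_unit_iff mult.commute)
    then obtain b where b: "lead_coeff k = p * b" by (auto elim: dvdE)
    define k' where "k' = k - monom (lead_coeff k) (degree k)"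
    have eq: "[:c:] = M * k' + smult p (g + M * monom b (degree k))"
      using less.prems unfolding k'_def b
      by (simp add: algebra_simps smult_add_right smult_monom flip: mult_smult_right)
    show ?thesis
    proof (cases "degree k = 0")
      case True
      then have "k' = 0" unfolding k'_def by (metis degree_eq_zeroE eq_iff_diff_eq_0 lead_coeff_pCons(2) monom_0 degree_0 coeff_pCons_0)
      then have "coeff [:c:] 0 = p * coeff (g + M * monom b (degree k)) 0" using eq by simp
      then show ?thesis by simp
    next
      case False
      have "degree k' < degree k"
        unfolding k'_def using False
        by (intro degree_lessI) (auto simp: coeff_eq_0 intro: le_degree)
      from less.hyps[OF this eq] show ?thesis .
    qed
  qed
qed

text \<open>Dedekind's argument. Write \<open>X^N - 1 = M * h\<close> with \<open>M\<close> the
  minimal polynomial of \<open>z\<close>. If \<open>M\<close> did not vanish at \<open>z^l\<close>,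
  then \<open>h\<close> would, and Frobenius makes \<open>h(z)^l\<close> equal to \<open>l\<close>
  times a value at \<open>z\<close>. The derivative of \<open>X^N - 1\<close> at \<open>z\<close>
  contains the factor \<open>h(z)\<close>, so \<open>N^l\<close> lies in the ideal of
  \<open>M\<close> and \<open>l\<close>, which forces \<open>l dvd N^l\<close>.\<close>

lemma ieval_root_of_unity_power_prime:
  assumes z: "z ^ N = 1" and N: "N > 0" and l: "prime l" "\<not> l dvd N" and f: "ieval f z = 0"
  shows "ieval f (z ^ l) = 0"
proof -
  define P :: "int poly" where "P = monom 1 N - 1"
  have coeffP: "coeff P N = 1" using N by (simp add: P_def)
  then have P0: "P \<noteq> 0" by auto
  have degP: "degree P = N"
    using coeffP N unfolding P_def
    by (intro antisym degree_le le_degree) auto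
  have leadP: "lead_coeff P = 1" using degP coeffP by simp
  have Pz: "ieval P z = 0" using z by (simp add: P_def)
  have Pzl: "ieval P (z ^ l) = 0"
    using z by (simp add: P_def) (metis power_commutes power_mult power_one mult.commute)
  obtain M where M: "M \<noteq> 0" "ieval M z = 0" "\<And>f. ieval f z = 0 \<Longrightarrow> M dvd f"
    using minimal_int_poly[OF P0 Pz] by blast
  from M(3)[OF Pz] obtain h where h: "P = M * h" by (auto elim: dvdE)
  have lead: "lead_coeff M * lead_coeff h = 1"
    using leadP unfolding h by (simp add: lead_coeff_mult)
  then have unit: "is_unit (lead_coeff M)" by (metis dvd_triv_left)
  have degM: "degree M > 0"
  proof (rule ccontr)
    assume "\<not> degree M > 0"
    then obtain c where "M = [:c:]" by (metis degree_eq_zeroE gr0I)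
    then show False using M(1,2) by simp
  qed
  have "ieval M (z ^ l) = 0"
  proof (rule ccontr)
    assume "ieval M (z ^ l) \<noteq> 0"
    then have hzl: "ieval h (z ^ l) = 0" using Pzl unfolding h by simp
    obtain k where k: "h ^ l - pcompose h (monom 1 l) = of_nat l * k"
      using int_poly_frobenius[OF l(1), of h] by (auto elim: dvdE)
    have hz: "ieval h z ^ l = of_nat l * ieval k z"
      using arg_cong[OF k, of "\<lambda>f. ieval f z"] hzl by (simp add: of_nat_poly)
    have "pderiv P = M * pderiv h + h * pderiv M" unfolding h by (rule pderiv_mult)
    moreover have "pderiv P = monom (int N) (N - 1)"
      by (simp add: P_def pderiv_diff pderiv_monom)
    ultimately have "ieval (monom (int N) (N - 1)) z = ieval (M * pderiv h + h * pderiv M) z"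
      by simp
    then have "of_nat N * z ^ (N - 1) = ieval h z * ieval (pderiv M) z"
      using M(2) by simp
    then have "of_nat N * z ^ N = z * ieval h z * ieval (pderiv M) z"
      using N by (cases N) (auto simp: algebra_simps)
    then have "of_nat N = z * ieval h z * ieval (pderiv M) z" using z by simp
    then have "of_nat N ^ l = z ^ l * ieval h z ^ l * ieval (pderiv M) z ^ l"
      by (simp add: power_mult_distrib)
    then have Nl: "of_nat N ^ l = of_nat l * (z ^ l * ieval k z * ieval (pderiv M) z ^ l)"
      unfolding hz by simp
    define g where "g = monom 1 l * k * pderiv M ^ l"
    have "ieval ([:int N ^ l:] - smult (int l) g) z = 0"
      using Nl by (simp add: g_def)
    from M(3)[OF this] obtain k2 where "[:int N ^ l:] - smult (int l) g = M * k2"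
      by (auto elim: dvdE)
    then have "[:int N ^ l:] = M * k2 + smult (int l) g" by (simp add: algebra_simps)
    from prime_dvd_const_of_combination[OF unit degM this] have "int l dvd int N ^ l" .
    then have "l dvd N ^ l" by (metis int_dvd_int_iff of_nat_power)
    then show False using l prime_dvd_power by blast
  qed
  with M(3)[OF f] show ?thesis by (auto elim!: dvdE)
qed

lemma ieval_root_of_unity_power_coprime:
  assumes "z ^ N = 1" "N > 0" "coprime a N" "ieval f z = 0"
  shows "ieval f (z ^ a) = 0"
  using assms(1,3,4)
proof (induction a arbitrary: z rule: less_induct)
  case (less a)
  consider "a = 0" | "a = 1" | "a > 1" by linarith
  then show ?case
  proof cases
    case 1
    then have "N = 1" using less.prems assms(2) by simp
    then show ?thesis using less.prems by simp
  next
    case 3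
    then obtain p where p: "prime p" "p dvd a" using prime_factor_nat[of a] by auto
    then obtain b where b: "a = p * b" by (auto elim: dvdE)
    have "b > 0" using 3 b by (intro gr0I) auto
    then have "b < a" using b prime_gt_1_nat[OF p(1)] by simp
    have cop: "coprime p N" "coprime b N" using less.prems b by auto
    have "\<not> p dvd N"
      using cop(1) p(1) by (metis coprime_absorb_left not_prime_unit)
    then have "ieval f (z ^ p) = 0"
      using ieval_root_of_unity_power_prime less.prems assms(2) p by blast
    moreover have "(z ^ p) ^ N = 1"
      using less.prems by (metis power_commutes power_mult power_one mult.commute)
    ultimately have "ieval f ((z ^ p) ^ b) = 0"
      using less.IH[OF \<open>b < a\<close>] cop by blast
    then show ?thesis by (simp add: b power_mult)
  qed (use less in auto)
qed

text \<open>This applies the automorphism \<open>z \<mapsto> z ^ a\<close> of the cyclotomic field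
  to a relation without constructing the field: all \<open>y i\<close> are powers of one primitive
  root, so the relation says that an integer polynomial vanishes there.\<close>

lemma roots_of_unity_relation_power:
  fixes y :: "'i \<Rightarrow> complex" and c :: "'i \<Rightarrow> int"
  assumes "N > 0" "\<And>i. i \<in> I \<Longrightarrow> y i ^ N = 1" "coprime a N"
  assumes "(\<Sum>i\<in>I. of_int (c i) * y i) = 0"
  shows "(\<Sum>i\<in>I. of_int (c i) * y i ^ a) = 0"
proof -
  define z where "z = cis (2 * pi / real N)"
  have zN: "z ^ N = 1" using assms(1) unfolding z_def Complex.DeMoivre by simp
  have "\<exists>e. y i = z ^ e" if "i \<in> I" for i
  proof -
    have "y i \<in> {w. w ^ N = 1}" using assms(2)[OF that] by simp
    then obtain k where "y i = cis (2 * pi * real k / real N)"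
      using Complex.bij_betw_roots_unity[OF assms(1)] by (auto simp: bij_betw_def)
    then show ?thesis
      by (intro exI[of _ k]) (simp add: z_def Complex.DeMoivre mult_ac)
  qed
  then obtain e where e: "\<And>i. i \<in> I \<Longrightarrow> y i = z ^ e i" by metis
  define f where "f = (\<Sum>i\<in>I. monom (c i) (e i))"
  have "ieval f z = 0" using assms(4) e by (simp add: f_def)
  from ieval_root_of_unity_power_coprime[OF zN assms(1,3) this]
  have "(\<Sum>i\<in>I. of_int (c i) * (z ^ a) ^ e i) = 0" by (simp add: f_def)
  then show ?thesis using e by (simp add: mult.commute flip: power_mult)
qed

text \<open>The composite of the operators "automorphism of \<open>a\<close> minus identity" for
  \<open>a\<close> in the list. Raising to the power \<open>a\<close> is the automorphism only on
  roots of unity, so the function is applied to the single roots in a relation, never to a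
  sum.\<close>

fun galois_diff :: "nat list \<Rightarrow> complex \<Rightarrow> complex" where
  "galois_diff [] y = y"
| "galois_diff (a # as) y = galois_diff as (y ^ a) - galois_diff as y"

lemma galois_diff_relation:
  fixes y :: "'i \<Rightarrow> complex" and c :: "'i \<Rightarrow> int"
  assumes "N > 0" "\<And>i. i \<in> I \<Longrightarrow> y i ^ N = 1" "\<And>a. a \<in> set as \<Longrightarrow> coprime a N"
  assumes "(\<Sum>i\<in>I. of_int (c i) * y i) = 0"
  shows "(\<Sum>i\<in>I. of_int (c i) * galois_diff as (y i)) = 0"
  using assms(2-)
proof (induction as arbitrary: y)
  case (Cons a as)
  have rel: "(\<Sum>i\<in>I. of_int (c i) * y i ^ a) = 0"
    using roots_of_unity_relation_power[OF assms(1), of I y a c] Cons.prems by auto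
  have "(\<Sum>i\<in>I. of_int (c i) * galois_diff as (y i ^ a)) = 0"
  proof (rule Cons.IH)
    show "(y i ^ a) ^ N = 1" if "i \<in> I" for i
      using Cons.prems(1)[OF that] by (metis power_mult mult.commute power_one)
  qed (use Cons.prems rel in auto)
  moreover have "(\<Sum>i\<in>I. of_int (c i) * galois_diff as (y i)) = 0"
    using Cons.prems by (intro Cons.IH) auto
  ultimately show ?case by (simp add: algebra_simps sum_subtractf)
qed auto

text \<open>The operators commute, so the difference that annihilates \<open>y\<close> may be taken
  first.\<close>

lemma galois_diff_eq_0:
  assumes "a \<in> set as" "y ^ a = y"
  shows "galois_diff as y = 0"
  using assms
proof (induction as arbitrary: y)
  case (Cons b as)
  show ?case
  proof (cases "a = b")
    case True
    then show ?thesis using Cons.prems by simp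
  next
    case False
    have "(y ^ b) ^ a = y ^ b" using Cons.prems(2) by (metis power_mult mult.commute)
    then show ?thesis using Cons False by simp
  qed
qed auto

text \<open>The divisibility says that the automorphism of \<open>a\<close> fixes
  \<open>y ^ (b - 1)\<close>. Each difference therefore acts on the leading factor \<open>y\<close>
  alone and contributes \<open>y ^ (a - 1) - 1\<close>, so that nonvanishing can be read off factor
  by factor.\<close>

lemma galois_diff_eq_prod:
  assumes "y ^ N = 1" "\<And>a. a \<in> set as \<Longrightarrow> a > 0" "distinct as"
  assumes "\<And>a b. a \<in> set as \<Longrightarrow> b \<in> set as \<Longrightarrow> a \<noteq> b \<Longrightarrow> N dvd (a - 1) * (b - 1)"
  shows "galois_diff as y = y * (\<Prod>a\<leftarrow>as. y ^ (a - 1) - 1)"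
  using assms
proof (induction as arbitrary: y)
  case (Cons a as)
  have IH: "galois_diff as x = x * (\<Prod>a\<leftarrow>as. x ^ (a - 1) - 1)" if "x ^ N = 1" for x
    using Cons.prems that by (intro Cons.IH) auto
  have "(y ^ a) ^ N = 1"
    using Cons.prems(1) by (metis power_mult mult.commute power_one)
  note 1 = IH[OF this] and 2 = IH[OF Cons.prems(1)]
  have "(y ^ a) ^ (b - 1) = y ^ (b - 1)" if "b \<in> set as" for b
  proof -
    have "a \<noteq> b" using that Cons.prems(3) by auto
    then have "N dvd (a - 1) * (b - 1)" using that by (intro Cons.prems(4)) auto
    then obtain k where k: "(a - 1) * (b - 1) = N * k" unfolding dvd_def by blast
    have "a > 0" using Cons.prems(2) by simp
    then have "a * (b - 1) = N * k + (b - 1)"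
      using k by (cases a) auto
    then have "y ^ (a * (b - 1)) = y ^ (b - 1)"
      using Cons.prems(1) by (simp only: power_add power_mult) simp
    then show ?thesis by (simp only: power_mult)
  qed
  then have "(\<Prod>b\<leftarrow>as. (y ^ a) ^ (b - 1) - 1) = (\<Prod>b\<leftarrow>as. y ^ (b - 1) - 1)"
    by (intro arg_cong[of _ _ prod_list] map_cong) auto
  moreover have "y ^ a = y * y ^ (a - 1)"
    using Cons.prems(2)[of a] by (cases a) auto
  ultimately show ?case using 1 2 by (simp add: algebra_simps)
qed auto

lemma root_of_unity_order:
  fixes y :: complex
  assumes "y ^ N = 1" "N > 0"
  obtains n where "n > 0" "\<And>m. y ^ m = 1 \<longleftrightarrow> n dvd m"
proof -
  define n where "n = (LEAST n. n > 0 \<and> y ^ n = 1)"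
  have n: "n > 0" "y ^ n = 1"
    unfolding n_def by (rule LeastI2[of _ N]; use assms in simp)+
  have least: "n \<le> m" if "m > 0" "y ^ m = 1" for m
    unfolding n_def by (rule Least_le) (use that in auto)
  show ?thesis
  proof
    fix m
    have "y ^ m = y ^ (n * (m div n) + m mod n)" by simp
    also have "\<dots> = y ^ (m mod n)" by (simp only: power_add power_mult n) simp
    finally have "y ^ m = 1 \<longleftrightarrow> y ^ (m mod n) = 1" by simp
    also have "\<dots> \<longleftrightarrow> m mod n = 0"
      using least[of "m mod n"] n(1) by (metis mod_less_divisor not_le gr0I power_0)
    finally show "y ^ m = 1 \<longleftrightarrow> n dvd m" by (simp add: dvd_eq_mod_eq_0)
  qed (use n in auto)
qed

text \<open>\<open>M\<close> is the part of \<open>N\<close> prime to \<open>p\<close>. Any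
  \<open>a = 1 + M * t\<close> is coprime to \<open>M\<close>, so it remains to choose the power of
  \<open>p\<close> in \<open>t\<close> while keeping \<open>p\<close> from dividing
  \<open>a\<close>. For \<open>p = 2\<close> and \<open>k = 1\<close> such an \<open>a\<close> would
  be even and not coprime to \<open>N\<close>, whence the assumption
  \<open>k \<ge> 2\<close>.\<close>

lemma exists_galois_exponent:
  fixes p k N :: nat
  assumes N: "N > 0" and p: "prime p" "k \<ge> 1" "p ^ k dvd N" "p = 2 \<longrightarrow> k \<ge> 2"
  defines "M \<equiv> N div p ^ multiplicity p N"
  obtains a where "coprime a N" "M * p ^ (k - 1) dvd a - 1" "\<not> p ^ k dvd a - 1" "a > 0"
proof -
  note obt = that
  have NM: "N = M * p ^ multiplicity p N"
    unfolding M_def by (simp add: multiplicity_dvd)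
  have pM: "\<not> p dvd M"
    unfolding M_def using N p(1) by (metis gr_implies_not0 multiplicity_decompose not_prime_unit)
  have cop: "coprime (1 + M * t) N" if "\<not> p dvd 1 + M * t" for t
  proof -
    have "coprime (1 + M * t) M" by (intro coprimeI) (metis dvd_add_left_iff dvd_mult2)
    moreover have "coprime (1 + M * t) p"
      using that p(1) by (simp add: coprime_commute prime_imp_coprime)
    ultimately show ?thesis by (subst NM) simp
  qed
  have *: thesis if t: "\<not> p dvd 1 + M * t" "p ^ (k - 1) dvd t" "\<not> p ^ k dvd t" for t
  proof (rule obt)
    show "coprime (1 + M * t) N" using cop t by simp
    show "M * p ^ (k - 1) dvd (1 + M * t) - 1" using t by simp
    have "coprime (p ^ k) M" using pM p(1) by (simp add: prime_imp_coprime)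
    then show "\<not> p ^ k dvd (1 + M * t) - 1" using t(3) by (simp add: coprime_dvd_mult_right_iff)
  qed simp
  show ?thesis
  proof (cases "k \<ge> 2")
    case True
    have "p dvd M * p ^ (k - 1)" using True by (cases "k - 1") auto
    then have "\<not> p dvd 1 + M * p ^ (k - 1)"
      using p(1) by (metis dvd_add_left_iff not_prime_unit)
    moreover have "\<not> p ^ k dvd p ^ (k - 1)"
      using p(1,2) by (metis Suc_diff_1 Suc_le_eq Suc_n_not_le_n power_dvd_imp_le prime_gt_1_nat zero_less_one order_less_le_trans)
    ultimately show ?thesis by (intro *[of "p ^ (k - 1)"]) auto
  next
    case False
    then have k: "k = 1" and p2: "p > 2" using p prime_ge_2_nat[of p] by (auto simp: le_less)
    show ?thesis
    \<comment> \<open>If \<open>p\<close> divided both \<open>1 + M\<close> and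
      \<open>1 + 2 * M\<close>, it would divide \<open>M\<close>; so \<open>t = 1\<close> or
      \<open>t = 2\<close> works, and neither is divisible by \<open>p > 2\<close>.\<close>
    proof (cases "p dvd 1 + M * 1")
      case False
      then show ?thesis by (intro *[of 1]) (use k p prime_gt_1_nat[of p] in auto)
    next
      case True
      have "\<not> p dvd 1 + M * 2"
      proof
        assume "p dvd 1 + M * 2"
        then have "p dvd (1 + M * 2) - (1 + M * 1)" using True by (rule dvd_diff_nat)
        then show False using pM by simp
      qed
      then show ?thesis by (intro *[of 2]) (use k p2 in \<open>auto dest: dvd_imp_le\<close>)
    qed
  qed
qed

text \<open>For every prime \<open>p\<close> dividing \<open>2 * R\<close> (except \<open>2\<close> if \<open>R\<close> is odd) there is an automorphism
  \<open>y \<mapsto> y ^ a\<close> of the cyclotomic field that fixes all roots of unity whose order is less divisible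
  by \<open>p\<close> than \<open>2 * R\<close>. The product of the differences \<open>y ^ a - y\<close> kills all the \<open>y i\<close>, but not \<open>e\<close>.\<close>

theorem primitive_root_not_in_rational_span:
  fixes y :: "'i \<Rightarrow> complex" and c :: "'i \<Rightarrow> int" and e :: complex
  assumes "R > 0" and e: "\<And>m. e ^ m = 1 \<longleftrightarrow> 2 * R dvd m"
  assumes y: "\<And>i. i \<in> I \<Longrightarrow> \<exists>s. 1 \<le> s \<and> s < R \<and> y i ^ s = -1"
  assumes eq: "of_int D * e = (\<Sum>i\<in>I. of_int (c i) * y i)" and "finite I"
  shows "D = 0"
proof -
  \<comment> \<open>A common multiple of all orders involved: \<open>y i\<close> has order dividing
    \<open>2 * s\<close> with \<open>s < R\<close>, and \<open>e\<close> has order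
    \<open>2 * R\<close>.\<close>
  define N :: nat where "N = 2 * fact R"
  have N: "N > 0" by (simp add: N_def)
  have dvdN: "2 * s dvd N" if "1 \<le> s" "s \<le> R" for s
    using that by (simp add: N_def dvd_fact)
  \<comment> \<open>For odd \<open>R\<close> the prime 2 would have \<open>k 2 = 1\<close>, where no
    exponent exists. In that case evenness of the order of \<open>y i\<close> comes directly from
    \<open>y i ^ s = -1\<close>.\<close>
  define P where "P = {p. prime p \<and> p dvd 2 * R \<and> (p = 2 \<longrightarrow> even R)}"
  have "finite P" unfolding P_def using assms(1)
    by (intro finite_subset[OF _ finite_divisors_nat[of "2 * R"]]) auto
  define k where "k p = multiplicity p (2 * R)" for p
  define M where "M p = N div p ^ multiplicity p N" for p
  have kdvd: "p ^ k p dvd 2 * R" for p by (simp add: k_def multiplicity_dvd)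
  have k1: "k p \<ge> 1" if "p \<in> P" for p
    using that assms(1) unfolding k_def P_def
    by (intro multiplicity_geI) (auto simp: not_prime_unit)
  have k2: "k p \<ge> 2" if "p \<in> P" "p = 2" for p
  proof -
    have "(2::nat) ^ 2 dvd 2 * R" using that by (auto simp: P_def)
    then show ?thesis unfolding k_def that(2) using assms(1) by (intro multiplicity_geI) auto
  qed
  have RN: "2 * R dvd N" using dvdN[of R] assms(1) by simp
  have "\<exists>a. coprime a N \<and> M p * p ^ (k p - 1) dvd a - 1 \<and> \<not> p ^ k p dvd a - 1 \<and> a > 0" if "p \<in> P" for p
    using exists_galois_exponent[OF N, of p "k p"] that k1 k2 kdvd RN dvd_trans
    unfolding M_def P_def by (metis (no_types, lifting) mem_Collect_eq)
  then obtain a where a: "\<And>p. p \<in> P \<Longrightarrow> coprime (a p) N"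
      "\<And>p. p \<in> P \<Longrightarrow> M p * p ^ (k p - 1) dvd a p - 1"
      "\<And>p. p \<in> P \<Longrightarrow> \<not> p ^ k p dvd a p - 1" "\<And>p. p \<in> P \<Longrightarrow> a p > 0"
    by metis
  have NM: "N = M p * p ^ multiplicity p N" for p
    unfolding M_def by (simp add: multiplicity_dvd)
  have pM: "p ^ multiplicity p N dvd M q" if "p \<in> P" "q \<in> P" "p \<noteq> q" for p q
  proof -
    have "p ^ multiplicity p N dvd M q * q ^ multiplicity q N"
      using multiplicity_dvd[of p N] NM[of q] by metis
    moreover have "coprime (p ^ multiplicity p N) (q ^ multiplicity q N)"
      using that unfolding P_def by (simp add: primes_coprime)
    ultimately show ?thesis by (simp add: coprime_dvd_mult_left_iff)
  qed
  have kN: "p ^ k p dvd p ^ multiplicity p N" for p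
    unfolding k_def by (intro le_imp_power_dvd dvd_imp_multiplicity_le RN) (use N in auto)
  have inj: "a p \<noteq> a q" if "p \<in> P" "q \<in> P" "p \<noteq> q" for p q
  proof
    assume "a p = a q"
    have "p ^ k p dvd M q" using pM[OF that] kN dvd_trans by blast
    then have "p ^ k p dvd a q - 1" using a(2)[OF that(2)] by (metis dvd_mult_left dvd_trans)
    then show False using a(3)[OF that(1)] \<open>a p = a q\<close> by simp
  qed
  obtain ps where ps: "set ps = P" "distinct ps" using finite_distinct_list[OF \<open>finite P\<close>] by blast
  define as where "as = map a ps"
  have as: "set as = a ` P" "distinct as"
    using ps inj unfolding as_def by (auto simp: distinct_map inj_on_def)
  have yN: "y i ^ N = 1" if "i \<in> I" for i
  proof -
    obtain s where s: "1 \<le> s" "s < R" "y i ^ s = -1" using y[OF \<open>i \<in> I\<close>] by blast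
    then obtain t where "N = s * 2 * t" using dvdN[of s] by (auto elim!: dvdE)
    then show ?thesis by (simp add: power_mult s)
  qed
  have eN: "e ^ N = 1" using e RN by simp
  have kill: "galois_diff as (y i) = 0" if "i \<in> I" for i
  proof -
    obtain s where s: "1 \<le> s" "s < R" "y i ^ s = -1" using y[OF \<open>i \<in> I\<close>] by blast
    obtain n where n: "n > 0" "\<And>m. y i ^ m = 1 \<longleftrightarrow> n dvd m"
      using root_of_unity_order[OF yN[OF \<open>i \<in> I\<close>] N] by blast
    have "y i ^ (s * 2) = 1" by (simp only: power_mult s) simp
    then have n2s: "n dvd s * 2" using n(2) by blast
    have "y i ^ s \<noteq> 1" using s(3) by simp
    then have ns: "\<not> n dvd s" using n(2) by blast
    have nN: "n dvd N" using n yN[OF that] by simp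
    \<comment> \<open>If no chosen automorphism fixes \<open>y i\<close>, its order \<open>n\<close>
      is divisible by every \<open>p ^ k p\<close>, hence by \<open>2 * R\<close>; but
      \<open>n\<close> divides \<open>2 * s\<close>, which is smaller.\<close>
    have "\<exists>p\<in>P. n dvd a p - 1"
    proof (rule ccontr)
      assume contra: "\<not> ?thesis"
      have pk: "k p \<le> multiplicity p n" if "p \<in> P" for p
      proof (rule ccontr)
        assume "\<not> k p \<le> multiplicity p n"
        then have le: "multiplicity p n \<le> k p - 1" by simp
        have pp: "prime p" using that by (simp add: P_def)
        obtain n' where n': "n = p ^ multiplicity p n * n'" "\<not> p dvd n'"
          using multiplicity_decompose'[of n p] n(1) pp not_prime_unit by (metis gr_implies_not0)
        have "n' dvd M p * p ^ multiplicity p N" using nN n'(1) NM[of p] by (metis dvd_mult_right)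
        moreover have "coprime n' (p ^ multiplicity p N)"
          using n'(2) pp by (metis coprime_commute coprime_power_left_iff prime_imp_coprime)
        ultimately have "n' dvd M p" by (simp add: coprime_dvd_mult_left_iff)
        then have "n dvd M p * p ^ (k p - 1)"
          using n'(1) le by (metis le_imp_power_dvd mult.commute mult_dvd_mono)
        then show False using contra a(2)[OF that] that dvd_trans by blast
      qed
      have "2 * R dvd n"
      proof (rule multiplicity_le_imp_dvd)
        fix p :: nat assume p: "prime p"
        consider "p \<in> P" | "\<not> p dvd 2 * R" | "p = 2" "odd R" using p unfolding P_def by blast
        then show "multiplicity p (2 * R) \<le> multiplicity p n"
        proof cases
          case 1
          then show ?thesis using pk k_def by simp
        next
          case 3
          have "even n"
          proof (rule ccontr)
            assume "odd n"
            then have "coprime n 2" by simp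
            then show False using n2s ns by (simp add: coprime_dvd_mult_left_iff)
          qed
          then have "multiplicity 2 n \<ge> 1" using n(1) by (simp add: multiplicity_geI)
          moreover have "multiplicity 2 (2 * R) = 1"
            using 3(2) assms(1) by (intro multiplicity_eqI) auto
          ultimately show ?thesis using 3 by simp
        qed (simp add: not_dvd_imp_multiplicity_0)
      qed (use assms(1) in auto)
      then have "2 * R \<le> n" using n(1) by (simp add: dvd_imp_le)
      also have "n \<le> s * 2" using n2s s by (intro dvd_imp_le) auto
      finally show False using s by simp
    qed
    then obtain p where p: "p \<in> P" "n dvd a p - 1" by blast
    then have "y i ^ (a p - 1) = 1" using n by simp
    moreover have "y i ^ a p = y i * y i ^ (a p - 1)" using a(4)[OF p(1)] by (cases "a p") auto
    ultimately have "y i ^ a p = y i" by simp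
    then show ?thesis using galois_diff_eq_0[of "a p" as] p as by blast
  qed
  have e0: "e \<noteq> 0" using eN N by (metis power_0_left not_gr_zero zero_neq_one)
  have "galois_diff as e = e * (\<Prod>x\<leftarrow>as. e ^ (x - 1) - 1)"
  proof (rule galois_diff_eq_prod[OF eN])
    fix x z assume xz: "x \<in> set as" "z \<in> set as" "x \<noteq> z"
    then obtain p q where pq: "p \<in> P" "q \<in> P" "x = a p" "z = a q" "p \<noteq> q" using as by blast
    have "p ^ multiplicity p N dvd a q - 1"
      using pM[of p q] a(2)[of q] pq by (metis dvd_mult_left dvd_trans)
    moreover have "M p dvd a p - 1" using a(2)[of p] pq by (metis dvd_mult_left)
    ultimately have "M p * p ^ multiplicity p N dvd (a p - 1) * (a q - 1)" by (intro mult_dvd_mono)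
    then show "N dvd (x - 1) * (z - 1)" using NM[of p] pq by simp
  qed (use as a in auto)
  moreover have "(\<Prod>x\<leftarrow>as. e ^ (x - 1) - 1) \<noteq> 0"
  proof -
    have "e ^ (a p - 1) \<noteq> 1" if "p \<in> P" for p
      using e a(3)[OF that] kdvd[of p] dvd_trans by blast
    then show ?thesis using as by (auto simp: prod_list_zero_iff)
  qed
  ultimately have ne: "galois_diff as e \<noteq> 0" using e0 by simp
  \<comment> \<open>The term with \<open>e\<close> is moved to the other side and becomes the
    summand at \<open>None\<close>, so that \<open>galois_diff_relation\<close> covers the whole
    equation.\<close>
  define y' where "y' j = (case j of None \<Rightarrow> e | Some i \<Rightarrow> y i)" for j
  define c' where "c' j = (case j of None \<Rightarrow> - D | Some i \<Rightarrow> c i)" for j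
  have "(\<Sum>j\<in>insert None (Some ` I). of_int (c' j) * galois_diff as (y' j)) = 0"
    by (rule galois_diff_relation[OF N])
       (use eN yN as a eq \<open>finite I\<close> in \<open>auto simp: y'_def c'_def sum.reindex\<close>)
  then have "of_int D * galois_diff as e = (\<Sum>i\<in>I. of_int (c i) * galois_diff as (y i))"
    using \<open>finite I\<close> by (simp add: y'_def c'_def sum.reindex)
  also have "\<dots> = 0" using kill by simp
  finally show ?thesis using ne by simp
qed

section \<open>Linear functionals over the rationals\<close>

interpretation rat_complex: vector_space "\<lambda>(r::rat) (x::complex). of_rat r * x"
  by standard (auto simp: algebra_simps of_rat_add of_rat_mult)

interpretation rat_complex_pair: vector_space_pair
  "\<lambda>(r::rat) (x::complex). of_rat r * x" "\<lambda>(r::rat) (x::complex). of_rat r * x" ..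

lemma common_denominator:
  fixes r :: "'i \<Rightarrow> rat"
  assumes "finite I"
  obtains D :: int and c :: "'i \<Rightarrow> int" where "D \<noteq> 0" "\<And>i. i \<in> I \<Longrightarrow> of_int D * r i = of_int (c i)"
proof -
  have "\<exists>D::int. D \<noteq> 0 \<and> (\<forall>i\<in>I. \<exists>n::int. of_int D * r i = of_int n)"
    using assms
  proof (induction I)
    case (insert i I)
    then obtain D :: int where D: "D \<noteq> 0" "\<forall>i\<in>I. \<exists>n::int. of_int D * r i = of_int n" by blast
    obtain a b where ab: "quotient_of (r i) = (a, b)" by fastforce
    then have b: "b > 0" "r i = of_int a / of_int b"
      using quotient_of_denom_pos quotient_of_div by blast+
    have "\<exists>n::int. of_int (D * b) * r j = of_int n" if j: "j \<in> insert i I" for j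
    proof (cases "j = i")
      case True
      then have "of_int (D * b) * r j = of_int (D * a)" using b by simp
      then show ?thesis by blast
    next
      case False
      then obtain n :: int where "of_int D * r j = of_int n" using D j by auto
      then have "of_int (D * b) * r j = of_int (n * b)" by (simp add: mult_ac)
      then show ?thesis by blast
    qed
    then show ?case using D b by (intro exI[of _ "D * b"]) auto
  qed (auto intro: exI[of _ 1])
  then show ?thesis using that by metis
qed

lemma cis_power_eq_1_iff:
  assumes "R > 0"
  shows "cis (- pi / real R) ^ m = 1 \<longleftrightarrow> 2 * R dvd m"
proof -
  have "cis (- pi / real R) ^ m = inverse (exp (2 * of_real pi * \<i> * of_nat m / of_nat (2 * R)))"
    using assms
    by (simp add: cis_conv_exp flip: exp_of_nat_mult exp_minus) (simp add: field_simps)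
  also have "\<dots> = 1 \<longleftrightarrow> exp (2 * of_real pi * \<i> * of_nat m / of_nat (2 * R)) = 1"
    by simp
  also have "\<dots> \<longleftrightarrow> 2 * R dvd m"
    using complex_root_unity_eq_1[of "2 * R" m] assms by simp
  finally show ?thesis .
qed

text \<open>Clearing denominators in the preceding theorem shows that \<open>cis (- pi / R)\<close>
  is outside the rational span of the older roots, so the values can be prescribed on a basis and
  extended. The inverse root is used because the exponents contain \<open>1 / q\<close>, not
  \<open>q\<close>; the inverses of the older roots are again older roots.\<close>

lemma exists_rational_functional:
  assumes R: "R > 0"
  obtains \<mu> :: "complex \<Rightarrow> complex" where
    "\<And>x y. \<mu> (x + y) = \<mu> x + \<mu> y" "\<And>r x. \<mu> (of_rat r * x) = of_rat r * \<mu> x"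
    "\<And>y s. 1 \<le> s \<Longrightarrow> s < R \<Longrightarrow> y ^ s = -1 \<Longrightarrow> \<mu> y = 0"
    "\<mu> (cis (- pi / real R)) = 1"
proof -
  define e where "e = cis (- pi / real R)"
  define Y where "Y = {y::complex. \<exists>s. 1 \<le> s \<and> s < R \<and> y ^ s = -1}"
  have e: "e \<notin> rat_complex.span Y"
  proof
    assume "e \<in> rat_complex.span Y"
    then obtain t r where t: "finite t" "t \<subseteq> Y" "e = (\<Sum>a\<in>t. of_rat (r a) * a)"
      unfolding rat_complex.span_explicit by auto
    obtain D :: int and c where D: "D \<noteq> 0" "\<And>a. a \<in> t \<Longrightarrow> of_int D * r a = of_int (c a)"
      using common_denominator[OF t(1), of r] by metis
    have "of_int D * e = (\<Sum>a\<in>t. of_int D * of_rat (r a) * a)"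
      by (simp add: t(3) sum_distrib_left mult.assoc)
    also have "\<dots> = (\<Sum>a\<in>t. of_int (c a) * a)"
    proof (rule sum.cong)
      fix a assume "a \<in> t"
      then have "(of_rat (of_int D * r a) :: complex) = of_rat (of_int (c a))" using D by simp
      then show "of_int D * of_rat (r a) * a = of_int (c a) * a" by (simp add: of_rat_mult)
    qed simp
    finally have "of_int D * e = (\<Sum>a\<in>t. of_int (c a) * a)" .
    from primitive_root_not_in_rational_span[OF R _ _ this t(1)]
    have "D = 0" using cis_power_eq_1_iff[OF R] t(2) unfolding e_def Y_def by blast
    then show False using D by simp
  qed
  obtain B where B: "B \<subseteq> Y" "rat_complex.independent B" "Y \<subseteq> rat_complex.span B"
    using rat_complex.maximal_independent_subset[of Y] by blast
  have eB: "e \<notin> rat_complex.span B"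
    using e B(1) rat_complex.span_mono by blast
  have "rat_complex.independent (insert e B)"
    using eB B(2) by (rule rat_complex.independent_insertI)
  then obtain \<mu> where \<mu>: "Vector_Spaces.linear (\<lambda>(r::rat) (x::complex). of_rat r * x) (\<lambda>(r::rat) (x::complex). of_rat r * x) \<mu>"
     "\<forall>x\<in>insert e B. \<mu> x = (if x = e then 1 else 0)"
    using rat_complex_pair.linear_independent_extend[of "insert e B" "\<lambda>x. if x = e then 1 else 0"] by blast
  then interpret \<mu>: Vector_Spaces.linear "\<lambda>(r::rat) (x::complex). of_rat r * x" "\<lambda>(r::rat) (x::complex). of_rat r * x" \<mu>
    by simp
  have \<mu>B: "\<mu> b = 0" if "b \<in> B" for b
    using \<mu>(2) that eB rat_complex.span_base by auto
  have span0: "\<mu> y = 0" if "y \<in> rat_complex.span B" for y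
    using that by (rule rat_complex.span_induct_alt) (auto simp: \<mu>.zero \<mu>.add \<mu>.scale \<mu>B)
  show ?thesis
  proof
    show "\<mu> y = 0" if "1 \<le> s" "s < R" "y ^ s = -1" for y s
      using that B(3) span0 unfolding Y_def by blast
    show "\<mu> (cis (- pi / real R)) = 1" using \<mu>(2) e_def by simp
  qed (auto simp: \<mu>.add \<mu>.scale)
qed

section \<open>Independence of exponentials over functions of polynomial growth\<close>

text \<open>The summands bound head and tail of the Taylor series in
  \<open>half_plane_uniqueness\<close>, cut at order about \<open>\<rho> powr \<gamma>\<close>. The
  head is small because \<open>\<gamma> < \<beta>\<close>, the tail because
  \<open>\<gamma> > 1\<close>.\<close>

lemma superexponential_tendsto_0:
  fixes \<beta> \<gamma> \<delta> l c C C' :: real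
  assumes "1 < \<gamma>" "\<gamma> < \<beta>" "\<delta> > 0" "l > 0" "c > 0"
  shows "((\<lambda>\<rho>. (\<rho> powr \<gamma> + 1) * (C' * exp (- \<delta> * \<rho> powr \<beta>)) * exp (l * (\<rho> powr \<gamma> + 1))
     + C * exp (- (\<rho> powr \<gamma>) * c / \<rho>) * (\<rho> / c)) \<longlongrightarrow> 0) at_top"
  using assms by real_asymp

text \<open>The Taylor coefficients at \<open>\<rho>\<close> are small up to an order much larger than \<open>\<rho>\<close>, so the
  Taylor series at \<open>\<rho>\<close> gives a small value at the fixed point \<open>x\<close>.\<close>

lemma half_plane_uniqueness:
  fixes G :: "complex \<Rightarrow> complex"
  assumes holo: "G holomorphic_on {z. Re z > 0}"
    and bound: "\<And>z. Re z > 0 \<Longrightarrow> norm (G z) \<le> C"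
    and small: "\<And>\<rho> z. \<rho> \<ge> \<rho>0 \<Longrightarrow> norm (z - of_real \<rho>) \<le> \<kappa> * \<rho> \<Longrightarrow> norm (G z) \<le> C' * exp (- \<delta> * \<rho> powr \<beta>)"
    and par: "\<beta> > 1" "\<delta> > 0" "0 < \<kappa>" "\<kappa> < 1" and x: "x > 0"
  shows "G (of_real x) = 0"
proof -
  define \<gamma> where "\<gamma> = (1 + \<beta>) / 2"
  have \<gamma>: "1 < \<gamma>" "\<gamma> < \<beta>" using par by (auto simp: \<gamma>_def)
  define l where "l = ln (1 / \<kappa>)"
  have l: "l > 0" using par by (simp add: l_def)
  have C: "C \<ge> 0" using bound[of 1] norm_ge_zero[of "G 1"] by (simp del: norm_ge_zero)
  define B where "B \<rho> = (\<rho> powr \<gamma> + 1) * (C' * exp (- \<delta> * \<rho> powr \<beta>)) * exp (l * (\<rho> powr \<gamma> + 1))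
     + C * exp (- (\<rho> powr \<gamma>) * (x / 2) / \<rho>) * (\<rho> / (x / 2))" for \<rho>
  have "(B \<longlongrightarrow> 0) at_top"
    unfolding B_def using \<gamma> par x l by (intro superexponential_tendsto_0) auto
  moreover have "eventually (\<lambda>\<rho>. norm (G (of_real x)) \<le> B \<rho>) at_top"
    using eventually_gt_at_top[of "max 1 (max \<rho>0 (max x (x / (1 - \<kappa>))))"]
  proof eventually_elim
    case (elim \<rho>)
    then have \<rho>: "\<rho> > 1" "\<rho> > \<rho>0" "\<rho> > x" "\<rho> > x / (1 - \<kappa>)" by auto
    \<comment> \<open>The disc of radius \<open>s\<close> about \<open>\<rho>\<close> ends at
      \<open>x / 2\<close> on the real axis: it contains \<open>x\<close> and stays in the
      half-plane.\<close>
    define s where "s = \<rho> - x / 2"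
    have s: "0 < s" "s < \<rho>" "\<rho> - x < s" using \<rho> x by (auto simp: s_def)
    have \<kappa>s: "\<kappa> * \<rho> < s"
      using \<rho>(4) x par by (simp add: s_def field_simps)
    define m where "m = C' * exp (- \<delta> * \<rho> powr \<beta>)"
    define a where "a n = (deriv ^^ n) G (of_real \<rho>) / fact n" for n
    have sub: "cball (of_real \<rho>) s \<subseteq> {z. Re z > 0}"
    proof
      fix z assume "z \<in> cball (complex_of_real \<rho>) s"
      then have "\<bar>Re (of_real \<rho> - z)\<bar> \<le> s"
        by (metis abs_Re_le_cmod dist_norm mem_cball order_trans)
      then show "z \<in> {z. Re z > 0}" using s by auto
    qed
    have holo_s: "G holomorphic_on cball (of_real \<rho>) r" if "r \<le> s" for r
      using holo sub that by (meson holomorphic_on_subset subset_cball)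
    \<comment> \<open>Two Cauchy estimates: the large disc offers only boundedness and serves the
      tail; the disc of radius \<open>\<kappa> * \<rho>\<close> offers the decay and serves the
      head.\<close>
    have a1: "norm (a n) \<le> C / s ^ n" for n
    proof -
      have "norm ((deriv ^^ n) G (of_real \<rho>)) \<le> fact n * C / s ^ n"
      proof (rule Cauchy_inequality)
        show "G holomorphic_on ball (complex_of_real \<rho>) s"
          using holo_s by (meson ball_subset_cball holomorphic_on_subset order_refl)
        show "continuous_on (cball (complex_of_real \<rho>) s) G"
          using holo_s[OF order_refl] by (rule holomorphic_on_imp_continuous_on)
        show "norm (G z) \<le> C" if "norm (of_real \<rho> - z) = s" for z
          using that sub by (intro bound) (auto simp: dist_norm)
      qed (use s in auto)
      then show ?thesis by (simp add: a_def norm_divide field_simps)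
    qed
    have a2: "norm (a n) \<le> m / (\<kappa> * \<rho>) ^ n" for n
    proof -
      have "norm ((deriv ^^ n) G (of_real \<rho>)) \<le> fact n * m / (\<kappa> * \<rho>) ^ n"
      proof (rule Cauchy_inequality)
        show "G holomorphic_on ball (complex_of_real \<rho>) (\<kappa> * \<rho>)"
          using holo_s[of "\<kappa> * \<rho>"] \<kappa>s by (meson ball_subset_cball holomorphic_on_subset less_imp_le)
        show "continuous_on (cball (complex_of_real \<rho>) (\<kappa> * \<rho>)) G"
          using holo_s[of "\<kappa> * \<rho>"] \<kappa>s by (intro holomorphic_on_imp_continuous_on) auto
        show "norm (G z) \<le> m" if "norm (of_real \<rho> - z) = \<kappa> * \<rho>" for z
          unfolding m_def using that \<rho> by (intro small) (auto simp: norm_minus_commute)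
      qed (use \<rho> par in auto)
      then show ?thesis by (simp add: a_def norm_divide field_simps)
    qed
    have m0: "m \<ge> 0" using a2[of 0] norm_ge_zero[of "a 0"] by (simp del: norm_ge_zero)
    define q where "q = (\<rho> - x) / s"
    have q: "0 \<le> q" "q < 1" using s \<rho> by (auto simp: q_def)
    have q1: "1 - q = (x / 2) / s" using s by (simp add: q_def s_def field_simps)
    have sums: "(\<lambda>n. a n * (of_real x - of_real \<rho>) ^ n) sums G (of_real x)"
      unfolding a_def
    proof (rule holomorphic_power_series)
      show "G holomorphic_on ball (complex_of_real \<rho>) s"
        using holo_s by (meson ball_subset_cball holomorphic_on_subset order_refl)
      show "complex_of_real x \<in> ball (complex_of_real \<rho>) s"
        using s \<rho> by (simp add: dist_norm flip: of_real_diff)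
    qed
    have nw: "norm (complex_of_real x - of_real \<rho>) = \<rho> - x"
      using \<rho> by (simp flip: of_real_diff)
    have t1: "norm (a n * (of_real x - of_real \<rho>) ^ n) \<le> C * q ^ n" for n
    proof -
      have "norm (a n * (of_real x - of_real \<rho>) ^ n) = norm (a n) * (\<rho> - x) ^ n"
        by (simp add: norm_mult norm_power nw)
      also have "\<dots> \<le> C / s ^ n * (\<rho> - x) ^ n"
        using \<rho> by (intro mult_right_mono a1) auto
      finally show ?thesis by (simp add: q_def power_divide)
    qed
    have t2: "norm (a n * (of_real x - of_real \<rho>) ^ n) \<le> m * (1 / \<kappa>) ^ n" for n
    proof -
      have "norm (a n * (of_real x - of_real \<rho>) ^ n) = norm (a n) * (\<rho> - x) ^ n"
        by (simp add: norm_mult norm_power nw)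
      also have "\<dots> \<le> m / (\<kappa> * \<rho>) ^ n * \<rho> ^ n"
        using \<rho> x par m0 by (intro mult_mono a2 power_mono) auto
      also have "\<dots> = m * (1 / \<kappa>) ^ n" using \<rho> by (simp add: power_mult_distrib power_divide)
      finally show ?thesis .
    qed
    define K where "K = nat \<lceil>\<rho> powr \<gamma>\<rceil>"
    have K: "\<rho> powr \<gamma> \<le> K" "K \<le> \<rho> powr \<gamma> + 1"
      using powr_ge_zero[of \<rho> \<gamma>] unfolding K_def by linarith+
    define u where "u n = a n * (of_real x - of_real \<rho>) ^ n" for n
    have summq: "summable (\<lambda>n. C * q ^ (n + K))"
      using q by (intro summable_mult summable_ignore_initial_segment summable_geometric) auto
    have summu: "summable (\<lambda>n. u (n + K))"
      using sums unfolding u_def by (intro summable_ignore_initial_segment) (rule sums_summable)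
    have "G (of_real x) = (suminf (\<lambda>n. u (n + K))) + (\<Sum>n<K. u n)"
      using sums unfolding u_def[symmetric] by (metis sums_summable sums_unique suminf_split_initial_segment)
    then have "norm (G (of_real x)) \<le> norm (suminf (\<lambda>n. u (n + K))) + norm (\<Sum>n<K. u n)"
      using norm_triangle_ineq by metis
    moreover have "norm (suminf (\<lambda>n. u (n + K))) \<le> C * exp (- (\<rho> powr \<gamma>) * (x / 2) / \<rho>) * (\<rho> / (x / 2))"
    proof -
      have "norm (suminf (\<lambda>n. u (n + K))) \<le> (suminf (\<lambda>n. C * q ^ (n + K)))"
        using t1 by (intro norm_suminf_le summq) (simp add: u_def)
      also have "(suminf (\<lambda>n. C * q ^ (n + K))) = (suminf (\<lambda>n. C * q ^ K * q ^ n))"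
        by (simp add: power_add mult_ac)
      also have "\<dots> = C * q ^ K * (1 / (1 - q))"
        using q by (simp add: suminf_mult summable_geometric suminf_geometric)
      also have "\<dots> \<le> C * exp (- (\<rho> powr \<gamma>) * (x / 2) / \<rho>) * (\<rho> / (x / 2))"
      proof (intro mult_mono)
        show "1 / (1 - q) \<le> \<rho> / (x / 2)"
          unfolding q1 using x s by (simp add: field_simps)
        have "(x / 2) / \<rho> \<le> 1 - q" unfolding q1 using x s \<rho> by (intro divide_left_mono) auto
        then have "q \<le> 1 - (x / 2) / \<rho>" by simp
        also have "\<dots> \<le> exp (- ((x / 2) / \<rho>))" using exp_ge_add_one_self[of "- ((x / 2) / \<rho>)"] by simp
        finally have "q ^ K \<le> exp (- ((x / 2) / \<rho>)) ^ K" using q by (intro power_mono) auto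
        also have "\<dots> = exp (- (K * ((x / 2) / \<rho>)))" by (simp flip: exp_of_nat_mult)
        also have "\<dots> \<le> exp (- (\<rho> powr \<gamma> * ((x / 2) / \<rho>)))"
          using mult_right_mono[OF K(1), of "(x / 2) / \<rho>"] x \<rho> by simp
        finally show "q ^ K \<le> exp (- (\<rho> powr \<gamma>) * (x / 2) / \<rho>)" by simp
      qed (use C q x \<rho> in auto)
      finally show ?thesis .
    qed
    moreover have "norm (\<Sum>n<K. u n) \<le> (\<rho> powr \<gamma> + 1) * m * exp (l * (\<rho> powr \<gamma> + 1))"
    proof -
      have "norm (u n) \<le> m * (1 / \<kappa>) ^ K" if n: "n \<in> {..<K}" for n
      proof -
        have "norm (u n) \<le> m * (1 / \<kappa>) ^ n" using t2 by (simp add: u_def)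
        also have "\<dots> \<le> m * (1 / \<kappa>) ^ K"
          using n par m0 by (intro mult_left_mono power_increasing) auto
        finally show ?thesis .
      qed
      then have "norm (\<Sum>n<K. u n) \<le> (\<Sum>n<K. m * (1 / \<kappa>) ^ K)" by (rule sum_norm_le)
      also have "\<dots> = K * m * (1 / \<kappa>) ^ K" by simp
      also have "(1 / \<kappa>) ^ K = exp (l * K)"
        using par by (simp add: l_def exp_of_nat2_mult)
      also have "K * m * exp (l * K) \<le> (\<rho> powr \<gamma> + 1) * m * exp (l * (\<rho> powr \<gamma> + 1))"
        using K m0 l powr_ge_zero[of \<rho> \<gamma>] by (intro mult_mono mult_right_mono) auto
      finally show ?thesis .
    qed
    ultimately show ?case by (simp add: B_def m_def)
  qed
  ultimately have "norm (G (of_real x)) \<le> 0"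
    by (intro tendsto_lowerbound[where F = at_top and f = B]) auto
  then show ?thesis by simp
qed

text \<open>A function \<open>h\<close> on the strip stands for \<open>u \<mapsto> h (Ln u)\<close> on the part \<open>norm u > 1\<close> of the sector
  of opening \<open>pi + 2 * \<eta>\<close>; thus \<open>exp (K * Re v)\<close> is the power \<open>norm u ^ K\<close>.\<close>

definition strip :: "real \<Rightarrow> complex set" where
  "strip \<eta> = {v. 0 < Re v \<and> \<bar>Im v\<bar> < pi / 2 + \<eta>}"

lemma open_strip: "open (strip \<eta>)"
  unfolding strip_def by (intro open_Collect_conj open_Collect_less continuous_intros)

lemma convex_strip: "convex (strip \<eta>)"
proof -
  have "strip \<eta> = {v. Re v > 0} \<inter> ({v. Im v < pi / 2 + \<eta>} \<inter> {v. Im v > - (pi / 2 + \<eta>)})"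
    by (auto simp: strip_def)
  then show ?thesis
    by (simp add: convex_Int convex_halfspace_Re_gt convex_halfspace_Im_lt convex_halfspace_Im_gt)
qed

lemma connected_strip: "connected (strip \<eta>)"
  by (simp add: convex_connected convex_strip)

lemma strip_analytic_continuation_ray:
  assumes "h holomorphic_on strip \<eta>" "\<bar>\<theta>\<bar> < pi / 2 + \<eta>"
    and "\<And>t. t > t0 \<Longrightarrow> h (Complex t \<theta>) = 0" and "t0 \<ge> 0" "v \<in> strip \<eta>"
  shows "h v = 0"
proof (rule analytic_continuation[OF assms(1) open_strip connected_strip])
  show "(\<lambda>t. Complex t \<theta>) ` {t0<..} \<subseteq> strip \<eta>" "Complex (t0 + 1) \<theta> \<in> strip \<eta>"
    using assms by (auto simp: strip_def)
  show "Complex (t0 + 1) \<theta> islimpt (\<lambda>t. Complex t \<theta>) ` {t0<..}"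
    unfolding islimpt_approachable
  proof (intro allI impI)
    fix e :: real assume "e > 0"
    then show "\<exists>x'\<in>(\<lambda>t. Complex t \<theta>) ` {t0<..}. x' \<noteq> Complex (t0 + 1) \<theta> \<and> dist x' (Complex (t0 + 1) \<theta>) < e"
      by (intro bexI[of _ "Complex (t0 + 1 + e / 2) \<theta>"])
         (auto simp: dist_norm complex_diff complex_norm)
  qed
qed (use assms in auto)

text \<open>The map \<open>V\<close> sends a half-plane to a sector of opening \<open>pi * \<beta> > pi\<close>, which turns exponential
  decay into decay of order \<open>\<beta> > 1\<close>.\<close>

theorem strip_uniqueness:
  fixes h :: "complex \<Rightarrow> complex"
  assumes \<eta>: "\<eta> > 0" and \<theta>0: "\<bar>\<theta>0\<bar> < \<eta> / 2" and K: "K \<ge> 0"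
    and holo: "h holomorphic_on strip \<eta>"
    and bound: "\<And>v. v \<in> strip \<eta> \<Longrightarrow> norm (h v) \<le> C * exp (K * Re v)"
    and small: "\<And>v. v \<in> strip \<eta> \<Longrightarrow> Re v \<ge> x0 \<Longrightarrow> \<bar>Im v - \<theta>0\<bar> < \<tau> \<Longrightarrow>
      norm (h v) \<le> C' * exp (- \<delta> * exp (Re v))"
    and \<tau>: "\<tau> > 0" and \<delta>: "\<delta> > 0" and v: "v \<in> strip \<eta>"
  shows "h v = 0"
proof -
  \<comment> \<open>The image of the half-plane has opening \<open>pi + \<eta>\<close>. Turned by
    \<open>\<theta>0\<close>, which is less than \<open>\<eta> / 2\<close> in size, it still lies in
    the strip.\<close>
  define \<beta> where "\<beta> = 1 + \<eta> / pi"
  have \<beta>: "\<beta> > 1" "\<beta> * (pi / 2) = pi / 2 + \<eta> / 2" "\<beta> > 0"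
    using \<eta> by (auto simp: \<beta>_def field_simps add_pos_pos)
  \<comment> \<open>The shift by 1 gives \<open>norm (\<xi> + 1) > 1\<close>, hence
    \<open>Re (V \<xi>) > 0\<close>.\<close>
  define V where "V \<xi> = \<i> * of_real \<theta>0 + of_real \<beta> * Ln (\<xi> + 1)" for \<xi>
  have V_holo: "V holomorphic_on {z. Re z > 0}"
    unfolding V_def by (intro holomorphic_intros) (auto simp: complex_nonpos_Reals_iff)
  have ReV: "Re (V \<xi>) = \<beta> * ln (norm (\<xi> + 1))" if "Re \<xi> > 0" for \<xi>
  proof -
    have "\<xi> + 1 \<noteq> 0" using that by (auto simp: complex_eq_iff)
    then show ?thesis by (simp add: V_def)
  qed
  have norm_gt: "norm (\<xi> + 1) > 1" if "Re \<xi> > 0" for \<xi>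
    using that complex_Re_le_cmod[of "\<xi> + 1"] by simp
  have ImV: "Im (V \<xi>) - \<theta>0 = \<beta> * Im (Ln (\<xi> + 1))" for \<xi> by (simp add: V_def)
  have V_strip: "V \<xi> \<in> strip \<eta>" if "Re \<xi> > 0" for \<xi>
  proof -
    have "\<bar>Im (Ln (\<xi> + 1))\<bar> < pi / 2"
      using that by (intro Re_Ln_pos_lt_imp) auto
    then have "\<beta> * \<bar>Im (Ln (\<xi> + 1))\<bar> < \<beta> * (pi / 2)" using \<beta> by (intro mult_strict_left_mono) auto
    then have "\<bar>Im (V \<xi>) - \<theta>0\<bar> < pi / 2 + \<eta> / 2"
      using \<beta>(1) unfolding ImV \<beta>(2) by (simp add: abs_mult)
    then have "\<bar>Im (V \<xi>)\<bar> < pi / 2 + \<eta>" using \<theta>0 by linarith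
    moreover have "Re (V \<xi>) > 0"
      unfolding ReV[OF that] using norm_gt[OF that] \<beta>(3) by (intro mult_pos_pos ln_gt_zero) auto
    ultimately show ?thesis by (simp add: strip_def)
  qed
  \<comment> \<open>Division by the power \<open>u^K\<close> turns polynomial growth into
    boundedness.\<close>
  define G where "G \<xi> = h (V \<xi>) * exp (- of_real K * V \<xi>)" for \<xi>
  have "C \<ge> 0"
  proof -
    have "0 \<le> C * exp (K * Re v)" using bound[OF v] norm_ge_zero order_trans by blast
    then show ?thesis by (simp add: zero_le_mult_iff)
  qed
  have norm_exp_V: "norm (exp (- of_real K * V \<xi>)) = exp (- K * Re (V \<xi>))" for \<xi>
    by simp
  \<comment> \<open>A disc about \<open>\<rho>\<close> of radius \<open>\<kappa> * \<rho>\<close> is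
    seen from 0 with slopes of size at most \<open>\<kappa> / (1 - \<kappa>) = T\<close>. As
    \<open>V\<close> multiplies angles by \<open>\<beta>\<close>, its image stays within
    \<open>\<tau> / 2\<close> of \<open>\<theta>0\<close>. The cap \<open>pi / 4\<close> keeps the
    tangent finite.\<close>
  define T where "T = tan (min (\<tau> / (2 * \<beta>)) (pi / 4))"
  have min_bounds: "0 < min (\<tau> / (2 * \<beta>)) (pi / 4)" "min (\<tau> / (2 * \<beta>)) (pi / 4) < pi / 2"
  proof -
    show "0 < min (\<tau> / (2 * \<beta>)) (pi / 4)" using \<tau> \<beta>(3) by simp
    show "min (\<tau> / (2 * \<beta>)) (pi / 4) < pi / 2"
      using min.cobounded2[of "\<tau> / (2 * \<beta>)" "pi / 4"] pi_gt_zero by linarith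
  qed
  have T: "T > 0" unfolding T_def using min_bounds by (rule tan_gt_zero)
  have arctanT: "arctan T = min (\<tau> / (2 * \<beta>)) (pi / 4)"
    unfolding T_def using min_bounds by (intro arctan_tan) auto
  define \<kappa> where "\<kappa> = T / (1 + T)"
  have \<kappa>: "0 < \<kappa>" "\<kappa> < 1" "\<kappa> = T * (1 - \<kappa>)" using T by (auto simp: \<kappa>_def field_simps)
  define \<rho>0 where "\<rho>0 = max 1 (exp (x0 / \<beta>) / (1 - \<kappa>))"
  have G0: "G (of_real x) = 0" if "x > 0" for x
  proof (rule half_plane_uniqueness[where C = C and C' = C' and \<delta> = "\<delta> * (1 - \<kappa>) powr \<beta>" and \<beta> = \<beta> and \<kappa> = \<kappa> and ?\<rho>0.0 = \<rho>0])
    show "G holomorphic_on {z. Re z > 0}"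
      unfolding G_def using V_strip
      by (intro holomorphic_intros holomorphic_on_compose_gen[OF V_holo holo, unfolded o_def] V_holo) auto
    show "norm (G \<xi>) \<le> C" if "Re \<xi> > 0" for \<xi>
    proof -
      have "norm (G \<xi>) \<le> (C * exp (K * Re (V \<xi>))) * exp (- K * Re (V \<xi>))"
        unfolding G_def norm_mult norm_exp_V by (intro mult_right_mono bound V_strip that) auto
      also have "\<dots> = C" by (simp flip: exp_add)
      finally show ?thesis .
    qed
    show "norm (G z) \<le> C' * exp (- (\<delta> * (1 - \<kappa>) powr \<beta>) * \<rho> powr \<beta>)"
      if \<rho>: "\<rho> \<ge> \<rho>0" and z: "norm (z - of_real \<rho>) \<le> \<kappa> * \<rho>" for \<rho> z
    proof -
      have \<rho>1: "\<rho> \<ge> 1" "\<rho> \<ge> exp (x0 / \<beta>) / (1 - \<kappa>)" using \<rho> by (auto simp: \<rho>0_def)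
      have "\<bar>Re (z - of_real \<rho>)\<bar> \<le> \<kappa> * \<rho>" "\<bar>Im (z - of_real \<rho>)\<bar> \<le> \<kappa> * \<rho>"
        using z abs_Re_le_cmod abs_Im_le_cmod order_trans by blast+
      then have ri: "(1 - \<kappa>) * \<rho> \<le> Re z" "\<bar>Im z\<bar> \<le> \<kappa> * \<rho>" by (auto simp: algebra_simps)
      have pos: "(1 - \<kappa>) * \<rho> > 0" using \<kappa> \<rho>1 by simp
      then have Rez: "Re z > 0" using ri by linarith
      have nz: "(1 - \<kappa>) * \<rho> \<le> norm (z + 1)" using ri complex_Re_le_cmod[of "z + 1"] by simp
      have "\<bar>Im z\<bar> \<le> T * (Re z + 1)"
      proof -
        have "\<bar>Im z\<bar> \<le> T * ((1 - \<kappa>) * \<rho>)" using ri(2) \<kappa>(3) by (metis mult.assoc)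
        also have "\<dots> \<le> T * (Re z + 1)" using T ri(1) by (intro mult_left_mono) auto
        finally show ?thesis .
      qed
      then have "\<bar>Im z / (Re z + 1)\<bar> \<le> T" using Rez by (simp add: abs_divide divide_le_eq)
      then have "Im z / (Re z + 1) \<le> T" "- T \<le> Im z / (Re z + 1)" by linarith+
      then have "arctan (Im z / (Re z + 1)) \<le> arctan T" "arctan (- T) \<le> arctan (Im z / (Re z + 1))"
        by (simp_all only: arctan_le_iff)
      then have "\<bar>arctan (Im z / (Re z + 1))\<bar> \<le> \<tau> / (2 * \<beta>)"
        unfolding arctan_minus arctanT by linarith
      then have "\<bar>Im (Ln (z + 1))\<bar> \<le> \<tau> / (2 * \<beta>)"
        using arg_conv_arctan[of "z + 1"] Rez by (auto simp: Arg_eq_Im_Ln complex_eq_iff)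
      then have "\<bar>Im (V z) - \<theta>0\<bar> \<le> \<tau> / 2"
        unfolding ImV using \<beta>(3) by (simp add: abs_mult field_simps)
      then have im: "\<bar>Im (V z) - \<theta>0\<bar> < \<tau>" using \<tau> by simp
      have "exp (x0 / \<beta>) \<le> (1 - \<kappa>) * \<rho>" using \<rho>1(2) \<kappa> by (simp add: divide_le_eq mult.commute)
      also have "\<dots> \<le> norm (z + 1)" by (rule nz)
      finally have "x0 / \<beta> \<le> ln (norm (z + 1))" using norm_gt[OF Rez] by (subst ln_ge_iff) auto
      then have x0: "x0 \<le> Re (V z)" using \<beta>(3) unfolding ReV[OF Rez] by (simp add: field_simps)
      have "(1 - \<kappa>) powr \<beta> * \<rho> powr \<beta> = ((1 - \<kappa>) * \<rho>) powr \<beta>"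
        using \<kappa> \<rho>1 by (simp add: powr_mult)
      also have "\<dots> \<le> norm (z + 1) powr \<beta>" using nz pos \<beta>(3) by (intro powr_mono2) auto
      also have "\<dots> = exp (Re (V z))" using norm_gt[OF Rez] unfolding ReV[OF Rez] powr_def by auto
      finally have exp_ge: "(1 - \<kappa>) powr \<beta> * \<rho> powr \<beta> \<le> exp (Re (V z))" .
      have hz: "norm (h (V z)) \<le> C' * exp (- \<delta> * exp (Re (V z)))"
        using V_strip[OF Rez] x0 im by (rule small)
      have C'0: "C' \<ge> 0"
        using order_trans[OF norm_ge_zero hz] by (simp add: zero_le_mult_iff)
      have "norm (G z) \<le> norm (h (V z)) * 1"
        unfolding G_def norm_mult norm_exp_V
        using K V_strip[OF Rez] by (intro mult_left_mono) (auto simp: strip_def)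
      also have "\<dots> \<le> C' * exp (- \<delta> * exp (Re (V z)))" using hz by simp
      also have "\<dots> \<le> C' * exp (- \<delta> * ((1 - \<kappa>) powr \<beta> * \<rho> powr \<beta>))"
        using C'0 exp_ge \<delta> by (intro mult_left_mono) auto
      finally show ?thesis by (simp add: mult_ac)
    qed
  qed (use \<beta> \<delta> \<kappa> that in auto)
  have ray: "h (Complex t \<theta>0) = 0" if "t > 0" for t
  proof -
    define x where "x = exp (t / \<beta>) - 1"
    have x: "x > 0" using that \<beta>(3) by (simp add: x_def)
    have "V (of_real x) = Complex t \<theta>0"
    proof -
      have "complex_of_real x + 1 = of_real (exp (t / \<beta>))" by (simp add: x_def)
      then have "Ln (complex_of_real x + 1) = of_real (t / \<beta>)"
        by (simp only: Ln_of_real[of "exp (t / \<beta>)"]) (simp add: Ln_of_real)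
      then show ?thesis using \<beta>(3) by (simp add: V_def complex_eq_iff)
    qed
    then show ?thesis using G0[OF x] by (simp add: G_def)
  qed
  have "\<bar>\<theta>0\<bar> < pi / 2 + \<eta>" using \<theta>0 \<eta> pi_gt_zero by linarith
  then show ?thesis
    by (rule strip_analytic_continuation_ray[OF holo _ ray _ v, of 0]) auto
qed

section \<open>Polynomial growth against exponential decay\<close>

definition tame :: "real \<Rightarrow> (complex \<Rightarrow> complex) set" where
  "tame \<eta> = {g. g holomorphic_on strip \<eta> \<and>
     (\<exists>C K. K > 0 \<and> (\<forall>v\<in>strip \<eta>. norm (g v) \<le> C * exp (K * Re v)))}"

lemma tameI:
  assumes "g holomorphic_on strip \<eta>" "\<And>v. v \<in> strip \<eta> \<Longrightarrow> norm (g v) \<le> C * exp (K * Re v)"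
  shows "g \<in> tame \<eta>"
proof -
  have "norm (g v) \<le> \<bar>C\<bar> * exp ((\<bar>K\<bar> + 1) * Re v)" if v: "v \<in> strip \<eta>" for v
  proof -
    have "norm (g v) \<le> C * exp (K * Re v)" by (rule assms(2)[OF v])
    also have "\<dots> \<le> \<bar>C\<bar> * exp ((\<bar>K\<bar> + 1) * Re v)"
      using v by (intro mult_mono) (auto simp: strip_def intro!: mult_right_mono)
    finally show ?thesis .
  qed
  then show ?thesis unfolding tame_def using assms(1)
    by (intro CollectI conjI exI[of _ "\<bar>C\<bar>"] exI[of _ "\<bar>K\<bar> + 1"]) auto
qed

lemma tame_const: "(\<lambda>_. c) \<in> tame \<eta>"
  by (rule tameI[of _ _ "norm c" 0]) auto

lemma tame_add:
  assumes "f \<in> tame \<eta>" "g \<in> tame \<eta>"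
  shows "(\<lambda>v. f v + g v) \<in> tame \<eta>"
proof -
  obtain C K where f: "f holomorphic_on strip \<eta>" "K > 0" "\<And>v. v \<in> strip \<eta> \<Longrightarrow> norm (f v) \<le> C * exp (K * Re v)"
    using assms(1) unfolding tame_def by blast
  obtain C' K' where g: "g holomorphic_on strip \<eta>" "K' > 0" "\<And>v. v \<in> strip \<eta> \<Longrightarrow> norm (g v) \<le> C' * exp (K' * Re v)"
    using assms(2) unfolding tame_def by blast
  show ?thesis
  proof (rule tameI[where C = "\<bar>C\<bar> + \<bar>C'\<bar>" and K = "K + K'"])
    fix v assume v: "v \<in> strip \<eta>"
    have "norm (f v + g v) \<le> C * exp (K * Re v) + C' * exp (K' * Re v)"
      using f(3)[OF v] g(3)[OF v] norm_triangle_mono by blast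
    also have "C * exp (K * Re v) \<le> \<bar>C\<bar> * exp ((K + K') * Re v)"
      using v f g by (intro mult_mono) (auto simp: strip_def intro!: mult_right_mono)
    also have "C' * exp (K' * Re v) \<le> \<bar>C'\<bar> * exp ((K + K') * Re v)"
      using v f g by (intro mult_mono) (auto simp: strip_def intro!: mult_right_mono)
    finally show "norm (f v + g v) \<le> (\<bar>C\<bar> + \<bar>C'\<bar>) * exp ((K + K') * Re v)"
      by (simp add: algebra_simps)
  qed (use f g in \<open>auto intro!: holomorphic_intros\<close>)
qed

lemma tame_mult:
  assumes "f \<in> tame \<eta>" "g \<in> tame \<eta>"
  shows "(\<lambda>v. f v * g v) \<in> tame \<eta>"
proof -
  obtain C K where f: "f holomorphic_on strip \<eta>" "K > 0" "\<And>v. v \<in> strip \<eta> \<Longrightarrow> norm (f v) \<le> C * exp (K * Re v)"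
    using assms(1) unfolding tame_def by blast
  obtain C' K' where g: "g holomorphic_on strip \<eta>" "K' > 0" "\<And>v. v \<in> strip \<eta> \<Longrightarrow> norm (g v) \<le> C' * exp (K' * Re v)"
    using assms(2) unfolding tame_def by blast
  show ?thesis
  proof (rule tameI[where C = "C * C'" and K = "K + K'"])
    fix v assume v: "v \<in> strip \<eta>"
    have "norm (f v * g v) \<le> (C * exp (K * Re v)) * (C' * exp (K' * Re v))"
      unfolding norm_mult using f(3)[OF v] g(3)[OF v] order_trans[OF norm_ge_zero]
      by (intro mult_mono) auto
    then show "norm (f v * g v) \<le> C * C' * exp ((K + K') * Re v)"
      by (simp add: algebra_simps exp_add)
  qed (use f g in \<open>auto intro!: holomorphic_intros\<close>)
qed

text \<open>Exponential decay in \<open>norm u\<close>, for \<open>u = exp v\<close>, far out in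
  some narrow sector around the ray of angle \<open>\<theta>\<close>.\<close>

definition exp_small :: "real \<Rightarrow> real \<Rightarrow> (complex \<Rightarrow> complex) \<Rightarrow> bool" where
  "exp_small \<eta> \<theta> f \<longleftrightarrow> (\<exists>\<tau>>0. \<exists>\<delta>>0. \<exists>C x0. \<forall>v\<in>strip \<eta>. Re v \<ge> x0 \<longrightarrow> \<bar>Im v - \<theta>\<bar> < \<tau> \<longrightarrow>
     norm (f v) \<le> C * exp (- \<delta> * exp (Re v)))"

lemma exp_small_0: "exp_small \<eta> \<theta> (\<lambda>_. 0)"
  unfolding exp_small_def by (intro exI[of _ 1] conjI exI[of _ 0]) auto

lemma exp_small_add:
  assumes "exp_small \<eta> \<theta> f" "exp_small \<eta> \<theta> g"
  shows "exp_small \<eta> \<theta> (\<lambda>v. f v + g v)"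
proof -
  obtain \<tau> \<delta> C x where f: "\<tau> > 0" "\<delta> > 0" "\<And>v. v \<in> strip \<eta> \<Longrightarrow> Re v \<ge> x \<Longrightarrow> \<bar>Im v - \<theta>\<bar> < \<tau> \<Longrightarrow>
     norm (f v) \<le> C * exp (- \<delta> * exp (Re v))"
    using assms(1) unfolding exp_small_def by blast
  obtain \<tau>' \<delta>' C' x' where g: "\<tau>' > 0" "\<delta>' > 0" "\<And>v. v \<in> strip \<eta> \<Longrightarrow> Re v \<ge> x' \<Longrightarrow> \<bar>Im v - \<theta>\<bar> < \<tau>' \<Longrightarrow>
     norm (g v) \<le> C' * exp (- \<delta>' * exp (Re v))"
    using assms(2) unfolding exp_small_def by blast
  have "norm (f v + g v) \<le> (\<bar>C\<bar> + \<bar>C'\<bar>) * exp (- (min \<delta> \<delta>') * exp (Re v))"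
    if v: "v \<in> strip \<eta>" "Re v \<ge> max x x'" "\<bar>Im v - \<theta>\<bar> < min \<tau> \<tau>'" for v
  proof -
    have "norm (f v + g v) \<le> C * exp (- \<delta> * exp (Re v)) + C' * exp (- \<delta>' * exp (Re v))"
      using f(3)[of v] g(3)[of v] v norm_triangle_mono by auto
    also have "C * exp (- \<delta> * exp (Re v)) \<le> \<bar>C\<bar> * exp (- (min \<delta> \<delta>') * exp (Re v))"
      by (intro mult_mono) auto
    also have "C' * exp (- \<delta>' * exp (Re v)) \<le> \<bar>C'\<bar> * exp (- (min \<delta> \<delta>') * exp (Re v))"
      by (intro mult_mono) auto
    finally show ?thesis by (simp add: algebra_simps)
  qed
  moreover have "min \<tau> \<tau>' > 0" "min \<delta> \<delta>' > 0" using f g by auto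
  ultimately show ?thesis unfolding exp_small_def by blast
qed

lemma exp_small_sum:
  assumes "\<And>x. x \<in> X \<Longrightarrow> exp_small \<eta> \<theta> (f x)"
  shows "exp_small \<eta> \<theta> (\<lambda>v. \<Sum>x\<in>X. f x v)"
  using assms
  by (induction X rule: infinite_finite_induct) (auto intro: exp_small_add exp_small_0)

text \<open>The maximum is at \<open>t = ln (K / a)\<close>. In the next lemma this absorbs the
  growth \<open>exp (K * Re v)\<close> into half of the decay rate; it requires
  \<open>K > 0\<close>, which explains that clause in \<open>tame\<close>.\<close>

lemma linear_minus_exp_bounded:
  fixes K a t :: real
  assumes "K > 0" "a > 0"
  shows "K * t - a * exp t \<le> K * ln (K / a)"
proof -
  have "1 + (t - ln (K / a)) \<le> exp (t - ln (K / a))" by (rule exp_ge_add_one_self)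
  also have "\<dots> = exp t * (a / K)" using assms by (simp add: exp_diff)
  finally have "K * (1 + (t - ln (K / a))) \<le> K * (exp t * (a / K))"
    using assms by (intro mult_left_mono) auto
  then have "K * (1 + (t - ln (K / a))) \<le> a * exp t" using assms by (simp add: mult.commute)
  moreover have "K * (1 + (t - ln (K / a))) = K + K * t - K * ln (K / a)" by (simp add: algebra_simps)
  ultimately show ?thesis using assms by linarith
qed

lemma exp_small_tame_mult:
  assumes "g \<in> tame \<eta>" "exp_small \<eta> \<theta> f"
  shows "exp_small \<eta> \<theta> (\<lambda>v. g v * f v)"
proof -
  obtain C K where g: "K > 0" "\<And>v. v \<in> strip \<eta> \<Longrightarrow> norm (g v) \<le> C * exp (K * Re v)"
    using assms(1) unfolding tame_def by blast
  obtain \<tau> \<delta> C' x where f: "\<tau> > 0" "\<delta> > 0" "\<And>v. v \<in> strip \<eta> \<Longrightarrow> Re v \<ge> x \<Longrightarrow> \<bar>Im v - \<theta>\<bar> < \<tau> \<Longrightarrow>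
     norm (f v) \<le> C' * exp (- \<delta> * exp (Re v))"
    using assms(2) unfolding exp_small_def by blast
  define D where "D = exp (K * ln (K / (\<delta> / 2)))"
  have "norm (g v * f v) \<le> (\<bar>C\<bar> * \<bar>C'\<bar> * D) * exp (- (\<delta> / 2) * exp (Re v))"
    if v: "v \<in> strip \<eta>" "Re v \<ge> x" "\<bar>Im v - \<theta>\<bar> < \<tau>" for v
  proof -
    have "norm (g v * f v) \<le> (\<bar>C\<bar> * exp (K * Re v)) * (\<bar>C'\<bar> * exp (- \<delta> * exp (Re v)))"
      unfolding norm_mult
    proof (rule mult_mono)
      show "norm (g v) \<le> \<bar>C\<bar> * exp (K * Re v)"
        using g(2)[OF v(1)] by (rule order_trans) (auto intro!: mult_right_mono)
      show "norm (f v) \<le> \<bar>C'\<bar> * exp (- \<delta> * exp (Re v))"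
        using f(3)[OF v] by (rule order_trans) (auto intro!: mult_right_mono)
    qed auto
    also have "\<dots> = \<bar>C\<bar> * \<bar>C'\<bar> * exp (K * Re v - \<delta> * exp (Re v))"
      by (simp add: exp_diff exp_minus field_simps)
    also have "\<dots> \<le> \<bar>C\<bar> * \<bar>C'\<bar> * exp (K * ln (K / (\<delta> / 2)) + - (\<delta> / 2) * exp (Re v))"
      using linear_minus_exp_bounded[of K "\<delta> / 2" "Re v"] g(1) f(2)
      by (intro mult_left_mono) auto
    also have "\<dots> = (\<bar>C\<bar> * \<bar>C'\<bar> * D) * exp (- (\<delta> / 2) * exp (Re v))"
      unfolding D_def exp_add by simp
    finally show ?thesis .
  qed
  moreover have "\<delta> / 2 > 0" using f by simp
  ultimately show ?thesis unfolding exp_small_def using f(1) by blast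
qed

text \<open>In the coordinate \<open>u = exp v\<close> this is \<open>\<lambda> * u - k * d * u * Ln u\<close> for \<open>x = (\<lambda>, k)\<close>.\<close>

definition expo :: "complex \<Rightarrow> complex \<times> nat \<Rightarrow> complex \<Rightarrow> complex" where
  "expo d x v = (fst x - of_nat (snd x) * d * v) * exp v"

lemma expo_add: "expo d (x + y) v = expo d x v + expo d y v"
  by (simp add: expo_def algebra_simps)

lemma Re_mult_exp: "Re (c * exp v) = exp (Re v) * Re (c * cis (Im v))"
  by (simp add: exp_eq_polar algebra_simps)

lemma tendsto_Re_mult_cis: "((\<lambda>\<theta>. Re (c * cis \<theta>)) \<longlongrightarrow> Re (c * cis \<theta>0)) (nhds \<theta>0)"
proof -
  have "isCont (\<lambda>\<theta>. Re c * cos \<theta> - Im c * sin \<theta>) \<theta>0" by (intro continuous_intros)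
  then have "((\<lambda>\<theta>. Re c * cos \<theta> - Im c * sin \<theta>) \<longlongrightarrow> Re c * cos \<theta>0 - Im c * sin \<theta>0) (nhds \<theta>0)"
    unfolding isCont_def by (subst (asm) tendsto_at_iff_tendsto_nhds)
  then show ?thesis by simp
qed

lemma exp_small_expo_same:
  assumes "Re (c * cis \<theta>) < 0"
  shows "exp_small \<eta> \<theta> (\<lambda>v. exp (c * exp v))"
proof -
  define \<delta> where "\<delta> = - Re (c * cis \<theta>) / 2"
  have "\<delta> > 0" using assms by (simp add: \<delta>_def)
  have less: "Re (c * cis \<theta>) < - \<delta>" using assms unfolding \<delta>_def by linarith
  have "eventually (\<lambda>\<theta>'. Re (c * cis \<theta>') < - \<delta>) (nhds \<theta>)"
    by (rule order_tendstoD(2)[OF tendsto_Re_mult_cis less])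
  then obtain \<tau> where \<tau>: "\<tau> > 0" "\<And>\<theta>'. \<bar>\<theta>' - \<theta>\<bar> < \<tau> \<Longrightarrow> Re (c * cis \<theta>') < - \<delta>"
    unfolding eventually_nhds_metric by (auto simp: dist_real_def)
  have "norm (exp (c * exp v)) \<le> 1 * exp (- \<delta> * exp (Re v))" if "\<bar>Im v - \<theta>\<bar> < \<tau>" for v
    using \<tau>(2)[OF that] mult_right_mono[of "Re (c * cis (Im v))" "- \<delta>" "exp (Re v)"]
    unfolding norm_exp_eq_Re Re_mult_exp by (simp only: mult.commute) simp
  then show ?thesis unfolding exp_small_def using \<open>\<delta> > 0\<close> \<tau>(1) by blast
qed

text \<open>The real part of \<open>m * d * v * exp v\<close> contains
  \<open>m * Re v * Re (d * exp v)\<close>. The factor \<open>Re v\<close>, the logarithm of the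
  modulus, eventually beats the linear exponent \<open>c * exp v\<close>, whatever the sign of its
  real part.\<close>

lemma exp_small_expo_higher:
  assumes "Re (d * cis \<theta>) > 0" "m > 0"
  shows "exp_small \<eta> \<theta> (\<lambda>v. exp ((c - of_nat m * d * v) * exp v))"
proof -
  define \<delta> where "\<delta> = Re (d * cis \<theta>) / 2"
  have "\<delta> > 0" using assms by (simp add: \<delta>_def)
  have less: "Re (d * cis \<theta>) > \<delta>" using assms unfolding \<delta>_def by linarith
  have "eventually (\<lambda>\<theta>'. Re (d * cis \<theta>') > \<delta>) (nhds \<theta>)"
    by (rule order_tendstoD(1)[OF tendsto_Re_mult_cis less])
  then obtain \<tau> where \<tau>: "\<tau> > 0" "\<And>\<theta>'. \<bar>\<theta>' - \<theta>\<bar> < \<tau> \<Longrightarrow> Re (d * cis \<theta>') > \<delta>"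
    unfolding eventually_nhds_metric by (auto simp: dist_real_def)
  define B where "B = norm c + m * norm d * (\<bar>\<theta>\<bar> + \<tau>)"
  have "norm (exp ((c - of_nat m * d * v) * exp v)) \<le> 1 * exp (- 1 * exp (Re v))"
    if v: "v \<in> strip \<eta>" "Re v \<ge> (B + 1) / \<delta>" "\<bar>Im v - \<theta>\<bar> < \<tau>" for v
  proof -
    have im: "\<bar>Im v\<bar> \<le> \<bar>\<theta>\<bar> + \<tau>" using v by linarith
    have split: "(c - of_nat m * d * v) = (c - of_nat m * d * (\<i> * Im v)) - of_real (m * Re v) * d"
      by (subst (1) complex_eq[of v]) (simp add: algebra_simps)
    have "Re ((c - of_nat m * d * (\<i> * Im v)) * cis (Im v)) \<le> norm ((c - of_nat m * d * (\<i> * Im v)) * cis (Im v))"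
      by (rule complex_Re_le_cmod)
    also have "\<dots> = norm (c - of_nat m * d * (\<i> * Im v))" by (simp add: norm_mult)
    also have "\<dots> \<le> norm c + m * norm d * \<bar>Im v\<bar>"
      by (rule order_trans[OF norm_triangle_ineq4]) (simp add: norm_mult)
    also have "\<dots> \<le> B" unfolding B_def using im by (intro add_left_mono mult_left_mono) auto
    finally have 1: "Re ((c - of_nat m * d * (\<i> * Im v)) * cis (Im v)) \<le> B" .
    have "B + 1 \<le> Re v * \<delta>" using v(2) \<open>\<delta> > 0\<close> by (simp add: divide_le_eq)
    also have "\<dots> \<le> Re v * Re (d * cis (Im v))"
      using v \<tau>(2)[of "Im v"] by (intro mult_left_mono) (auto simp: strip_def)
    also have "\<dots> = 1 * (Re v * Re (d * cis (Im v)))" by simp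
    also have "\<dots> \<le> m * (Re v * Re (d * cis (Im v)))"
      using assms(2) v \<tau>(2)[of "Im v"] \<open>\<delta> > 0\<close> by (intro mult_right_mono mult_nonneg_nonneg) (auto simp: strip_def)
    finally have 2: "B + 1 \<le> m * (Re v * Re (d * cis (Im v)))" .
    have "Re ((c - of_nat m * d * v) * cis (Im v)) =
      Re ((c - of_nat m * d * (\<i> * Im v)) * cis (Im v)) - m * (Re v * Re (d * cis (Im v)))"
      by (subst split) (simp add: algebra_simps)
    then have "Re ((c - of_nat m * d * v) * cis (Im v)) \<le> - 1" using 1 2 by linarith
    then have "exp (Re v) * Re ((c - of_nat m * d * v) * cis (Im v)) \<le> exp (Re v) * (- 1)"
      by (intro mult_left_mono) auto
    then show ?thesis unfolding norm_exp_eq_Re Re_mult_exp by simp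
  qed
  then show ?thesis unfolding exp_small_def using \<tau>(1) zero_less_one by blast
qed

text \<open>The zeros in \<open>\<theta>\<close> are spaced by \<open>pi\<close>, so an interval of
  length 1 contains at most one.\<close>

lemma finite_zeros_Re_mult_cis:
  assumes "c \<noteq> 0"
  shows "finite {\<theta>\<in>{0<..<1}. Re (c * cis \<theta>) = 0}"
proof -
  have uniq: "s = t" if st: "s \<in> {0<..<1}" "t \<in> {0<..<1}" "Re (c * cis s) = 0" "Re (c * cis t) = 0" for s t
  proof -
    have e: "Re c * cos s = Im c * sin s" "Re c * cos t = Im c * sin t" using st by auto
    have "Re c * sin (s - t) = sin s * (Re c * cos t) - (Re c * cos s) * sin t"
      by (simp add: sin_diff algebra_simps)
    then have 1: "Re c * sin (s - t) = 0" unfolding e by simp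
    have "Im c * sin (s - t) = (Im c * sin s) * cos t - cos s * (Im c * sin t)"
      by (simp add: sin_diff algebra_simps)
    then have 2: "Im c * sin (s - t) = 0" unfolding e[symmetric] by simp
    have "sin (s - t) = 0" using 1 2 assms by (auto simp: complex_eq_iff)
    then have "s - t = 0"
      by (rule sin_eq_0_pi[rotated 2]) (use st pi_gt3 in auto)
    then show ?thesis by simp
  qed
  show ?thesis
  proof (cases "{\<theta>\<in>{0<..<1}. Re (c * cis \<theta>) = 0} = {}")
    case False
    then obtain s where "s \<in> {0<..<1}" "Re (c * cis s) = 0" by blast
    then have "{\<theta>\<in>{0<..<1}. Re (c * cis \<theta>) = 0} \<subseteq> {s}" using uniq by blast
    then show ?thesis using finite_subset by blast
  qed (simp only: finite.emptyI)
qed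

text \<open>In a generic direction one term dominates: least second component, and among those the
  largest real part of \<open>\<lambda> * u\<close>. After division by its exponential all other
  terms are exponentially small there, hence so is its coefficient. Being tame on a sector of
  opening more than \<open>pi\<close>, the coefficient vanishes by
  \<open>strip_uniqueness\<close>.\<close>

lemma dominant_term_vanishes:
  assumes \<eta>: "\<eta> > 0" and d: "Re d > 0" and X: "finite X" "X \<noteq> {}"
    and g: "\<And>x. x \<in> X \<Longrightarrow> g x \<in> tame \<eta>"
    and eq: "\<And>v. v \<in> strip \<eta> \<Longrightarrow> (\<Sum>x\<in>X. g x v * exp (expo d x v)) = 0"
  obtains x where "x \<in> X" "\<And>v. v \<in> strip \<eta> \<Longrightarrow> g x v = 0"
proof -
  have "eventually (\<lambda>\<theta>. Re (d * cis \<theta>) > 0) (nhds 0)"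
    by (rule order_tendstoD(1)[OF tendsto_Re_mult_cis]) (use d in simp)
  then obtain \<epsilon> where \<epsilon>: "\<epsilon> > 0" "\<And>\<theta>. \<bar>\<theta>\<bar> < \<epsilon> \<Longrightarrow> Re (d * cis \<theta>) > 0"
    unfolding eventually_nhds_metric by (auto simp: dist_real_def)
  \<comment> \<open>Directions in which two different \<open>\<lambda>\<close> have equal real parts
    and neither term would dominate.\<close>
  define bad where "bad = (\<Union>c\<in>(\<lambda>(x, y). fst x - fst y) ` (X \<times> X) - {0}. {\<theta>\<in>{0<..<1}. Re (c * cis \<theta>) = 0})"
  have "finite bad" unfolding bad_def using X finite_zeros_Re_mult_cis by (intro finite_UN_I) auto
  moreover have "infinite {0<..<min 1 (min \<epsilon> (\<eta> / 2))}" using \<epsilon> \<eta> by (intro infinite_Ioo) auto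
  ultimately obtain \<theta> where \<theta>: "\<theta> \<in> {0<..<min 1 (min \<epsilon> (\<eta> / 2))}" "\<theta> \<notin> bad"
    by (meson finite_subset subsetI)
  have d\<theta>: "Re (d * cis \<theta>) > 0" using \<theta> by (intro \<epsilon>(2)) auto
  define k where "k = Min (snd ` X)"
  have k: "k \<in> snd ` X" "\<And>x. x \<in> X \<Longrightarrow> k \<le> snd x" using X unfolding k_def by auto
  define X0 where "X0 = {x\<in>X. snd x = k}"
  have X0: "finite X0" "X0 \<noteq> {}" using X k by (auto simp: X0_def)
  define M where "M = Max ((\<lambda>x. Re (fst x * cis \<theta>)) ` X0)"
  have "M \<in> (\<lambda>x. Re (fst x * cis \<theta>)) ` X0" unfolding M_def using X0 by (intro Max_in) auto
  then obtain x where x: "x \<in> X0" "M = Re (fst x * cis \<theta>)" by blast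
  have max: "Re (fst y * cis \<theta>) \<le> Re (fst x * cis \<theta>)" if "y \<in> X0" for y
    unfolding x(2)[symmetric] M_def using X0 that by (intro Max_ge) auto
  have xX: "x \<in> X" using x by (simp add: X0_def)
  have small: "exp_small \<eta> \<theta> (\<lambda>v. exp (expo d y v - expo d x v))" if y: "y \<in> X - {x}" for y
  proof (cases "snd y = k")
    case True
    have ne: "fst y - fst x \<noteq> 0" using True y x by (auto simp: X0_def prod_eq_iff)
    have "Re (fst y * cis \<theta>) \<le> Re (fst x * cis \<theta>)" using y True by (intro max) (auto simp: X0_def)
    moreover have "Re ((fst y - fst x) * cis \<theta>) \<noteq> 0"
    proof
      assume "Re ((fst y - fst x) * cis \<theta>) = 0"
      then have "\<theta> \<in> bad" using ne y xX \<theta>(1) unfolding bad_def by (intro UN_I[of "fst y - fst x"]) auto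
      then show False using \<theta>(2) by simp
    qed
    moreover have "Re ((fst y - fst x) * cis \<theta>) = Re (fst y * cis \<theta>) - Re (fst x * cis \<theta>)"
      by (simp add: algebra_simps)
    ultimately have "Re ((fst y - fst x) * cis \<theta>) < 0" by linarith
    from exp_small_expo_same[OF this, of \<eta>] show ?thesis
      using True x by (simp add: expo_def X0_def algebra_simps)
  next
    case False
    then have lt: "snd y > k" using k(2)[of y] y by simp
    have "exp_small \<eta> \<theta> (\<lambda>v. exp (((fst y - fst x) - of_nat (snd y - k) * d * v) * exp v))"
      by (rule exp_small_expo_higher[OF d\<theta>]) (use lt in simp)
    moreover have "((fst y - fst x) - of_nat (snd y - k) * d * v) * exp v = expo d y v - expo d x v" for v
      using lt x by (simp add: expo_def X0_def of_nat_diff algebra_simps)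
    ultimately show ?thesis by simp
  qed
  define E where "E v = (\<Sum>y\<in>X - {x}. (- g y v) * exp (expo d y v - expo d x v))" for v
  have "(\<lambda>v. - g y v) \<in> tame \<eta>" if "y \<in> X" for y
    using tame_mult[OF tame_const[of "-1"] g[OF that]] by simp
  then have "exp_small \<eta> \<theta> E"
    unfolding E_def using small by (intro exp_small_sum exp_small_tame_mult) auto
  then obtain \<tau> \<delta> C x0 where E: "\<tau> > 0" "\<delta> > 0" "\<And>v. v \<in> strip \<eta> \<Longrightarrow> Re v \<ge> x0 \<Longrightarrow> \<bar>Im v - \<theta>\<bar> < \<tau> \<Longrightarrow>
     norm (E v) \<le> C * exp (- \<delta> * exp (Re v))"
    unfolding exp_small_def by blast
  have gE: "g x v = E v" if "v \<in> strip \<eta>" for v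
  proof -
    have "0 = (\<Sum>y\<in>X. g y v * exp (expo d y v)) * exp (- expo d x v)" using eq[OF that] by simp
    also have "\<dots> = (\<Sum>y\<in>X. g y v * exp (expo d y v - expo d x v))"
      by (simp add: sum_distrib_right exp_diff exp_minus divide_inverse mult.assoc)
    also have "\<dots> = g x v + (\<Sum>y\<in>X - {x}. g y v * exp (expo d y v - expo d x v))"
      using X xX by (subst sum.remove[of X x]) auto
    also have "\<dots> = g x v - E v" by (simp add: E_def sum_negf)
    finally show ?thesis by simp
  qed
  obtain C' K where gx: "g x holomorphic_on strip \<eta>" "K > 0"
     "\<And>v. v \<in> strip \<eta> \<Longrightarrow> norm (g x v) \<le> C' * exp (K * Re v)"
    using g[OF xX] unfolding tame_def by blast
  have "g x v = 0" if "v \<in> strip \<eta>" for v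
  proof (rule strip_uniqueness[OF \<eta> _ _ gx(1) gx(3) _ E(1,2) that])
    show "\<bar>\<theta>\<bar> < \<eta> / 2" using \<theta> by auto
    show "norm (g x w) \<le> C * exp (- \<delta> * exp (Re w))"
      if "w \<in> strip \<eta>" "x0 \<le> Re w" "\<bar>Im w - \<theta>\<bar> < \<tau>" for w
      using E(3)[OF that] gE that by simp
  qed (use gx in auto)
  then show ?thesis using that xX by blast
qed

theorem exponentials_independent:
  assumes \<eta>: "\<eta> > 0" and d: "Re d > 0" and X: "finite X"
    and g: "\<And>x. x \<in> X \<Longrightarrow> g x \<in> tame \<eta>"
    and eq: "\<And>v. v \<in> strip \<eta> \<Longrightarrow> (\<Sum>x\<in>X. g x v * exp (expo d x v)) = 0"
    and "x \<in> X" "v \<in> strip \<eta>"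
  shows "g x v = 0"
  using X g eq assms(6)
proof (induction "card X" arbitrary: X)
  case (Suc n)
  then have "X \<noteq> {}" by auto
  then obtain y where y: "y \<in> X" "\<And>v. v \<in> strip \<eta> \<Longrightarrow> g y v = 0"
    using dominant_term_vanishes[OF \<eta> d Suc.prems(1) _ Suc.prems(2,3)] by blast
  show ?case
  proof (cases "x = y")
    case True
    then show ?thesis using y \<open>v \<in> strip \<eta>\<close> by simp
  next
    case False
    show ?thesis
    proof (rule Suc.hyps(1)[of "X - {y}"])
      show "(\<Sum>x\<in>X - {y}. g x v * exp (expo d x v)) = 0" if "v \<in> strip \<eta>" for v
        using Suc.prems(3)[OF that] y Suc.prems(1) that by (simp add: sum.remove[of X y])
    qed (use Suc y False in auto)
  qed
qed auto

section \<open>A weak form of Stirling's formula\<close>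

text \<open>The constant is \<open>sin (\<eta> / 2)\<close>. With \<open>r = exp (Re v)\<close> the
  squares of the two sides differ by at least
  \<open>(1 + cos \<eta>) / 2 * (r - t)^2\<close>.\<close>

lemma norm_exp_plus_real_ge:
  assumes \<eta>: "0 < \<eta>" "\<eta> < pi" and v: "\<bar>Im v\<bar> \<le> pi - \<eta>" and t: "t \<ge> 0"
  shows "sqrt ((1 - cos \<eta>) / 2) * (exp (Re v) + t) \<le> norm (exp v + of_real t)"
proof (rule power2_le_imp_le)
  define r where "r = exp (Re v)"
  have r: "r > 0" by (simp add: r_def)
  have "cos (pi - \<eta>) \<le> cos \<bar>Im v\<bar>" using \<eta> v by (intro cos_monotone_0_pi_le) auto
  then have c: "- cos \<eta> \<le> cos (Im v)" by simp
  have sq: "(r * cos (Im v))\<^sup>2 + (r * sin (Im v))\<^sup>2 = r\<^sup>2"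
    by (simp add: power_mult_distrib flip: distrib_left)
  have "norm (exp v + of_real t) ^ 2 = (r * cos (Im v) + t)\<^sup>2 + (r * sin (Im v))\<^sup>2"
    by (simp add: cmod_power2 Re_exp Im_exp r_def)
  also have "\<dots> = r\<^sup>2 + t\<^sup>2 + 2 * t * r * cos (Im v)"
    using sq by (simp add: power2_sum algebra_simps)
  finally have n: "norm (exp v + of_real t) ^ 2 = r\<^sup>2 + t\<^sup>2 + 2 * t * r * cos (Im v)" .
  have "(sqrt ((1 - cos \<eta>) / 2) * (r + t))\<^sup>2 = (1 - cos \<eta>) / 2 * (r + t)\<^sup>2"
    by (simp add: power_mult_distrib)
  also have "\<dots> = r\<^sup>2 + t\<^sup>2 + 2 * t * r * (- cos \<eta>) - (1 + cos \<eta>) / 2 * (r - t)\<^sup>2"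
    by (simp add: power2_eq_square field_simps)
  also have "\<dots> \<le> r\<^sup>2 + t\<^sup>2 + 2 * t * r * (- cos \<eta>)"
  proof -
    have "1 + cos \<eta> \<ge> 0" using cos_ge_minus_one[of \<eta>] by linarith
    then have "(1 + cos \<eta>) / 2 * (r - t)\<^sup>2 \<ge> 0" by simp
    then show ?thesis by linarith
  qed
  also have "\<dots> \<le> r\<^sup>2 + t\<^sup>2 + 2 * t * r * cos (Im v)"
    using c r t by (intro add_left_mono mult_left_mono) auto
  finally show "(sqrt ((1 - cos \<eta>) / 2) * (exp (Re v) + t))\<^sup>2 \<le> norm (exp v + of_real t) ^ 2"
    using n by (simp add: r_def)
qed auto

lemma exp_notin_nonpos_Reals:
  assumes "\<bar>Im v\<bar> < pi"
  shows "exp v \<notin> \<real>\<^sub>\<le>\<^sub>0"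
proof
  assume "exp v \<in> \<real>\<^sub>\<le>\<^sub>0"
  then have "Re (exp v) \<le> 0" "Im (exp v) = 0" unfolding complex_nonpos_Reals_iff by auto
  moreover have "Re (exp v) \<noteq> 0 \<or> Im (exp v) \<noteq> 0" using exp_not_eq_zero[of v] by (metis complex_eq_0 zero_power2 add_0)
  ultimately have "Im (Ln (exp v)) = pi" by (subst Im_Ln_eq_pi) auto
  then show False using assms by (subst (asm) Ln_exp) auto
qed

lemma exp_plus_notin_nonpos_Reals:
  assumes "\<bar>Im v\<bar> < pi" "t \<ge> 0"
  shows "exp v + of_real t \<notin> \<real>\<^sub>\<le>\<^sub>0"
proof
  assume *: "exp v + of_real t \<in> \<real>\<^sub>\<le>\<^sub>0"
  then have "exp v \<in> \<real>\<^sub>\<le>\<^sub>0"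
    using assms(2) unfolding complex_nonpos_Reals_iff by auto
  then show False using exp_notin_nonpos_Reals assms by blast
qed

text \<open>Up to sign the difference is the sum over \<open>k\<close> of
  \<open>Ln (w + k + 1) - Ln (w + k) - 1 / (w + k)\<close> with \<open>w = exp v\<close>. Each term
  is of order \<open>1 / norm (w + k)^2\<close>, and \<open>norm (w + k)\<close> is at least a
  constant times \<open>r + k\<close>, so the sum is of order \<open>1 / r\<close>.\<close>

lemma norm_Digamma_minus_Ln_le:
  assumes \<eta>: "0 < \<eta>" "\<eta> < pi" and v: "Re v \<ge> 0" "\<bar>Im v\<bar> \<le> pi - \<eta>"
  shows "norm (Digamma (exp v) - v) \<le> 2 * (2 / (1 - cos \<eta>)) / exp (Re v)"
proof -
  define c where "c = (1 - cos \<eta>) / 2"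
  have "cos \<eta> < cos 0" using \<eta> by (intro cos_monotone_0_pi) auto
  then have c: "c > 0" by (simp add: c_def)
  define r where "r = exp (Re v)"
  have r: "r \<ge> 1" using v by (simp add: r_def)
  have v': "\<bar>Im v\<bar> < pi" using \<eta> v by simp
  define w where "w = exp v"
  have Lnw: "Ln w = v" unfolding w_def using v' by (intro Ln_exp) auto
  have nonpos: "w + of_real t \<notin> \<real>\<^sub>\<le>\<^sub>0" if "t \<ge> 0" for t
    unfolding w_def using exp_plus_notin_nonpos_Reals[OF v' that] .
  have ge: "sqrt c * (r + t) \<le> norm (w + of_real t)" if "t \<ge> 0" for t
    unfolding w_def r_def c_def using norm_exp_plus_real_ge[OF \<eta> v(2) that] .
  define T where "T k = Ln (w + of_nat (Suc k)) - Ln (w + of_nat k) - inverse (w + of_nat k)" for k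
  have T: "norm (T k) \<le> 1 / (c * (r + k)\<^sup>2)" for k
  proof -
    define z where "z = w + of_nat k"
    have seg: "\<exists>t\<in>{0..1}. s = of_real t" if "s \<in> closed_segment 0 (1::complex)" for s
      using that by (auto simp: in_segment scaleR_conv_of_real)
    have zs: "z + of_real t \<notin> \<real>\<^sub>\<le>\<^sub>0" "sqrt c * (r + k) \<le> norm (z + of_real t)" if "t \<in> {0..1}" for t
    proof -
      have eq: "z + of_real t = w + of_real (k + t)" by (simp add: z_def)
      show "z + of_real t \<notin> \<real>\<^sub>\<le>\<^sub>0" unfolding eq using that by (intro nonpos) auto
      have "sqrt c * (r + k) \<le> sqrt c * (r + (k + t))" using c that by (intro mult_left_mono) auto
      also have "\<dots> \<le> norm (z + of_real t)" unfolding eq using that by (intro ge) auto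
      finally show "sqrt c * (r + k) \<le> norm (z + of_real t)" .
    qed
    have z0: "z \<noteq> 0" using zs(1)[of 0] by auto
    have "norm ((Ln (z + 1) - 1 / z) - (Ln (z + 0) - 0 / z)) \<le> 1 / (c * (r + k)\<^sup>2) * norm (1 - 0 :: complex)"
    proof (rule field_differentiable_bound[where f = "\<lambda>s. Ln (z + s) - s / z" and f' = "\<lambda>s. inverse (z + s) - 1 / z" and S = "closed_segment 0 1"])
      fix s assume "s \<in> closed_segment 0 (1::complex)"
      then obtain t where t: "t \<in> {0..1}" "s = of_real t" using seg by blast
      show "((\<lambda>s. Ln (z + s) - s / z) has_field_derivative inverse (z + s) - 1 / z) (at s within closed_segment 0 1)"
        using zs(1)[OF t(1)] z0 t by (auto intro!: derivative_eq_intros simp: divide_inverse)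
      have ne: "z + s \<noteq> 0" using zs(1)[OF t(1)] t by auto
      have "inverse (z + s) - 1 / z = - s / (z * (z + s))" using ne z0 by (simp add: field_simps)
      then have "norm (inverse (z + s) - 1 / z) = t / (norm z * norm (z + s))"
        using t by (simp add: norm_divide norm_mult)
      also have "\<dots> \<le> 1 / (norm z * norm (z + s))" using t by (intro divide_right_mono) auto
      also have "\<dots> \<le> 1 / ((sqrt c * (r + k)) * (sqrt c * (r + k)))"
      proof (intro divide_left_mono mult_mono mult_pos_pos)
        show "0 < sqrt c" "0 < r + k" "0 < sqrt c" "0 < r + k" using c r by auto
        show "sqrt c * (r + k) \<le> norm z" using zs(2)[of 0] by simp
        show "sqrt c * (r + k) \<le> norm (z + s)" using zs(2)[OF t(1)] t by simp
        show "0 < norm z" "0 < norm (z + s)" using ne z0 by auto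
      qed (use c r in auto)
      also have "\<dots> = 1 / (c * (r + k)\<^sup>2)" using c by (simp add: power2_eq_square algebra_simps)
      finally show "norm (inverse (z + s) - 1 / z) \<le> 1 / (c * (r + k)\<^sup>2)" .
    qed auto
    then show ?thesis by (simp add: T_def z_def inverse_eq_divide algebra_simps)
  qed
  have sumT: "norm (\<Sum>k<m. T k) \<le> 2 / (c * r)" for m :: nat
  proof -
    have "norm (\<Sum>k<m. T k) \<le> (\<Sum>k<m. 2 / c * (1 / (r + k) - 1 / (r + Suc k)))"
    proof (rule sum_norm_le)
      fix k
      \<comment> \<open>A telescoping majorant; the factor 2 pays for
        \<open>x + 1 \<le> 2 * x\<close>, which holds since \<open>r \<ge> 1\<close>.\<close>
      have "1 / (c * (r + k)\<^sup>2) \<le> 2 / c * (1 / (r + k) - 1 / (r + Suc k))"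
      proof -
        have "1 / (r + k)\<^sup>2 \<le> 2 / ((r + k) * (r + Suc k))"
        proof -
          define x where "x = r + k"
          have x: "x \<ge> 1" using r by (simp add: x_def)
          have "1 / x\<^sup>2 = 2 / (x * (2 * x))" by (simp add: power2_eq_square)
          also have "\<dots> \<le> 2 / (x * (x + 1))"
            using x by (intro divide_left_mono mult_left_mono mult_pos_pos) auto
          finally show ?thesis by (simp add: x_def add_ac)
        qed
        also have "\<dots> = 2 * (1 / (r + k) - 1 / (r + Suc k))" using r by (simp add: field_simps)
        finally have "1 / c * (1 / (r + k)\<^sup>2) \<le> 1 / c * (2 * (1 / (r + k) - 1 / (r + Suc k)))"
          using c by (intro mult_left_mono) auto
        then show ?thesis by simp
      qed
      then show "norm (T k) \<le> 2 / c * (1 / (r + k) - 1 / (r + Suc k))" using T[of k] by linarith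
    qed
    also have "\<dots> = 2 / c * (\<Sum>k<m. 1 / (r + k) - 1 / (r + Suc k))" by (simp add: sum_distrib_left)
    also have "(\<Sum>k<m. 1 / (r + k) - 1 / (r + Suc k)) = 1 / r - 1 / (r + m)"
      by (induction m) auto
    also have "2 / c * (1 / r - 1 / (r + m)) \<le> 2 / c * (1 / r)"
      using c r by (intro mult_left_mono) auto
    finally show ?thesis by simp
  qed
  have tele: "(\<Sum>k<m. T k) = Ln (w + of_nat m) - Ln w - (\<Sum>k<m. inverse (w + of_nat k))" for m
    by (induction m) (auto simp: T_def)
  have "w \<noteq> 0" by (simp add: w_def)
  then have D: "(\<lambda>m. of_real (ln (real m)) - (\<Sum>k<m. inverse (w + of_nat k))) \<longlonglongrightarrow> Digamma w"
    by (rule Digamma_LIMSEQ)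
  have L: "(\<lambda>m. Ln (w + of_nat m) - of_real (ln (real m))) \<longlonglongrightarrow> 0"
  proof -
    have "(\<lambda>m. w / of_nat m) \<longlonglongrightarrow> 0" by (rule lim_const_over_n)
    then have "(\<lambda>m. Ln (w / of_nat m + 1)) \<longlonglongrightarrow> Ln (0 + 1)"
      by (intro tendsto_intros) auto
    moreover have "eventually (\<lambda>m. Ln (w / of_nat m + 1) = Ln (w + of_nat m) - of_real (ln (real m))) sequentially"
      using eventually_gt_at_top[of 0]
    proof eventually_elim
      case (elim m)
      have "w / of_nat m + 1 \<noteq> 0" using nonpos[of "real m"] elim by (auto simp: field_simps)
      then have "Ln (of_real (real m) * (w / of_nat m + 1)) = of_real (ln (real m)) + Ln (w / of_nat m + 1)"
        using Ln_times_of_real[of "real m" "w / of_nat m + 1"] elim by (simp add: Ln_of_real)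
      moreover have "of_real (real m) * (w / of_nat m + 1) = w + of_nat m" using elim by (simp add: field_simps)
      ultimately show ?case by simp
    qed
    ultimately show ?thesis by (auto elim: Lim_transform_eventually)
  qed
  have "(\<lambda>m. \<Sum>k<m. T k) \<longlonglongrightarrow> Digamma w + 0 - Ln w"
    unfolding tele using tendsto_diff[OF tendsto_add[OF D L] tendsto_const[of "Ln w"]] by (simp add: algebra_simps)
  then have "(\<lambda>m. norm (\<Sum>k<m. T k)) \<longlonglongrightarrow> norm (Digamma w + 0 - Ln w)" by (rule tendsto_norm)
  then have "norm (Digamma w + 0 - Ln w) \<le> 2 / (c * r)"
    by (rule LIMSEQ_le_const2) (use sumT in auto)
  then show ?thesis unfolding Lnw by (simp add: w_def c_def r_def)
qed

text \<open>In the coordinate \<open>v\<close> the derivative of the difference is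
  \<open>exp v * (Digamma (exp v) - v)\<close>, bounded by the preceding lemma, so the difference
  grows at most linearly in \<open>v\<close>, that is, logarithmically in \<open>u\<close>.
  Exponentiated, this is a factor of polynomial growth, as is its inverse.\<close>

theorem weak_stirling:
  assumes \<eta>: "0 < \<eta>" "\<eta> < pi"
  obtains C where "C \<ge> 0" "\<And>v. Re v \<ge> 0 \<Longrightarrow> \<bar>Im v\<bar> \<le> pi - \<eta> \<Longrightarrow>
    norm (ln_Gamma (exp v) - (v - 1) * exp v) \<le> C * (1 + norm v)"
proof -
  define S where "S = {v. Re v \<ge> 0} \<inter> ({v. Im v \<le> pi - \<eta>} \<inter> {v. Im v \<ge> - (pi - \<eta>)})"
  have "convex S" unfolding S_def
    by (intro convex_Int convex_halfspace_Re_ge convex_halfspace_Im_le convex_halfspace_Im_ge)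
  define \<Psi> where "\<Psi> v = ln_Gamma (exp v) - (v - 1) * exp v" for v :: complex
  define C where "C = 2 * (2 / (1 - cos \<eta>))"
  have "cos \<eta> \<le> 1" by simp
  then have C: "C \<ge> 0" by (simp add: C_def)
  have *: "norm (\<Psi> v - \<Psi> 0) \<le> C * norm (v - 0)" if "v \<in> S" for v
  proof (rule field_differentiable_bound[OF \<open>convex S\<close>, where f' = "\<lambda>v. exp v * (Digamma (exp v) - v)"])
    fix v assume v: "v \<in> S"
    then have "exp v \<notin> \<real>\<^sub>\<le>\<^sub>0" using \<eta> by (intro exp_notin_nonpos_Reals) (auto simp: S_def)
    then show "(\<Psi> has_field_derivative exp v * (Digamma (exp v) - v)) (at v within S)"
      unfolding \<Psi>_def by (auto intro!: derivative_eq_intros simp: algebra_simps)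
    have "norm (Digamma (exp v) - v) \<le> C / exp (Re v)"
      unfolding C_def using v \<eta> by (intro norm_Digamma_minus_Ln_le) (auto simp: S_def)
    then show "norm (exp v * (Digamma (exp v) - v)) \<le> C"
      unfolding norm_mult norm_exp_eq_Re by (simp add: field_simps)
  qed (use that \<eta> in \<open>auto simp: S_def\<close>)
  show ?thesis
  proof (rule that)
    show "0 \<le> C + norm (\<Psi> 0)" using C by simp
    fix v :: complex assume "Re v \<ge> 0" "\<bar>Im v\<bar> \<le> pi - \<eta>"
    then have "v \<in> S" by (auto simp: S_def)
    then have "norm (\<Psi> v) \<le> norm (\<Psi> 0) + C * norm v"
      using *[of v] norm_triangle_ineq2[of "\<Psi> v" "\<Psi> 0"] by simp
    also have "\<dots> \<le> (C + norm (\<Psi> 0)) * (1 + norm v)" using C by (simp add: algebra_simps)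
    finally show "norm (ln_Gamma (exp v) - (v - 1) * exp v) \<le> (C + norm (\<Psi> 0)) * (1 + norm v)"
      by (simp add: \<Psi>_def)
  qed
qed

text \<open>The error term in the logarithm of Stirling's formula at
  \<open>u = exp (v + i * \<phi>)\<close>. The angle \<open>\<phi>\<close> turns the strip towards
  the direction in which \<open>Gamma\<close> is evaluated.\<close>

definition stirling_factor :: "real \<Rightarrow> complex \<Rightarrow> complex" where
  "stirling_factor \<phi> v = ln_Gamma (exp (v + \<i> * of_real \<phi>)) - (v + \<i> * of_real \<phi> - 1) * exp (v + \<i> * of_real \<phi>)"

lemma Gamma_eq_stirling_factor:
  assumes "\<bar>Im v + \<phi>\<bar> < pi"
  shows "Gamma (exp (v + \<i> * of_real \<phi>)) = exp ((v + \<i> * of_real \<phi> - 1) * exp (v + \<i> * of_real \<phi>)) * exp (stirling_factor \<phi> v)"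
proof -
  have "exp (v + \<i> * of_real \<phi>) \<notin> \<real>\<^sub>\<le>\<^sub>0" using assms by (intro exp_notin_nonpos_Reals) auto
  then have "exp (v + \<i> * of_real \<phi>) \<notin> \<int>\<^sub>\<le>\<^sub>0" using nonpos_Ints_subset_nonpos_Reals by blast
  then show ?thesis
    by (simp add: Gamma_complex_altdef stirling_factor_def flip: exp_add)
qed

text \<open>It is applied with \<open>\<sigma> = 1\<close> and \<open>\<sigma> = -1\<close>, for
  \<open>Gamma\<close> and its inverse. The bound on \<open>\<phi>\<close> is chosen so that the
  angle \<open>Im v + \<phi>\<close> stays within \<open>pi - \<eta>\<close>, where
  \<open>weak_stirling\<close> holds.\<close>

lemma exp_stirling_factor_tame:
  assumes \<eta>: "0 < \<eta>" and \<phi>: "\<bar>\<phi>\<bar> \<le> pi / 2 - 2 * \<eta>" and \<sigma>: "norm \<sigma> \<le> 1"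
  shows "(\<lambda>v. exp (\<sigma> * stirling_factor \<phi> v)) \<in> tame \<eta>"
proof -
  have \<eta>pi: "\<eta> < pi" using assms by auto
  obtain C where C: "C \<ge> 0" "\<And>v. Re v \<ge> 0 \<Longrightarrow> \<bar>Im v\<bar> \<le> pi - \<eta> \<Longrightarrow>
    norm (ln_Gamma (exp v) - (v - 1) * exp v) \<le> C * (1 + norm v)"
    using weak_stirling[OF \<eta> \<eta>pi] by blast
  have im: "\<bar>Im v + \<phi>\<bar> \<le> pi - \<eta>" if "v \<in> strip \<eta>" for v
    using that \<phi> by (auto simp: strip_def)
  show ?thesis
  proof (rule tameI)
    have "exp (v + \<i> * of_real \<phi>) \<notin> \<real>\<^sub>\<le>\<^sub>0" if "v \<in> strip \<eta>" for v
      using im[OF that] \<eta> by (intro exp_notin_nonpos_Reals) auto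
    then show "(\<lambda>v. exp (\<sigma> * stirling_factor \<phi> v)) holomorphic_on strip \<eta>"
      unfolding stirling_factor_def by (auto intro!: analytic_imp_holomorphic analytic_intros)
    show "norm (exp (\<sigma> * stirling_factor \<phi> v)) \<le> exp (C * (1 + pi)) * exp (C * Re v)" if v: "v \<in> strip \<eta>" for v
    proof -
      have "Re (\<sigma> * stirling_factor \<phi> v) \<le> norm (\<sigma> * stirling_factor \<phi> v)" by (rule complex_Re_le_cmod)
      also have "\<dots> \<le> 1 * norm (stirling_factor \<phi> v)"
        unfolding norm_mult using \<sigma> by (intro mult_right_mono) auto
      also have "\<dots> \<le> C * (1 + norm (v + \<i> * of_real \<phi>))"
        unfolding stirling_factor_def using C(2)[of "v + \<i> * of_real \<phi>"] v im[OF v] by (simp add: strip_def)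
      also have "\<dots> \<le> C * (1 + (Re v + pi))"
      proof (intro mult_left_mono add_left_mono C(1))
        have "norm (v + \<i> * of_real \<phi>) \<le> \<bar>Re v\<bar> + \<bar>Im v + \<phi>\<bar>"
          using cmod_le[of "v + \<i> * of_real \<phi>"] by simp
        then show "norm (v + \<i> * of_real \<phi>) \<le> Re v + pi" using im[OF v] v \<eta> by (simp add: strip_def)
      qed
      also have "\<dots> = C * (1 + pi) + C * Re v" by (simp add: algebra_simps)
      finally show ?thesis unfolding norm_exp_eq_Re exp_add[symmetric] by simp
    qed
  qed
qed

section \<open>Algebraic independence, one function at a time\<close>

text \<open>The algebra of polynomial expressions in the \<open>f i\<close>, generated inductively
  so that holomorphy, continuation and invariance under twisting pass from the \<open>f i\<close> to
  all of it.\<close>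

inductive_set polys :: "'i set \<Rightarrow> ('i \<Rightarrow> 'a \<Rightarrow> complex) \<Rightarrow> ('a \<Rightarrow> complex) set"
  for I f where
  polys_const: "(\<lambda>_. c) \<in> polys I f"
| polys_gen: "i \<in> I \<Longrightarrow> f i \<in> polys I f"
| polys_add: "g \<in> polys I f \<Longrightarrow> h \<in> polys I f \<Longrightarrow> (\<lambda>z. g z + h z) \<in> polys I f"
| polys_mult: "g \<in> polys I f \<Longrightarrow> h \<in> polys I f \<Longrightarrow> (\<lambda>z. g z * h z) \<in> polys I f"

lemma polys_mono: "g \<in> polys I f \<Longrightarrow> I \<subseteq> J \<Longrightarrow> g \<in> polys J f"
  by (induction rule: polys.induct) (auto intro: polys.intros)

lemma polys_sum: "(\<And>x. x \<in> X \<Longrightarrow> g x \<in> polys I f) \<Longrightarrow> (\<lambda>z. \<Sum>x\<in>X. g x z) \<in> polys I f"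
  by (induction X rule: infinite_finite_induct) (auto intro: polys.intros)

lemma polys_prod: "(\<And>x. x \<in> X \<Longrightarrow> g x \<in> polys I f) \<Longrightarrow> (\<lambda>z. \<Prod>x\<in>X. g x z) \<in> polys I f"
  by (induction X rule: infinite_finite_induct) (auto intro: polys.intros)

lemma polys_power: "g \<in> polys I f \<Longrightarrow> (\<lambda>z. g z ^ n) \<in> polys I f"
  by (induction n) (auto intro: polys.intros)

lemma polys_closed:
  assumes "g \<in> polys I f"
    and "\<And>c. P (\<lambda>_. c)" "\<And>i. i \<in> I \<Longrightarrow> P (f i)"
    and "\<And>g h. P g \<Longrightarrow> P h \<Longrightarrow> P (\<lambda>z. g z + h z)" "\<And>g h. P g \<Longrightarrow> P h \<Longrightarrow> P (\<lambda>z. g z * h z)"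
  shows "P g"
  using assms(1) by induction (auto intro: assms)

lemma polys_holomorphic:
  assumes "g \<in> polys I f" "\<And>i. i \<in> I \<Longrightarrow> f i holomorphic_on S"
  shows "g holomorphic_on S"
  using assms(1) by (rule polys_closed) (auto intro: holomorphic_intros assms(2))

lemma polys_insert_expansion:
  assumes "g \<in> polys (insert i I) f"
  obtains N A where "\<And>j. A j \<in> polys I f" "\<And>j. j > N \<Longrightarrow> A j = (\<lambda>_. 0)"
    "\<And>z. g z = (\<Sum>j\<le>N. A j z * f i z ^ j)"
proof -
  define P where "P g \<longleftrightarrow> (\<exists>N A. (\<forall>j. A j \<in> polys I f) \<and> (\<forall>j>N. A j = (\<lambda>_. 0)) \<and>
     (\<forall>z. g z = (\<Sum>j\<le>N. A j z * f i z ^ j)))" for g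
  have coeff0: "P g" if "g \<in> polys I f" for g
    unfolding P_def
    by (rule exI[of _ 0], rule exI[of _ "\<lambda>j. if j = 0 then g else (\<lambda>_. 0)"])
       (use that in \<open>auto intro: polys_const\<close>)
  have "P g"
    using assms
  proof (induction rule: polys.induct)
    case (polys_const c)
    then show ?case by (intro coeff0 polys.polys_const)
  next
    case (polys_gen k)
    show ?case
    proof (cases "k = i")
      case True
      then show ?thesis unfolding P_def
        by (intro exI[of _ 1] exI[of _ "\<lambda>j. if j = 1 then (\<lambda>_. 1) else (\<lambda>_. 0)"])
           (auto intro: polys.polys_const)
    qed (use polys_gen in \<open>auto intro: coeff0 polys.polys_gen\<close>)
  next
    case (polys_add g h)
    from polys_add.IH(1) obtain N A where A: "\<And>j. A j \<in> polys I f" "\<And>j. j > N \<Longrightarrow> A j = (\<lambda>_. 0)" "\<And>z. g z = (\<Sum>j\<le>N. A j z * f i z ^ j)"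
      unfolding P_def by blast
    from polys_add.IH(2) obtain M B where B: "\<And>j. B j \<in> polys I f" "\<And>j. j > M \<Longrightarrow> B j = (\<lambda>_. 0)" "\<And>z. h z = (\<Sum>j\<le>M. B j z * f i z ^ j)"
      unfolding P_def by blast
    have "g z = (\<Sum>j\<le>max N M. A j z * f i z ^ j)" for z
      unfolding A(3) by (rule sum.mono_neutral_left) (auto simp: A(2))
    moreover have "h z = (\<Sum>j\<le>max N M. B j z * f i z ^ j)" for z
      unfolding B(3) by (rule sum.mono_neutral_left) (auto simp: B(2))
    ultimately have "g z + h z = (\<Sum>j\<le>max N M. (A j z + B j z) * f i z ^ j)" for z
      by (simp add: distrib_right sum.distrib)
    moreover have "(\<lambda>z. A j z + B j z) \<in> polys I f" for j by (intro polys.polys_add A B)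
    moreover have "(\<lambda>z. A j z + B j z) = (\<lambda>_. 0)" if "j > max N M" for j
      using that by (simp add: A(2) B(2))
    ultimately show ?case unfolding P_def
      by (intro exI[of _ "max N M"] exI[of _ "\<lambda>j z. A j z + B j z"]) blast
  next
    case (polys_mult g h)
    from polys_mult.IH(1) obtain N A where A: "\<And>j. A j \<in> polys I f" "\<And>j. j > N \<Longrightarrow> A j = (\<lambda>_. 0)" "\<And>z. g z = (\<Sum>j\<le>N. A j z * f i z ^ j)"
      unfolding P_def by blast
    from polys_mult.IH(2) obtain M B where B: "\<And>j. B j \<in> polys I f" "\<And>j. j > M \<Longrightarrow> B j = (\<lambda>_. 0)" "\<And>z. h z = (\<Sum>j\<le>M. B j z * f i z ^ j)"
      unfolding P_def by blast
    have "g z * h z = (\<Sum>r\<le>N + M. (\<Sum>k\<le>r. A k z * B (r - k) z) * f i z ^ r)" for z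
      unfolding A(3) B(3) by (rule polynomial_product) (auto simp: A(2) B(2))
    moreover have "(\<lambda>z. \<Sum>k\<le>r. A k z * B (r - k) z) \<in> polys I f" for r
      by (intro polys_sum polys.polys_mult A B)
    moreover have "(\<lambda>z. \<Sum>k\<le>r. A k z * B (r - k) z) = (\<lambda>_. 0)" if "r > N + M" for r
    proof
      fix z
      have "A k z * B (r - k) z = 0" if "k \<le> r" for k
        using \<open>r > N + M\<close> that A(2)[of k] B(2)[of "r - k"] by (cases "k > N") auto
      then show "(\<Sum>k\<le>r. A k z * B (r - k) z) = 0" by (intro sum.neutral) auto
    qed
    ultimately show ?case unfolding P_def
      by (intro exI[of _ "N + M"] exI[of _ "\<lambda>r z. \<Sum>k\<le>r. A k z * B (r - k) z"]) blast
  qed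
  then show ?thesis using that unfolding P_def by blast
qed

text \<open>A monomial is an exponent function on the whole index type, of which only the
  restriction to \<open>I\<close> counts; injectivity of the restriction on \<open>M\<close>
  expresses that the monomials are distinct.\<close>

definition indep_on :: "'a set \<Rightarrow> 'i set \<Rightarrow> ('i \<Rightarrow> 'a \<Rightarrow> complex) \<Rightarrow> bool" where
  "indep_on D I f \<longleftrightarrow> (\<forall>(M :: ('i \<Rightarrow> nat) set) c. finite M \<longrightarrow> inj_on (\<lambda>m. restrict m I) M \<longrightarrow>
     (\<forall>z\<in>D. (\<Sum>m\<in>M. c m * (\<Prod>i\<in>I. f i z ^ m i)) = 0) \<longrightarrow> (\<forall>m\<in>M. c m = 0))"

text \<open>The coefficients are functions, and zero means zero on \<open>D\<close>. In
  \<open>indep_on_insert\<close> the independence over \<open>I\<close> turns this into vanishing of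
  the numerical coefficients.\<close>

definition transcendental_on :: "'a set \<Rightarrow> 'i set \<Rightarrow> ('i \<Rightarrow> 'a \<Rightarrow> complex) \<Rightarrow> ('a \<Rightarrow> complex) \<Rightarrow> bool" where
  "transcendental_on D I f g \<longleftrightarrow> (\<forall>N A. (\<forall>j. A j \<in> polys I f) \<longrightarrow>
     (\<forall>z\<in>D. (\<Sum>j\<le>N. A j z * g z ^ j) = 0) \<longrightarrow> (\<forall>j\<le>N. \<forall>z\<in>D. A j z = 0))"

lemma indep_on_empty:
  fixes f :: "'i \<Rightarrow> 'a \<Rightarrow> complex"
  assumes "D \<noteq> {}"
  shows "indep_on D {} f"
  unfolding indep_on_def
proof (intro allI impI ballI)
  fix M :: "('i \<Rightarrow> nat) set" and c m
  assume *: "finite M" "inj_on (\<lambda>m. restrict m {}) M" "\<forall>z\<in>D. (\<Sum>m\<in>M. c m * (\<Prod>i\<in>{}. f i z ^ m i)) = 0" "m \<in> M"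
  have "M = {m}" using *(2,4) by (auto simp: inj_on_def restrict_def)
  then show "c m = 0" using * assms by auto
qed

lemma indep_on_insert:
  fixes f :: "'i \<Rightarrow> 'a \<Rightarrow> complex"
  assumes "finite I" "i \<notin> I" "indep_on D I f" "transcendental_on D I f (f i)"
  shows "indep_on D (insert i I) f"
  unfolding indep_on_def
proof (intro allI impI)
  fix M :: "('i \<Rightarrow> nat) set" and c
  assume M: "finite M" "inj_on (\<lambda>m. restrict m (insert i I)) M"
    and eq: "\<forall>z\<in>D. (\<Sum>m\<in>M. c m * (\<Prod>k\<in>insert i I. f k z ^ m k)) = 0"
  define A where "A j z = (\<Sum>m\<in>{m\<in>M. m i = j}. c m * (\<Prod>k\<in>I. f k z ^ m k))" for j z
  define N where "N = Max (insert 0 ((\<lambda>m. m i) ` M))"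
  have N: "(\<lambda>m. m i) ` M \<subseteq> {..N}" using M(1) by (auto simp: N_def)
  have A: "A j \<in> polys I f" for j
  proof -
    have "(\<lambda>z. \<Sum>m\<in>{m\<in>M. m i = j}. c m * (\<Prod>k\<in>I. f k z ^ m k)) \<in> polys I f"
      by (intro polys_sum polys_mult polys_const polys_prod polys_power polys_gen) auto
    then show ?thesis by (simp add: A_def[abs_def])
  qed
  have "(\<Sum>j\<le>N. A j z * f i z ^ j) = 0" if "z \<in> D" for z
  proof -
    have "(\<Sum>j\<le>N. A j z * f i z ^ j) = (\<Sum>j\<le>N. \<Sum>m\<in>{m\<in>M. m i = j}. c m * (\<Prod>k\<in>insert i I. f k z ^ m k))"
      unfolding A_def sum_distrib_right
      by (intro sum.cong refl) (use assms(1,2) in auto)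
    also have "\<dots> = (\<Sum>m\<in>M. c m * (\<Prod>k\<in>insert i I. f k z ^ m k))"
      using M(1) N by (intro sum.group) auto
    finally show ?thesis using eq that by simp
  qed
  then have A0: "\<And>j z. j \<le> N \<Longrightarrow> z \<in> D \<Longrightarrow> A j z = 0"
    using assms(4) A unfolding transcendental_on_def by blast
  show "\<forall>m\<in>M. c m = 0"
  proof
    fix m assume m: "m \<in> M"
    have "inj_on (\<lambda>m. restrict m I) {m'\<in>M. m' i = m i}"
    proof (rule inj_onI)
      fix x y assume xy: "x \<in> {m'\<in>M. m' i = m i}" "y \<in> {m'\<in>M. m' i = m i}" "restrict x I = restrict y I"
      have "x k = y k" if "k \<in> insert i I" for k
        using xy that by (metis (mono_tags, lifting) insertE mem_Collect_eq restrict_apply')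
      then have "restrict x (insert i I) = restrict y (insert i I)" by (auto simp: restrict_def)
      then show "x = y" using M(2) xy by (auto dest: inj_onD)
    qed
    moreover have "\<forall>z\<in>D. (\<Sum>m\<in>{m'\<in>M. m' i = m i}. c m * (\<Prod>k\<in>I. f k z ^ m k)) = 0"
    proof -
      have "m i \<le> N" using N m by auto
      then show ?thesis using A0 by (simp only: A_def) blast
    qed
    moreover have "finite {m'\<in>M. m' i = m i}" using M(1) by simp
    ultimately have "\<forall>m'\<in>{m'\<in>M. m' i = m i}. c m' = 0"
      using assms(3) unfolding indep_on_def by blast
    then show "c m = 0" using m by blast
  qed
qed

section \<open>Reading the ring \<open>hol_disc\<close> as functions on the disc\<close>

lemma hol_fun_zero_iff: "f = 0 \<longleftrightarrow> (\<forall>z\<in>ball 0 1. hol_fun f z = 0)"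
  by transfer (auto simp: fun_eq_iff)

lemma hol_fun_add [simp]: "hol_fun (f + g) z = hol_fun f z + hol_fun g z"
  by transfer simp

lemma hol_fun_mult [simp]: "hol_fun (f * g) z = hol_fun f z * hol_fun g z"
  by transfer simp

lemma hol_fun_0 [simp]: "hol_fun 0 z = 0"
  by transfer simp

lemma hol_fun_1 [simp]: "z \<in> ball 0 1 \<Longrightarrow> hol_fun 1 z = 1"
  by transfer simp

lemma hol_fun_scale [simp]: "hol_fun (hol_scale c f) z = c * hol_fun f z"
  by transfer simp

lemma hol_fun_sum [simp]: "hol_fun (\<Sum>i\<in>A. f i) z = (\<Sum>i\<in>A. hol_fun (f i) z)"
  by (induction A rule: infinite_finite_induct) auto

lemma hol_fun_power [simp]: "z \<in> ball 0 1 \<Longrightarrow> hol_fun (f ^ n) z = hol_fun f z ^ n"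
  by (induction n) auto

lemma hol_fun_prod [simp]: "z \<in> ball 0 1 \<Longrightarrow> hol_fun (\<Prod>i\<in>A. f i) z = (\<Prod>i\<in>A. hol_fun (f i) z)"
  by (induction A rule: infinite_finite_induct) auto

lemma hol_fun_holomorphic: "hol_fun f holomorphic_on ball 0 1"
  using hol_fun by auto

lemma alg_freeI:
  fixes f :: "'i \<Rightarrow> hol_disc"
  assumes "\<And>S. finite S \<Longrightarrow> S \<subseteq> I \<Longrightarrow> \<exists>J. finite J \<and> S \<subseteq> J \<and> indep_on (ball 0 1) J (\<lambda>i. hol_fun (f i))"
  shows "alg_free I f"
  unfolding alg_free_def
proof (intro allI impI)
  fix p :: "'i cpoly"
  assume p: "\<forall>m\<in>Poly_Mapping.keys p. Poly_Mapping.keys m \<subseteq> I" "cpoly_eval f p = 0"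
  define S where "S = (\<Union>m\<in>Poly_Mapping.keys p. Poly_Mapping.keys m)"
  have "finite S" "S \<subseteq> I" using p by (auto simp: S_def)
  then obtain J where J: "finite J" "S \<subseteq> J" "indep_on (ball 0 1) J (\<lambda>i. hol_fun (f i))"
    using assms by blast
  define M where "M = Poly_Mapping.lookup ` Poly_Mapping.keys p"
  define c where "c m = Poly_Mapping.lookup p (Poly_Mapping.Abs_poly_mapping m)" for m
  have keysJ: "Poly_Mapping.keys m \<subseteq> J" if "m \<in> Poly_Mapping.keys p" for m
    using that J(2) unfolding S_def by auto
  have out: "Poly_Mapping.lookup m k = 0" if "m \<in> Poly_Mapping.keys p" "k \<notin> J" for m k
    using keysJ[OF that(1)] that(2) by (meson in_keys_iff subsetD)
  have "inj_on (\<lambda>m. restrict m J) M"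
  proof (rule inj_onI)
    fix x y assume xy: "x \<in> M" "y \<in> M" "restrict x J = restrict y J"
    show "x = y"
    proof
      fix k
      show "x k = y k"
      proof (cases "k \<in> J")
        case True
        then show ?thesis using xy(3) by (metis restrict_apply')
      next
        case False
        then show ?thesis using xy(1,2) out unfolding M_def by auto
      qed
    qed
  qed
  moreover have "(\<Sum>m\<in>M. c m * (\<Prod>i\<in>J. hol_fun (f i) z ^ m i)) = 0" if z: "z \<in> ball 0 1" for z
  proof -
    have "(\<Sum>m\<in>M. c m * (\<Prod>i\<in>J. hol_fun (f i) z ^ m i)) =
      (\<Sum>m\<in>Poly_Mapping.keys p. Poly_Mapping.lookup p m * (\<Prod>i\<in>J. hol_fun (f i) z ^ Poly_Mapping.lookup m i))"
      unfolding M_def c_def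
      by (subst sum.reindex)
         (simp_all add: inj_on_def Poly_Mapping.lookup_inverse Poly_Mapping.lookup_inject)
    also have "\<dots> = (\<Sum>m\<in>Poly_Mapping.keys p. Poly_Mapping.lookup p m *
       (\<Prod>i\<in>Poly_Mapping.keys m. hol_fun (f i) z ^ Poly_Mapping.lookup m i))"
    proof (intro sum.cong arg_cong2[where f = "(*)"] refl)
      fix m assume "m \<in> Poly_Mapping.keys p"
      from keysJ[OF this] show "(\<Prod>i\<in>J. hol_fun (f i) z ^ Poly_Mapping.lookup m i) =
        (\<Prod>i\<in>Poly_Mapping.keys m. hol_fun (f i) z ^ Poly_Mapping.lookup m i)"
        using J(1) by (intro prod.mono_neutral_right) (simp_all add: in_keys_iff)
    qed
    also have "\<dots> = hol_fun (cpoly_eval f p) z"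
      using z by (simp add: cpoly_eval_def)
    finally show ?thesis using p(2) by simp
  qed
  moreover have "finite M" by (simp add: M_def)
  ultimately have "\<forall>m\<in>M. c m = 0"
    using J(3) unfolding indep_on_def by blast
  then have "Poly_Mapping.lookup p m = 0" if "m \<in> Poly_Mapping.keys p" for m
    using that unfolding M_def c_def by (auto simp: Poly_Mapping.lookup_inverse)
  then have "Poly_Mapping.lookup p m = 0" for m by (cases "m \<in> Poly_Mapping.keys p") (auto simp: in_keys_iff)
  then show "p = 0" by (intro poly_mapping_eqI) simp
qed

section \<open>Twisting sums of exponentials by a character\<close>

text \<open>\<open>twist \<eta> d \<kappa> f f'\<close>: on the strip, \<open>f\<close> is a sum of exponentials with tame coefficients,
  and \<open>f'\<close> results from it by multiplying the term of exponent \<open>x\<close> by \<open>\<kappa> x\<close>.\<close>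

inductive twist :: "real \<Rightarrow> complex \<Rightarrow> (complex \<times> nat \<Rightarrow> complex) \<Rightarrow> (complex \<Rightarrow> complex) \<Rightarrow> (complex \<Rightarrow> complex) \<Rightarrow> bool"
  for \<eta> d \<kappa> where
  twist_base: "g \<in> tame \<eta> \<Longrightarrow> twist \<eta> d \<kappa> (\<lambda>v. g v * exp (expo d x v)) (\<lambda>v. \<kappa> x * g v * exp (expo d x v))"
| twist_add: "twist \<eta> d \<kappa> f f' \<Longrightarrow> twist \<eta> d \<kappa> g g' \<Longrightarrow> twist \<eta> d \<kappa> (\<lambda>v. f v + g v) (\<lambda>v. f' v + g' v)"
| twist_cong: "twist \<eta> d \<kappa> f f' \<Longrightarrow> (\<And>v. v \<in> strip \<eta> \<Longrightarrow> g v = f v) \<Longrightarrow> (\<And>v. v \<in> strip \<eta> \<Longrightarrow> g' v = f' v) \<Longrightarrow> twist \<eta> d \<kappa> g g'"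

lemma twist_tame:
  assumes "g \<in> tame \<eta>" "\<kappa> 0 = 1"
  shows "twist \<eta> d \<kappa> g g"
  by (rule twist_cong[OF twist_base[OF assms(1), of d \<kappa> 0]]) (auto simp: expo_def assms)

lemma twist_const: "\<kappa> 0 = 1 \<Longrightarrow> twist \<eta> d \<kappa> (\<lambda>_. c) (\<lambda>_. c)"
  by (rule twist_tame[OF tame_const])

text \<open>Exponents add when terms are multiplied, and a character is multiplicative. The second
  induction, over the other factor, is nested in the base case.\<close>

lemma twist_mult:
  assumes \<kappa>: "\<And>x y. \<kappa> (x + y) = \<kappa> x * \<kappa> y"
    and "twist \<eta> d \<kappa> f f'" "twist \<eta> d \<kappa> g g'"
  shows "twist \<eta> d \<kappa> (\<lambda>v. f v * g v) (\<lambda>v. f' v * g' v)"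
  using assms(2)
proof induction
  case (twist_base h x)
  show ?case using assms(3)
  proof induction
    case (twist_base k y)
    show ?case
      by (rule twist_cong[OF twist.twist_base[OF tame_mult[OF \<open>h \<in> tame \<eta>\<close> \<open>k \<in> tame \<eta>\<close>], of d \<kappa> "x + y"]])
         (auto simp: \<kappa> expo_add exp_add algebra_simps)
  next
    case (twist_add f f' g g')
    from twist.twist_add[OF twist_add.IH] show ?case by (rule twist_cong) (auto simp: algebra_simps)
  next
    case (twist_cong f f' g g')
    from twist_cong.IH show ?case by (rule twist.twist_cong) (use twist_cong.hyps in auto)
  qed
next
  case (twist_add f f' h h')
  from twist.twist_add[OF twist_add.IH] show ?case by (rule twist_cong) (auto simp: algebra_simps)
next
  case (twist_cong f f' h h')
  from twist_cong.IH show ?case by (rule twist.twist_cong) (use twist_cong.hyps in auto)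
qed

lemma twist_sum:
  assumes "\<kappa> 0 = 1" "\<And>x. x \<in> X \<Longrightarrow> twist \<eta> d \<kappa> (f x) (f' x)"
  shows "twist \<eta> d \<kappa> (\<lambda>v. \<Sum>x\<in>X. f x v) (\<lambda>v. \<Sum>x\<in>X. f' x v)"
  using assms(2)
  by (induction X rule: infinite_finite_induct) (auto intro: twist_const twist_add assms(1))

lemma twist_prod:
  assumes "\<kappa> 0 = 1" "\<And>x y. \<kappa> (x + y) = \<kappa> x * \<kappa> y" "\<And>x. x \<in> X \<Longrightarrow> twist \<eta> d \<kappa> (f x) (f' x)"
  shows "twist \<eta> d \<kappa> (\<lambda>v. \<Prod>x\<in>X. f x v) (\<lambda>v. \<Prod>x\<in>X. f' x v)"
  using assms(3)
  by (induction X rule: infinite_finite_induct) (auto intro: twist_const twist_mult assms(1,2))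

lemma twist_power:
  assumes "\<kappa> 0 = 1" "\<And>x y. \<kappa> (x + y) = \<kappa> x * \<kappa> y" "twist \<eta> d \<kappa> f f'"
  shows "twist \<eta> d \<kappa> (\<lambda>v. f v ^ n) (\<lambda>v. f' v ^ n)"
  by (induction n) (auto intro: twist_const twist_mult assms)

text \<open>Terms with equal exponents are collected, as \<open>exponentials_independent\<close>
  demands. In the induction, \<open>g x\<close> is kept zero outside \<open>X\<close> so that the
  supports of two summands can be merged.\<close>

lemma twist_normal_form:
  assumes "twist \<eta> d \<kappa> f f'"
  obtains X g where "finite X" "\<And>x. g x \<in> tame \<eta>"
    "\<And>v. v \<in> strip \<eta> \<Longrightarrow> f v = (\<Sum>x\<in>X. g x v * exp (expo d x v))"
    "\<And>v. v \<in> strip \<eta> \<Longrightarrow> f' v = (\<Sum>x\<in>X. \<kappa> x * (g x v * exp (expo d x v)))"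
proof -
  have "\<exists>X g. finite X \<and> (\<forall>x. g x \<in> tame \<eta>) \<and> (\<forall>x. x \<notin> X \<longrightarrow> g x = (\<lambda>_. 0)) \<and>
    (\<forall>v\<in>strip \<eta>. f v = (\<Sum>x\<in>X. g x v * exp (expo d x v))) \<and>
    (\<forall>v\<in>strip \<eta>. f' v = (\<Sum>x\<in>X. \<kappa> x * (g x v * exp (expo d x v))))"
    using assms
  proof induction
    case (twist_base g x)
    then show ?case
      by (intro exI[of _ "{x}"] exI[of _ "\<lambda>y. if y = x then g else (\<lambda>_. 0)"]) (auto intro: tame_const)
  next
    case (twist_add f1 f1' f2 f2')
    then obtain X g where X: "finite X" "\<forall>x. g x \<in> tame \<eta>" "\<forall>x. x \<notin> X \<longrightarrow> g x = (\<lambda>_. 0)"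
      "\<forall>v\<in>strip \<eta>. f1 v = (\<Sum>x\<in>X. g x v * exp (expo d x v))"
      "\<forall>v\<in>strip \<eta>. f1' v = (\<Sum>x\<in>X. \<kappa> x * (g x v * exp (expo d x v)))" by blast
    from twist_add obtain Y h where Y: "finite Y" "\<forall>x. h x \<in> tame \<eta>" "\<forall>x. x \<notin> Y \<longrightarrow> h x = (\<lambda>_. 0)"
      "\<forall>v\<in>strip \<eta>. f2 v = (\<Sum>x\<in>Y. h x v * exp (expo d x v))"
      "\<forall>v\<in>strip \<eta>. f2' v = (\<Sum>x\<in>Y. \<kappa> x * (h x v * exp (expo d x v)))" by blast
    have eqs: "(\<Sum>x\<in>X. c x * (g x v * e x)) = (\<Sum>x\<in>X \<union> Y. c x * (g x v * e x))"
       "(\<Sum>x\<in>Y. c x * (h x v * e x)) = (\<Sum>x\<in>X \<union> Y. c x * (h x v * e x))" for c e :: "complex \<times> nat \<Rightarrow> complex" and v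
      using X Y by (auto intro!: sum.mono_neutral_left)
    show ?case
    proof (intro exI[of _ "X \<union> Y"] exI[of _ "\<lambda>x v. g x v + h x v"] conjI ballI allI impI)
      fix v assume v: "v \<in> strip \<eta>"
      show "f1 v + f2 v = (\<Sum>x\<in>X \<union> Y. (g x v + h x v) * exp (expo d x v))"
        using v X(4) Y(4) eqs(1)[of "\<lambda>_. 1" v "\<lambda>x. exp (expo d x v)"] eqs(2)[of "\<lambda>_. 1" v "\<lambda>x. exp (expo d x v)"]
        by (simp add: distrib_right sum.distrib)
      show "f1' v + f2' v = (\<Sum>x\<in>X \<union> Y. \<kappa> x * ((g x v + h x v) * exp (expo d x v)))"
        using v X(5) Y(5) eqs(1)[of \<kappa> v "\<lambda>x. exp (expo d x v)"] eqs(2)[of \<kappa> v "\<lambda>x. exp (expo d x v)"]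
        by (simp add: distrib_right distrib_left sum.distrib)
    qed (use X Y in \<open>auto intro: tame_add\<close>)
  next
    case (twist_cong f f' g g')
    then show ?case by auto
  qed
  then show ?thesis using that by blast
qed

text \<open>\<open>twist\<close> is a relation, as \<open>f'\<close> is built from a chosen
  representation of \<open>f\<close>. Independence of the exponentials forces all coefficients of
  the zero function to vanish, so any twist of 0 is 0 on the strip; hence twisting preserves
  algebraic relations.\<close>

theorem twist_zero:
  assumes "\<eta> > 0" "Re d > 0" "twist \<eta> d \<kappa> f f'" "\<And>v. v \<in> strip \<eta> \<Longrightarrow> f v = 0" "v \<in> strip \<eta>"
  shows "f' v = 0"
proof -
  obtain X g where X: "finite X" "\<And>x. g x \<in> tame \<eta>"
    "\<And>v. v \<in> strip \<eta> \<Longrightarrow> f v = (\<Sum>x\<in>X. g x v * exp (expo d x v))"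
    "\<And>v. v \<in> strip \<eta> \<Longrightarrow> f' v = (\<Sum>x\<in>X. \<kappa> x * (g x v * exp (expo d x v)))"
    using twist_normal_form[OF assms(3)] by blast
  have "g x v = 0" if "x \<in> X" for x
    by (rule exponentials_independent[OF assms(1,2) X(1) _ _ that assms(5)]) (use X assms(4) in auto)
  then show ?thesis using X(4)[OF assms(5)] by simp
qed

section \<open>The entire functions $\exp \ell_r$\<close>

definition neg1_roots :: "nat \<Rightarrow> complex set" where
  "neg1_roots r = {q. q ^ r = -1}"

lemma finite_neg1_roots [simp]: "r > 0 \<Longrightarrow> finite (neg1_roots r)"
  unfolding neg1_roots_def by (rule finite_nth_roots)

lemma norm_neg1_root:
  assumes "q \<in> neg1_roots r" "r > 0"
  shows "norm q = 1"
proof -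
  have "norm (q ^ r) = 1" using assms(1) unfolding neg1_roots_def by simp
  then have "norm q ^ r = 1" by (simp add: norm_power)
  then show ?thesis using power_eq_imp_eq_base[of "norm q" r 1] assms(2) by simp
qed

lemma neg1_root_nonzero: "q \<in> neg1_roots r \<Longrightarrow> q \<noteq> 0"
  by (cases r) (auto simp: neg1_roots_def)

lemma neg1_roots_1 [simp]: "neg1_roots (Suc 0) = {-1}"
  by (auto simp: neg1_roots_def)

text \<open>Multiplication by a primitive \<open>r\<close>-th root of unity \<open>\<omega>\<close>
  permutes \<open>neg1_roots r\<close> and multiplies the sum by \<open>(1 / \<omega>) ^ k\<close>,
  which differs from 1.\<close>

lemma sum_inverse_neg1_roots_power:
  assumes r: "r > 0" and k: "\<not> r dvd k"
  shows "(\<Sum>q\<in>neg1_roots r. (1 / q) ^ k) = 0"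
proof -
  define \<omega> where "\<omega> = exp (2 * of_real pi * \<i> * of_nat 1 / of_nat r)"
  have \<omega>r: "\<omega> ^ r = 1" using r by (simp add: \<omega>_def flip: exp_of_nat_mult)
  have \<omega>0: "\<omega> \<noteq> 0" by (simp add: \<omega>_def)
  have "\<omega> ^ k = exp (2 * of_real pi * \<i> * of_nat k / of_nat r)"
    by (simp add: \<omega>_def mult_ac flip: exp_of_nat_mult)
  then have \<omega>k: "\<omega> ^ k \<noteq> 1" using complex_root_unity_eq_1[of r k] r k by simp
  have "bij_betw (\<lambda>q. \<omega> * q) (neg1_roots r) (neg1_roots r)"
    by (rule bij_betwI[of _ _ _ "\<lambda>q. q / \<omega>"])
       (use \<omega>0 \<omega>r in \<open>auto simp: neg1_roots_def power_mult_distrib power_divide\<close>)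
  then have "(\<Sum>q\<in>neg1_roots r. (1 / q) ^ k) = (\<Sum>q\<in>neg1_roots r. (1 / (\<omega> * q)) ^ k)"
    by (rule sum.reindex_bij_betw[symmetric])
  also have "\<dots> = (1 / \<omega>) ^ k * (\<Sum>q\<in>neg1_roots r. (1 / q) ^ k)"
    by (simp add: sum_distrib_left power_divide power_mult_distrib)
  finally have "(1 - (1 / \<omega>) ^ k) * (\<Sum>q\<in>neg1_roots r. (1 / q) ^ k) = 0" by (simp add: algebra_simps)
  moreover have "(1 / \<omega>) ^ k \<noteq> 1" using \<omega>k by (simp add: power_divide)
  ultimately show ?thesis by simp
qed

definition Efun :: "nat \<Rightarrow> complex \<Rightarrow> complex" where
  "Efun r z = (\<Prod>q\<in>neg1_roots r. rGamma (1 - z / q))"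

lemma Efun_holomorphic [holomorphic_intros]: "Efun r holomorphic_on A"
  unfolding Efun_def[abs_def] by (intro holomorphic_intros) (use neg1_root_nonzero in auto)

lemma rGamma_one_minus_eq_0_iff:
  fixes q z :: complex
  assumes "q \<noteq> 0"
  shows "rGamma (1 - z / q) = 0 \<longleftrightarrow> (\<exists>n::nat. n \<ge> 1 \<and> z = q * of_nat n)"
proof
  assume "rGamma (1 - z / q) = 0"
  then have "1 - z / q \<in> \<int>\<^sub>\<le>\<^sub>0" by (simp add: rGamma_eq_zero_iff)
  then obtain n where "1 - z / q = - of_nat n" by (elim nonpos_Ints_cases')
  then have "z = q * of_nat (Suc n)" using assms by (simp add: field_simps)
  then show "\<exists>n::nat. n \<ge> 1 \<and> z = q * of_nat n" by (intro exI[of _ "Suc n"]) auto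
next
  assume "\<exists>n::nat. n \<ge> 1 \<and> z = q * of_nat n"
  then obtain n :: nat where n: "n \<ge> 1" "z = q * of_nat n" by blast
  then have "1 - z / q = - of_nat (n - 1)" using assms by (simp add: of_nat_diff)
  then have "1 - z / q \<in> \<int>\<^sub>\<le>\<^sub>0" by simp
  then show "rGamma (1 - z / q) = 0" by (simp add: rGamma_eq_zero_iff)
qed

lemma Efun_eq_0_iff:
  assumes "r > 0"
  shows "Efun r z = 0 \<longleftrightarrow> (\<exists>q\<in>neg1_roots r. \<exists>n::nat. n \<ge> 1 \<and> z = q * of_nat n)"
  unfolding Efun_def using assms rGamma_one_minus_eq_0_iff neg1_root_nonzero by auto

lemma Efun_nonzero_disc:
  assumes "r > 0" "norm z < 1"
  shows "Efun r z \<noteq> 0"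
proof
  assume "Efun r z = 0"
  then obtain q and n :: nat where q: "q \<in> neg1_roots r" "n \<ge> 1" "z = q * of_nat n"
    using Efun_eq_0_iff[OF assms(1)] by blast
  then have "norm z = n" using norm_neg1_root assms(1) by (simp add: norm_mult)
  then show False using q assms(2) by simp
qed

text \<open>With \<open>w = d * exp v / q\<close>, one of \<open>w\<close> and \<open>-w\<close> stays away from the negative real axis. In the first
  case the reflection formula replaces \<open>rGamma (1 - w)\<close> by \<open>Gamma w * sin (pi * w) / pi\<close>, so that
  Stirling's formula applies in both cases.\<close>

definition reduced_arg :: "complex \<Rightarrow> complex \<Rightarrow> real" where
  "reduced_arg d q = Arg (if Re (d / q) > 0 then d / q else - (d / q))"

definition tame_part :: "complex \<Rightarrow> complex \<Rightarrow> complex \<Rightarrow> complex" where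
  "tame_part d q v = (if Re (d / q) > 0 then exp (stirling_factor (reduced_arg d q) v) / of_real pi
     else exp (- (v + \<i> * of_real (reduced_arg d q))) * exp (- stirling_factor (reduced_arg d q) v))"

definition sine_part :: "complex \<Rightarrow> complex \<Rightarrow> complex \<Rightarrow> complex" where
  "sine_part d q v = (if Re (d / q) > 0 then sin (of_real pi * (d / q * exp v)) else 1)"

lemma cis_reduced_arg:
  assumes "norm d = 1" "norm q = 1"
  shows "cis (reduced_arg d q) = (if Re (d / q) > 0 then d / q else - (d / q))"
proof -
  have "norm (if Re (d / q) > 0 then d / q else - (d / q)) = 1" using assms by (simp add: norm_divide)
  moreover from this have "(if Re (d / q) > 0 then d / q else - (d / q)) \<noteq> 0" by (metis norm_zero zero_neq_one)
  ultimately show ?thesis unfolding reduced_arg_def by (subst cis_Arg) (simp_all add: sgn_eq)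
qed

text \<open>Both cases lead to the same exponent: in the second, \<open>w\<close> has the opposite
  sign but \<open>Gamma w\<close> stands in the denominator. The additional factor
  \<open>1 / w\<close> from \<open>Gamma_plus1\<close> is bounded on the strip and goes into
  \<open>tame_part\<close>.\<close>

lemma rGamma_factorization:
  assumes \<eta>: "\<eta> > 0" and norms: "norm d = 1" "norm q = 1"
    and reduced_arg: "\<bar>reduced_arg d q\<bar> \<le> pi / 2 - 2 * \<eta>" and v: "v \<in> strip \<eta>"
  shows "rGamma (1 - d * exp v / q) = exp ((v + \<i> * of_real (reduced_arg d q) - 1) * (d / q) * exp v) * tame_part d q v * sine_part d q v"
proof -
  define \<phi> where "\<phi> = reduced_arg d q"
  have im: "\<bar>Im v + \<phi>\<bar> < pi" using v reduced_arg \<eta> by (auto simp: strip_def \<phi>_def)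
  define w where "w = exp (v + \<i> * of_real \<phi>)"
  have w_eq: "w = exp v * cis \<phi>" by (simp add: w_def exp_add cis_conv_exp)
  have "w \<notin> \<real>\<^sub>\<le>\<^sub>0" unfolding w_def using im by (intro exp_notin_nonpos_Reals) auto
  then have wn: "w \<notin> \<int>\<^sub>\<le>\<^sub>0" using nonpos_Ints_subset_nonpos_Reals by blast
  have G: "Gamma w = exp ((v + \<i> * of_real \<phi> - 1) * w) * exp (stirling_factor \<phi> v)"
    unfolding w_def using im by (rule Gamma_eq_stirling_factor)
  have w0: "w \<noteq> 0" by (simp add: w_def)
  show ?thesis
  proof (cases "Re (d / q) > 0")
    case True
    then have c: "cis \<phi> = d / q" using cis_reduced_arg[OF norms] by (simp add: \<phi>_def)
    then have w: "w = d / q * exp v" using w_eq by simp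
    have "rGamma w \<noteq> 0" using wn by (simp add: rGamma_eq_zero_iff)
    then have "rGamma (1 - w) = Gamma w * sin (of_real pi * w) / of_real pi"
      using rGamma_reflection_complex[of w] by (simp add: Gamma_def field_simps)
    then show ?thesis using True w G by (simp add: tame_part_def sine_part_def \<phi>_def mult_ac)
  next
    case False
    then have c: "cis \<phi> = - (d / q)" using cis_reduced_arg[OF norms] by (simp add: \<phi>_def)
    then have w: "w = - (d / q) * exp v" using w_eq by simp
    have "rGamma (1 + w) = inverse (w * Gamma w)"
      using Gamma_plus1[OF wn] by (simp add: rGamma_inverse_Gamma add.commute)
    also have "\<dots> = exp (- (v + \<i> * of_real \<phi>)) * exp (- ((v + \<i> * of_real \<phi> - 1) * w)) * exp (- stirling_factor \<phi> v)"
      by (simp only: G exp_minus inverse_mult_distrib mult.assoc) (simp only: w_def)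
    also have "- ((v + \<i> * of_real \<phi> - 1) * w) = (v + \<i> * of_real \<phi> - 1) * (d / q) * exp v"
      by (simp add: w)
    finally show ?thesis using False w by (simp add: tame_part_def sine_part_def \<phi>_def mult_ac)
  qed
qed

lemma tame_part_tame:
  assumes "\<eta> > 0" "\<bar>reduced_arg d q\<bar> \<le> pi / 2 - 2 * \<eta>"
  shows "tame_part d q \<in> tame \<eta>"
proof (cases "Re (d / q) > 0")
  case True
  have "(\<lambda>v. exp (stirling_factor (reduced_arg d q) v) * (1 / of_real pi)) \<in> tame \<eta>"
    using exp_stirling_factor_tame[OF assms, of 1] by (intro tame_mult tame_const) simp
  then show ?thesis using True by (simp add: tame_part_def[abs_def])
next
  case False
  have "(\<lambda>v. exp (- (v + \<i> * of_real (reduced_arg d q)))) \<in> tame \<eta>"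
    by (rule tameI[of _ _ 1 0]) (auto intro!: holomorphic_intros simp: strip_def)
  moreover have "(\<lambda>v. exp (- stirling_factor (reduced_arg d q) v)) \<in> tame \<eta>"
    using exp_stirling_factor_tame[OF assms, of "-1"] by simp
  ultimately have "(\<lambda>v. exp (- (v + \<i> * of_real (reduced_arg d q))) * exp (- stirling_factor (reduced_arg d q) v)) \<in> tame \<eta>"
    by (rule tame_mult)
  then show ?thesis using False by (simp add: tame_part_def[abs_def])
qed

definition sine_twist :: "complex \<Rightarrow> (complex \<times> nat \<Rightarrow> complex) \<Rightarrow> complex \<Rightarrow> complex \<Rightarrow> complex" where
  "sine_twist d \<kappa> q v = (if Re (d / q) > 0 then
     (\<kappa> (\<i> * of_real pi * d / q, 0) * exp (\<i> * of_real pi * d / q * exp v) -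
      \<kappa> (- (\<i> * of_real pi * d / q), 0) * exp (- (\<i> * of_real pi * d / q) * exp v)) / (2 * \<i>) else 1)"

lemma twist_sine_part:
  assumes "\<kappa> 0 = 1" "\<And>x y. \<kappa> (x + y) = \<kappa> x * \<kappa> y"
  shows "twist \<eta> d \<kappa> (sine_part d q) (sine_twist d \<kappa> q)"
proof (cases "Re (d / q) > 0")
  case True
  define l where "l = \<i> * of_real pi * d / q"
  have "twist \<eta> d \<kappa> (\<lambda>v. 1 / (2 * \<i>) * exp (expo d (l, 0) v) + - (1 / (2 * \<i>)) * exp (expo d (- l, 0) v))
     (\<lambda>v. \<kappa> (l, 0) * (1 / (2 * \<i>)) * exp (expo d (l, 0) v) + \<kappa> (- l, 0) * (- (1 / (2 * \<i>))) * exp (expo d (- l, 0) v))"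
    by (intro twist_add twist_base tame_const)
  then show ?thesis
    by (rule twist_cong)
       (use True in \<open>auto simp: sine_part_def sine_twist_def l_def expo_def sin_exp_eq field_simps\<close>)
next
  case False
  then show ?thesis using twist_const[of \<kappa> \<eta> d 1] assms(1)
    by (simp add: sine_part_def[abs_def] sine_twist_def[abs_def])
qed

text \<open>The sum over \<open>q\<close> of the exponents in \<open>rGamma_factorization\<close>.
  The part containing \<open>v\<close> carries the factor \<open>d\<close> times the sum of
  \<open>1 / q\<close>, which is \<open>-1\<close> for \<open>s = 1\<close> and 0 otherwise; so only
  \<open>Efun 1\<close> has a term \<open>d * v * exp v\<close>, recorded in the second
  component.\<close>

definition Efun_exponent :: "complex \<Rightarrow> nat \<Rightarrow> complex \<times> nat" where
  "Efun_exponent d s = (d * (\<Sum>q\<in>neg1_roots s. (\<i> * of_real (reduced_arg d q) - 1) / q), if s = 1 then 1 else 0)"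

definition Efun_twist :: "complex \<Rightarrow> (complex \<times> nat \<Rightarrow> complex) \<Rightarrow> nat \<Rightarrow> complex \<Rightarrow> complex" where
  "Efun_twist d \<kappa> s v = \<kappa> (Efun_exponent d s) * exp (expo d (Efun_exponent d s) v) *
     (\<Prod>q\<in>neg1_roots s. tame_part d q v) * (\<Prod>q\<in>neg1_roots s. sine_twist d \<kappa> q v)"

lemma Efun_factorization:
  assumes "\<eta> > 0" "norm d = 1" "s > 0"
    and "\<And>q. q \<in> neg1_roots s \<Longrightarrow> \<bar>reduced_arg d q\<bar> \<le> pi / 2 - 2 * \<eta>" and "v \<in> strip \<eta>"
  shows "Efun s (d * exp v) = exp (expo d (Efun_exponent d s) v) *
    (\<Prod>q\<in>neg1_roots s. tame_part d q v) * (\<Prod>q\<in>neg1_roots s. sine_part d q v)"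
proof -
  have "Efun s (d * exp v) = (\<Prod>q\<in>neg1_roots s. exp ((v + \<i> * of_real (reduced_arg d q) - 1) * (d / q) * exp v) * tame_part d q v * sine_part d q v)"
    unfolding Efun_def using assms norm_neg1_root by (intro prod.cong rGamma_factorization) auto
  also have "\<dots> = exp (\<Sum>q\<in>neg1_roots s. (v + \<i> * of_real (reduced_arg d q) - 1) * (d / q) * exp v) *
    (\<Prod>q\<in>neg1_roots s. tame_part d q v) * (\<Prod>q\<in>neg1_roots s. sine_part d q v)"
    using assms(3) by (simp add: prod.distrib exp_sum)
  also have "(\<Sum>q\<in>neg1_roots s. (v + \<i> * of_real (reduced_arg d q) - 1) * (d / q) * exp v) =
     (\<Sum>q\<in>neg1_roots s. (\<i> * of_real (reduced_arg d q) - 1) / q * (d * exp v) + 1 / q * (d * v * exp v))"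
    by (intro sum.cong) (auto simp: diff_divide_distrib add_divide_distrib algebra_simps)
  also have "\<dots> = (\<Sum>q\<in>neg1_roots s. (\<i> * of_real (reduced_arg d q) - 1) / q) * (d * exp v) + (\<Sum>q\<in>neg1_roots s. 1 / q) * (d * v * exp v)"
    by (simp only: sum.distrib sum_distrib_right)
  also have "(\<Sum>q\<in>neg1_roots s. 1 / q) = - of_nat (if s = 1 then 1 else 0)"
    using sum_inverse_neg1_roots_power[of s 1] assms(3) by auto
  also have "(\<Sum>q\<in>neg1_roots s. (\<i> * of_real (reduced_arg d q) - 1) / q) * (d * exp v) + - of_nat (if s = 1 then 1 else 0) * (d * v * exp v)
    = expo d (Efun_exponent d s) v"
    unfolding expo_def Efun_exponent_def fst_conv snd_conv by (simp add: algebra_simps)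
  finally show ?thesis .
qed

lemma tw_Efun:
  assumes "\<eta> > 0" "norm d = 1" "s > 0"
    and "\<And>q. q \<in> neg1_roots s \<Longrightarrow> \<bar>reduced_arg d q\<bar> \<le> pi / 2 - 2 * \<eta>"
    and \<kappa>: "\<kappa> 0 = 1" "\<And>x y. \<kappa> (x + y) = \<kappa> x * \<kappa> y"
  shows "twist \<eta> d \<kappa> (\<lambda>v. Efun s (d * exp v)) (Efun_twist d \<kappa> s)"
proof -
  have "twist \<eta> d \<kappa> (\<lambda>v. (1 * exp (expo d (Efun_exponent d s) v) *
      (\<Prod>q\<in>neg1_roots s. tame_part d q v)) * (\<Prod>q\<in>neg1_roots s. sine_part d q v))
    (\<lambda>v. (\<kappa> (Efun_exponent d s) * 1 * exp (expo d (Efun_exponent d s) v) *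
     (\<Prod>q\<in>neg1_roots s. tame_part d q v)) * (\<Prod>q\<in>neg1_roots s. sine_twist d \<kappa> q v))"
    by (intro twist_mult twist_prod twist_sine_part twist_base tame_const twist_tame tame_part_tame assms)
  then show ?thesis
    by (rule twist_cong) (use Efun_factorization[OF assms(1-4)] in \<open>auto simp: Efun_twist_def\<close>)
qed

text \<open>\<open>cis (reduced_arg d q - \<alpha>)\<close> is \<open>1 / q\<close> up to sign,
  hence a root of unity. Since \<open>\<mu>\<close> is linear only over the rationals, the Stirling
  exponents must split into rational multiples of \<open>1 / q\<close> and a part with a coefficient
  common to all \<open>q\<close>.\<close>

lemma reduced_arg_rational:
  assumes d: "d = cis \<alpha>" and s: "s > 0" and q: "q \<in> neg1_roots s"
  obtains r :: rat where "reduced_arg d q = \<alpha> - pi * of_rat r"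
proof -
  have "cis (reduced_arg d q - \<alpha>) = (if Re (d / q) > 0 then 1 / q else - (1 / q))"
    using cis_reduced_arg[of d q] norm_neg1_root[OF q s] d by (simp add: cis_divide[symmetric])
  then have sq: "cis (reduced_arg d q - \<alpha>) ^ 2 = (1 / q) ^ 2" by (simp split: if_splits)
  have "cis (reduced_arg d q - \<alpha>) ^ (s * 2) = (cis (reduced_arg d q - \<alpha>) ^ 2) ^ s" by (metis power_mult mult.commute)
  also have "\<dots> = ((1 / q) ^ s) ^ 2" unfolding sq by (metis power_mult mult.commute)
  also have "\<dots> = 1" using q by (simp add: neg1_roots_def power_divide)
  finally have "cis (reduced_arg d q - \<alpha>) ^ (s * 2) = 1" .
  then have "cis (real (s * 2) * (reduced_arg d q - \<alpha>)) = 1" by (simp only: Complex.DeMoivre)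
  then have "cos (real (s * 2) * (reduced_arg d q - \<alpha>)) = 1" by (metis cis.sel(1) one_complex.sel(1))
  then obtain n :: int where "real (s * 2) * (reduced_arg d q - \<alpha>) = n * 2 * pi" by (auto simp: cos_one_2pi_int)
  then have "reduced_arg d q = \<alpha> - pi * (- of_int n / of_nat s)" using s by (simp add: field_simps)
  also have "(- of_int n / of_nat s :: real) = of_rat (- of_int n / of_nat s)" by (simp add: of_rat_divide of_rat_minus)
  finally show ?thesis using that by blast
qed

text \<open>\<open>\<alpha>\<close> avoids the finitely many angles where
  \<open>Re (cis \<alpha> / q) = 0\<close> and the reduced argument would reach
  \<open>pi / 2\<close>. Taking \<open>0 < \<alpha> < pi / R\<close> keeps the direction within a
  right angle of 1, which orders the logarithmic terms, and of \<open>p\<close>, which makes the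
  sine factor for \<open>q = p\<close> appear.\<close>

lemma exists_generic_direction:
  assumes R: "R \<ge> 2" and Q: "finite Q" "\<And>q. q \<in> Q \<Longrightarrow> norm q = 1"
  obtains \<alpha> \<eta> where "Re (cis \<alpha>) > 0" "Re (cis \<alpha> / cis (pi / real R)) > 0" "\<eta> > 0"
    "\<And>q. q \<in> Q \<Longrightarrow> \<bar>reduced_arg (cis \<alpha>) q\<bar> \<le> pi / 2 - 2 * \<eta>"
proof -
  have piR: "0 < pi / R" using R by simp
  have piR2: "pi / R \<le> pi / 2" using R by (intro divide_left_mono) auto
  have "finite (\<Union>q\<in>Q. {\<theta>\<in>{0<..<1}. Re (1 / q * cis \<theta>) = 0})"
  proof (intro finite_UN_I finite_zeros_Re_mult_cis Q(1))
    fix q assume "q \<in> Q"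
    then have "q \<noteq> 0" using Q(2) by fastforce
    then show "1 / q \<noteq> 0" by simp
  qed
  moreover have "infinite {0<..<min 1 (pi / R)}" using piR by (intro infinite_Ioo) auto
  ultimately obtain \<alpha> where \<alpha>: "\<alpha> \<in> {0<..<min 1 (pi / R)}"
    "\<alpha> \<notin> (\<Union>q\<in>Q. {\<theta>\<in>{0<..<1}. Re (1 / q * cis \<theta>) = 0})"
    by (meson finite_subset subsetI)
  have ne: "Re (cis \<alpha> / q) \<noteq> 0" if "q \<in> Q" for q using \<alpha> that by (auto simp del: Re_divide)
  have less: "\<bar>reduced_arg (cis \<alpha>) q\<bar> < pi / 2" if "q \<in> Q" for q
    unfolding reduced_arg_def Arg_Re_pos using ne[OF that] by (auto simp del: Re_divide)
  define \<eta> where "\<eta> = Min (insert 1 ((\<lambda>q. (pi / 2 - \<bar>reduced_arg (cis \<alpha>) q\<bar>) / 2) ` Q))"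
  show ?thesis
  proof
    have a: "0 < \<alpha>" "\<alpha> < pi / R" using \<alpha>(1) by auto
    have "- (pi / 2) < \<alpha>" "\<alpha> < pi / 2" using a piR2 by linarith+
    then show "Re (cis \<alpha>) > 0" using cos_gt_zero_pi by simp
    have "- (pi / 2) < \<alpha> - pi / R" "\<alpha> - pi / R < pi / 2" using a piR2 by linarith+
    then have "cos (\<alpha> - pi / R) > 0" by (rule cos_gt_zero_pi)
    then show "Re (cis \<alpha> / cis (pi / real R)) > 0"
      unfolding cis_divide by simp
    show "\<eta> > 0" unfolding \<eta>_def using Q(1) less by (subst Min_gr_iff) auto
    fix q assume "q \<in> Q"
    then have "\<eta> \<le> (pi / 2 - \<bar>reduced_arg (cis \<alpha>) q\<bar>) / 2" unfolding \<eta>_def using Q(1) by (intro Min_le) auto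
    then show "\<bar>reduced_arg (cis \<alpha>) q\<bar> \<le> pi / 2 - 2 * \<eta>" by simp
  qed
qed

section \<open>Transcendence of \<open>Efun R\<close> over its predecessors\<close>

lemma twist_polys:
  assumes \<kappa>: "\<kappa> 0 = 1" "\<And>x y. \<kappa> (x + y) = \<kappa> x * \<kappa> y"
    and "A \<in> polys I F" "\<And>i. i \<in> I \<Longrightarrow> twist \<eta> d \<kappa> (\<lambda>v. F i (d * exp v)) (\<lambda>v. F i (d * exp v))"
  shows "twist \<eta> d \<kappa> (\<lambda>v. A (d * exp v)) (\<lambda>v. A (d * exp v))"
  using assms(3)
  by (rule polys_closed) (auto intro: twist_const[where \<kappa> = \<kappa>] twist_add twist_mult \<kappa> assms(4))

lemma polynomial_infinite_zeros:
  fixes c :: "nat \<Rightarrow> complex"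
  assumes "infinite Y" "\<And>y. y \<in> Y \<Longrightarrow> (\<Sum>j\<le>N. c j * y ^ j) = 0" "j \<le> N"
  shows "c j = 0"
proof (rule ccontr)
  assume "c j \<noteq> 0"
  then have "finite {z. (\<Sum>j\<le>N. c j * z ^ j) = 0}"
    using polyfun_finite_roots[of c N] assms(3) by blast
  then show False using assms(1,2) by (metis (mono_tags, lifting) finite_subset mem_Collect_eq subsetI)
qed

lemma infinite_range_of_zero_and_nonzero:
  fixes \<phi> :: "complex \<Rightarrow> complex"
  assumes "continuous_on UNIV \<phi>" "\<phi> a = 0" "\<phi> b \<noteq> 0"
  shows "infinite (range \<phi>)"
proof
  assume fin: "finite (range \<phi>)"
  have "connected (range \<phi>)" using assms(1) by (rule connected_continuous_image) (rule connected_UNIV)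
  then obtain x where "range \<phi> = {x}" using fin connected_finite_iff_sing by blast
  then show False using assms(2,3) by (metis rangeI singletonD)
qed

theorem Efun_transcendental:
  assumes R: "R \<ge> 2"
  shows "transcendental_on UNIV {1..<R} Efun (Efun R)"
  unfolding transcendental_on_def
proof (intro allI impI ballI)
  fix N A j and z :: complex
  assume A: "\<forall>j. A j \<in> polys {1..<R} Efun" and rel: "\<forall>z\<in>UNIV. (\<Sum>j\<le>N. A j z * Efun R z ^ j) = 0"
    and j: "j \<le> N"
  define Q where "Q = (\<Union>s\<in>{1..R}. neg1_roots s)"
  have Q: "finite Q" "\<And>q. q \<in> Q \<Longrightarrow> norm q = 1"
    unfolding Q_def using norm_neg1_root by auto
  obtain \<alpha> \<eta> where dir: "Re (cis \<alpha>) > 0" "Re (cis \<alpha> / cis (pi / real R)) > 0" "\<eta> > 0"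
    "\<And>q. q \<in> Q \<Longrightarrow> \<bar>reduced_arg (cis \<alpha>) q\<bar> \<le> pi / 2 - 2 * \<eta>"
    using exists_generic_direction[OF R Q] by blast
  define d where "d = cis \<alpha>"
  have d: "norm d = 1" "d \<noteq> 0" "Re d > 0" using dir by (auto simp: d_def)
  have reduced_arg: "\<bar>reduced_arg d q\<bar> \<le> pi / 2 - 2 * \<eta>" if "q \<in> neg1_roots s" "s \<in> {1..R}" for q s
    unfolding d_def using that by (intro dir(4)) (auto simp: Q_def)
  obtain \<mu> :: "complex \<Rightarrow> complex" where \<mu>:
    "\<And>x y. \<mu> (x + y) = \<mu> x + \<mu> y" "\<And>r x. \<mu> (of_rat r * x) = of_rat r * \<mu> x"
    "\<And>y s. 1 \<le> s \<Longrightarrow> s < R \<Longrightarrow> y ^ s = -1 \<Longrightarrow> \<mu> y = 0"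
    "\<mu> (cis (- pi / real R)) = 1"
    using exists_rational_functional[of R] R by (metis gr_zeroI not_numeral_le_zero)
  have \<mu>0: "\<mu> 0 = 0" using \<mu>(2)[of 0 0] by simp
  have \<mu>minus: "\<mu> (- x) = - \<mu> x" for x using \<mu>(2)[of "-1" x] by simp
  have \<mu>sum: "\<mu> (\<Sum>x\<in>X. f x) = (\<Sum>x\<in>X. \<mu> (f x))" if "finite X" for X and f :: "complex \<Rightarrow> complex"
    using that by (induction X) (auto simp: \<mu>0 \<mu>(1))
  have \<mu>root: "\<mu> (1 / q) = 0" if "q \<in> neg1_roots s" "1 \<le> s" "s < R" for q s
    using that by (intro \<mu>(3)[of s]) (auto simp: neg1_roots_def power_divide)
  \<comment> \<open>Normalised so that the exponents of the sine for \<open>q\<close> are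
    \<open>c / q\<close> and \<open>- c / q\<close>, at which the characters see
    \<open>\<mu> (1 / q)\<close>.\<close>
  define c where "c = \<i> * of_real pi * d"
  have c: "c \<noteq> 0" using d by (simp add: c_def)
  \<comment> \<open>\<open>\<mu>\<close> need not vanish on the exponent of \<open>Efun 1\<close>.
    Its second component is 1, so charging \<open>m1\<close> for every logarithmic term makes the
    characters trivial on it.\<close>
  define m1 where "m1 = \<mu> (fst (Efun_exponent d 1) / c)"
  define \<kappa> where "\<kappa> t x = exp (t * (\<mu> (fst x / c) - of_nat (snd x) * m1))" for t :: complex and x :: "complex \<times> nat"
  have \<kappa>: "\<kappa> t 0 = 1" "\<kappa> t (x + y) = \<kappa> t x * \<kappa> t y" for t x y
    by (auto simp: \<kappa>_def \<mu>0 \<mu>(1) add_divide_distrib algebra_simps exp_add exp_diff)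
  have \<kappa>sine: "\<kappa> t (\<i> * of_real pi * d / q, 0) = exp (t * \<mu> (1 / q))"
      "\<kappa> t (- (\<i> * of_real pi * d / q), 0) = exp (- (t * \<mu> (1 / q)))" for t q
  proof -
    have "\<i> * of_real pi * d / q / c = 1 / q" "- (\<i> * of_real pi * d / q) / c = - (1 / q)"
      using c by (auto simp: c_def)
    then show "\<kappa> t (\<i> * of_real pi * d / q, 0) = exp (t * \<mu> (1 / q))"
      "\<kappa> t (- (\<i> * of_real pi * d / q), 0) = exp (- (t * \<mu> (1 / q)))"
      by (simp_all add: \<kappa>_def \<mu>minus)
  qed
  \<comment> \<open>For \<open>s \<ge> 2\<close> the exponent divided by \<open>c\<close> is a
    constant times the sum of \<open>1 / q\<close>, which is 0, minus rational multiples of the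
    single \<open>1 / q\<close>, which \<open>\<mu>\<close> kills.\<close>
  have exponent: "\<kappa> t (Efun_exponent d s) = 1" if s: "1 \<le> s" "s < R" for s t
  proof (cases "s = 1")
    case True
    then show ?thesis by (simp add: \<kappa>_def m1_def Efun_exponent_def)
  next
    case False
    have "\<exists>r. reduced_arg d q = \<alpha> - pi * of_rat r" if "q \<in> neg1_roots s" for q
      using reduced_arg_rational[OF d_def _ that] s by auto
    then obtain r where r: "\<And>q. q \<in> neg1_roots s \<Longrightarrow> reduced_arg d q = \<alpha> - pi * of_rat (r q)" by metis
    have "fst (Efun_exponent d s) / c = (\<Sum>q\<in>neg1_roots s. (\<i> * of_real (reduced_arg d q) - 1) / q / (\<i> * of_real pi))"
      using d by (simp add: Efun_exponent_def c_def sum_divide_distrib)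
    also have "\<dots> = (\<Sum>q\<in>neg1_roots s. (of_real (\<alpha> / pi) + \<i> / of_real pi) * (1 / q) - of_rat (r q) * (1 / q))"
    proof (intro sum.cong refl)
      fix q assume q: "q \<in> neg1_roots s"
      have "(of_real (of_rat (r q)) :: complex) = of_rat (r q)" by (cases "r q") (simp add: of_rat_rat)
      moreover have "(\<i> * x - 1) / (\<i> * p) = x / p + \<i> / p" if "p \<noteq> 0" for x p :: complex
        using that by (simp add: field_simps)
      ultimately show "(\<i> * of_real (reduced_arg d q) - 1) / q / (\<i> * of_real pi) =
         (of_real (\<alpha> / pi) + \<i> / of_real pi) * (1 / q) - of_rat (r q) * (1 / q)"
        unfolding r[OF q] using neg1_root_nonzero[OF q] by (simp add: field_simps)
    qed
    also have "\<dots> = (of_real (\<alpha> / pi) + \<i> / of_real pi) * (\<Sum>q\<in>neg1_roots s. (1 / q) ^ 1) + (\<Sum>q\<in>neg1_roots s. of_rat (- r q) * (1 / q))"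
      by (simp add: sum_subtractf sum_distrib_left of_rat_minus sum_negf)
    also have "(\<Sum>q\<in>neg1_roots s. (1 / q) ^ 1) = 0"
      using s False by (intro sum_inverse_neg1_roots_power) auto
    finally have "\<mu> (fst (Efun_exponent d s) / c) = (\<Sum>q\<in>neg1_roots s. \<mu> (of_rat (- r q) * (1 / q)))"
      using s by (simp add: \<mu>sum)
    also have "\<dots> = 0" using \<mu>root s unfolding \<mu>(2) by (intro sum.neutral) auto
    finally show ?thesis using False by (simp add: \<kappa>_def Efun_exponent_def)
  qed
  have fixed: "twist \<eta> d (\<kappa> t) (\<lambda>v. Efun s (d * exp v)) (\<lambda>v. Efun s (d * exp v))" if s: "s \<in> {1..<R}" for s t
  proof -
    have *: "twist \<eta> d (\<kappa> t) (\<lambda>v. Efun s (d * exp v)) (Efun_twist d (\<kappa> t) s)"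
      using s by (intro tw_Efun dir(3) d(1) reduced_arg \<kappa>) auto
    have "sine_twist d (\<kappa> t) q v = sine_part d q v" if "q \<in> neg1_roots s" for q v
      using \<mu>root[OF that] s unfolding sine_twist_def sine_part_def \<kappa>sine by (simp add: sin_exp_eq mult_ac)
    then have "Efun_twist d (\<kappa> t) s v = Efun s (d * exp v)" if "v \<in> strip \<eta>" for v
      using exponent[of s t] s that Efun_factorization[OF dir(3) d(1), of s v] reduced_arg
      by (simp add: Efun_twist_def)
    then show ?thesis by (intro twist_cong[OF *]) auto
  qed
  have twisted_relation: "(\<Sum>j\<le>N. A j (d * exp v) * Efun_twist d (\<kappa> t) R v ^ j) = 0" if v: "v \<in> strip \<eta>" for v t
  proof -
    have tA: "twist \<eta> d (\<kappa> t) (\<lambda>v. A j (d * exp v)) (\<lambda>v. A j (d * exp v))" for j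
      by (rule twist_polys[where I = "{1..<R}" and F = Efun]) (use A fixed \<kappa> in blast)+
    have tE: "twist \<eta> d (\<kappa> t) (\<lambda>v. Efun R (d * exp v)) (Efun_twist d (\<kappa> t) R)"
      by (rule tw_Efun[OF dir(3) d(1)]) (use R reduced_arg \<kappa> in auto)
    have "twist \<eta> d (\<kappa> t) (\<lambda>v. \<Sum>j\<le>N. A j (d * exp v) * Efun R (d * exp v) ^ j)
       (\<lambda>v. \<Sum>j\<le>N. A j (d * exp v) * Efun_twist d (\<kappa> t) R v ^ j)"
      by (intro twist_sum twist_mult twist_power tA tE \<kappa>)
    from twist_zero[OF dir(3) d(3) this _ v] show ?thesis using rel by blast
  qed
  define e where "e = cis (pi / real R)"
  have e: "e \<in> neg1_roots R" using R by (simp add: e_def neg1_roots_def Complex.DeMoivre)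
  have "1 / e = cis (- pi / real R)" by (simp add: e_def divide_inverse)
  then have \<mu>e: "\<mu> (1 / e) = 1" using \<mu>(4) by simp
  have Ree: "Re (d / e) > 0" using dir(2) by (simp add: e_def d_def)
  \<comment> \<open>At a fixed \<open>v\<close> let \<open>t\<close> vary and put
    \<open>w = pi * (d / e) * exp v\<close>. The sine for \<open>e\<close> becomes
    \<open>sin (w - i * t)\<close>, which vanishes at \<open>t = - i * w\<close>, while
    \<open>t = 0\<close> gives back \<open>Efun R\<close>. So the relation at this point is a
    polynomial with infinitely many zeros.\<close>
  have zero: "A j (d * exp v) * Efun R (d * exp v) = 0" if v: "v \<in> strip \<eta>" for v
  proof (cases "Efun R (d * exp v) = 0")
    case False
    define \<phi> where "\<phi> t = Efun_twist d (\<kappa> t) R v" for t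
    have "continuous_on UNIV (\<lambda>t. sine_twist d (\<kappa> t) q v)" for q
    proof (cases "Re (d / q) > 0")
      case True
      have "continuous_on UNIV (\<lambda>t. (exp (t * \<mu> (1 / q)) * exp (\<i> * of_real pi * d / q * exp v) -
        exp (- (t * \<mu> (1 / q))) * exp (- (\<i> * of_real pi * d / q) * exp v)) / (2 * \<i>))"
        by (intro continuous_intros) simp
      then show ?thesis unfolding sine_twist_def \<kappa>sine using True by (simp only: if_True)
    next
      case False
      then show ?thesis unfolding sine_twist_def by (simp del: Re_divide)
    qed
    then have "continuous_on UNIV \<phi>"
      unfolding \<phi>_def Efun_twist_def \<kappa>_def by (intro continuous_intros) auto
    moreover have "\<phi> (- (\<i> * of_real pi * (d / e) * exp v)) = 0"
    proof -
      have "sine_twist d (\<kappa> (- (\<i> * of_real pi * (d / e) * exp v))) e v = 0"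
        using Ree unfolding sine_twist_def \<kappa>sine \<mu>e by (simp flip: exp_add)
      then show ?thesis unfolding \<phi>_def Efun_twist_def using e R by (auto intro!: prod_zero)
    qed
    moreover have "\<phi> 0 = Efun R (d * exp v)"
    proof -
      have "sine_twist d (\<kappa> 0) q v = sine_part d q v" for q
        by (simp add: sine_twist_def sine_part_def \<kappa>_def sin_exp_eq mult_ac)
      then show ?thesis
        using Efun_factorization[OF dir(3) d(1) _ _ v, of R] reduced_arg R by (simp add: \<phi>_def Efun_twist_def \<kappa>_def)
    qed
    ultimately have "infinite (range \<phi>)"
      using False by (metis infinite_range_of_zero_and_nonzero)
    then have "A j (d * exp v) = 0"
    proof (rule polynomial_infinite_zeros[where N = N and c = "\<lambda>j. A j (d * exp v)" and j = j])
      show "(\<Sum>j\<le>N. A j (d * exp v) * y ^ j) = 0" if "y \<in> range \<phi>" for y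
        using that twisted_relation[OF v] unfolding \<phi>_def by blast
    qed (rule j)
    then show ?thesis by simp
  qed simp
  have holo: "A j holomorphic_on UNIV"
    using A by (auto intro!: polys_holomorphic[of "A j"] Efun_holomorphic)
  \<comment> \<open>Only the ray through \<open>d\<close> is covered so far. The product is
    continued to the plane first; \<open>Efun R\<close> is cancelled afterwards on the disc, where
    it has no zeros.\<close>
  have prod0: "A j w * Efun R w = 0" for w
  proof (rule analytic_continuation[where f = "\<lambda>w. A j w * Efun R w" and S = UNIV and \<xi> = "2 * d" and U = "(\<lambda>t. of_real t * d) ` {1<..}"])
    show "2 * d islimpt (\<lambda>t. of_real t * d) ` {1<..}"
      unfolding islimpt_approachable
    proof (intro allI impI)
      fix \<epsilon> :: real assume "\<epsilon> > 0"
      have "of_real (2 + \<epsilon> / 2) * d - 2 * d = of_real (\<epsilon> / 2) * d" by (simp add: algebra_simps)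
      then have "dist (of_real (2 + \<epsilon> / 2) * d) (2 * d) = norm (of_real (\<epsilon> / 2) * d)"
        unfolding dist_norm by (rule arg_cong)
      also have "\<dots> = \<epsilon> / 2" using d \<open>\<epsilon> > 0\<close> by (simp add: norm_mult)
      finally have dist: "dist (of_real (2 + \<epsilon> / 2) * d) (2 * d) = \<epsilon> / 2" .
      show "\<exists>x'\<in>(\<lambda>t. of_real t * d) ` {1<..}. x' \<noteq> 2 * d \<and> dist x' (2 * d) < \<epsilon>"
      proof (rule bexI[of _ "of_real (2 + \<epsilon> / 2) * d"])
        have "dist (of_real (2 + \<epsilon> / 2) * d) (2 * d) > 0" using dist d(2) \<open>\<epsilon> > 0\<close> by simp
        then show "of_real (2 + \<epsilon> / 2) * d \<noteq> 2 * d \<and> dist (of_real (2 + \<epsilon> / 2) * d) (2 * d) < \<epsilon>"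
          using dist \<open>\<epsilon> > 0\<close> unfolding zero_less_dist_iff by simp
      qed (rule imageI, use \<open>\<epsilon> > 0\<close> in simp)
    qed
    show "A j w * Efun R w = 0" if "w \<in> (\<lambda>t. of_real t * d) ` {1<..}" for w
    proof -
      from that obtain t where t: "t > 1" "w = of_real t * d" by auto
      have "of_real (ln t) \<in> strip \<eta>" using t dir(3) by (simp add: strip_def add_pos_pos)
      from zero[OF this] have "A j (d * exp (of_real (ln t))) * Efun R (d * exp (of_real (ln t))) = 0" .
      moreover have "exp (of_real (ln t)) = complex_of_real t" using t by (simp add: exp_of_real)
      ultimately show ?thesis by (simp only: t(2) mult.commute[of d])
    qed
  qed (auto intro!: holomorphic_intros holo)
  have ball0: "A j w = 0" if "w \<in> ball 0 1" for w
    using prod0[of w] Efun_nonzero_disc[of R w] that R by simp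
  show "A j z = 0"
  proof (rule analytic_continuation_open[where f = "A j" and g = "\<lambda>_. 0" and s = "ball 0 1" and s' = UNIV])
    show "ball (0 :: complex) 1 \<noteq> {}" by simp
    show "A j w = 0" if "w \<in> ball 0 1" for w using ball0 that .
    show "connected (UNIV :: complex set)" by (rule connected_UNIV)
  qed (rule holo | simp)+
qed

text \<open>Here the coefficients are constants, so it suffices that \<open>Efun 1\<close> takes
  infinitely many values.\<close>

lemma Efun_1_transcendental: "transcendental_on UNIV {} Efun (Efun 1)"
  unfolding transcendental_on_def
proof (intro allI impI ballI)
  fix N A j and z :: complex
  assume A: "\<forall>j. A j \<in> polys {} Efun" and rel: "\<forall>z\<in>UNIV. (\<Sum>j\<le>N. A j z * Efun 1 z ^ j) = 0" and j: "j \<le> N"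
  have const: "\<exists>c. f = (\<lambda>_. c)" if "f \<in> polys {} Efun" for f
    using that by (rule polys_closed) auto
  then have "\<forall>j. \<exists>c. A j = (\<lambda>_. c)" using A by blast
  from choice[OF this] obtain c where c: "\<And>j. A j = (\<lambda>_. c j)" by blast
  have "infinite (range (Efun 1))"
  proof (rule infinite_range_of_zero_and_nonzero)
    show "continuous_on UNIV (Efun 1)"
      by (intro holomorphic_on_imp_continuous_on Efun_holomorphic)
    have "\<exists>q\<in>neg1_roots 1. \<exists>n::nat. n \<ge> 1 \<and> - 1 = q * of_nat n" by (auto intro: exI[of _ 1])
    then show "Efun 1 (- 1) = 0" by (subst Efun_eq_0_iff) auto
    show "Efun 1 0 \<noteq> 0" by (rule Efun_nonzero_disc) auto
  qed
  then have "c j = 0"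
    by (rule polynomial_infinite_zeros[where N = N and c = c and j = j]) (use rel c j in auto)
  then show "A j z = 0" using c by simp
qed

section \<open>The functions $\ell_r$ and their logarithmic singularities\<close>

text \<open>Taylor coefficients of \<open>- ln_Gamma (1 + z)\<close> in powers of
  \<open>- z\<close>. The series of \<open>zeta_nat 1\<close> diverges; Euler's constant takes its
  place.\<close>

definition ell_coeff :: "nat \<Rightarrow> complex" where
  "ell_coeff n = (if n = 0 then 0 else if n = 1 then - euler_mascheroni else - zeta_nat n / of_nat n)"

lemma ell_1_sums:
  assumes "norm z < 1"
  shows "(\<lambda>n. ell_coeff n * (- z) ^ n) sums (- ln_Gamma (1 + z))"
proof -
  have ball: "w \<notin> \<real>\<^sub>\<le>\<^sub>0" if "w \<in> ball 1 1" for w :: complex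
    using that abs_Re_le_cmod[of "1 - w"] by (auto simp: dist_norm complex_nonpos_Reals_iff)
  have "(\<lambda>n. (deriv ^^ n) ln_Gamma 1 / fact n * ((1 + z) - 1) ^ n) sums ln_Gamma (1 + z)"
    by (rule holomorphic_power_series[where r = 1])
       (use assms ball in \<open>auto intro!: holomorphic_ln_Gamma simp: dist_norm\<close>)
  then have "(\<lambda>n. - ((deriv ^^ n) ln_Gamma 1 / fact n * z ^ n)) sums (- ln_Gamma (1 + z))"
    by (intro sums_minus) simp
  moreover have "- ((deriv ^^ n) ln_Gamma 1 / fact n * z ^ n) = ell_coeff n * (- z) ^ n" for n
  proof -
    have 1: "(deriv ^^ n) ln_Gamma (1::complex) = (if n = 0 then ln_Gamma 1 else Polygamma (n - 1) 1)"
      by (rule higher_deriv_ln_Gamma_complex) auto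
    consider "n = 0" | "n = 1" | "n \<ge> 2" by linarith
    then show ?thesis
    proof cases
      case 1
      then show ?thesis using ln_Gamma_complex_conv_fact[of 1] by (simp add: ell_coeff_def)
    next
      case 2
      then show ?thesis unfolding 1 by (simp add: ell_coeff_def)
    next
      case 3
      then obtain m where m: "n = Suc m" "m \<noteq> 0" by (cases n) auto
      have "Polygamma m (1::complex) = (-1) ^ Suc m * fact m * zeta_nat n"
        using m by (simp add: Polygamma_def zeta_nat_def inverse_eq_divide add.commute)
      then have "(deriv ^^ n) ln_Gamma (1::complex) / fact n = (-1) ^ n * zeta_nat n / of_nat n"
      proof -
        have "fact n = of_nat n * (fact m :: complex)" using m by simp
        moreover have "(of_nat n :: complex) \<noteq> 0" using 3 by simp
        ultimately show ?thesis unfolding 1 using m \<open>Polygamma m 1 = _\<close> by (simp del: power_Suc of_nat_Suc fact_Suc)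
      qed
      moreover have "(- z) ^ n = (-1) ^ n * z ^ n" by (rule power_minus)
      ultimately show ?thesis using 3 by (simp add: ell_coeff_def)
    qed
  qed
  ultimately show ?thesis by simp
qed

lemma ell_1_eq:
  assumes "norm z < 1"
  shows "ell 1 z = - ln_Gamma (1 + z)"
proof -
  have "(\<lambda>n. ell_coeff (n + 2) * (- z) ^ (n + 2)) sums (- ln_Gamma (1 + z) - (\<Sum>n<2. ell_coeff n * (- z) ^ n))"
    using ell_1_sums[OF assms] by (rule sums_split_initial_segment)
  then have "(\<lambda>n. - (ell_coeff (n + 2) * (- z) ^ (n + 2))) sums - (- ln_Gamma (1 + z) - (\<Sum>n<2. ell_coeff n * (- z) ^ n))"
    by (rule sums_minus)
  moreover have "(\<lambda>n. - (ell_coeff (n + 2) * (- z) ^ (n + 2))) = (\<lambda>k. zeta_nat (k + 2) * (- z) ^ (k + 2) / of_nat (k + 2))"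
    by (simp add: ell_coeff_def fun_eq_iff)
  ultimately have "(\<lambda>k. zeta_nat (k + 2) * (- z) ^ (k + 2) / of_nat (k + 2)) sums - (- ln_Gamma (1 + z) - (\<Sum>n<2. ell_coeff n * (- z) ^ n))"
    by (simp only:)
  from sums_unique[OF this] have "suminf (\<lambda>k. zeta_nat (k + 2) * (- z) ^ (k + 2) / of_nat (k + 2)) = - (- ln_Gamma (1 + z) - (\<Sum>n<2. ell_coeff n * (- z) ^ n))"
    by (rule sym)
  then show ?thesis by (simp add: ell_def ell_coeff_def numeral_2_eq_2)
qed

lemma sum_inverse_neg1_roots_multiple:
  assumes "r > 0"
  shows "(\<Sum>q\<in>neg1_roots r. (1 / q) ^ (r * j)) = of_nat r * (-1) ^ j"
proof -
  have "(\<Sum>q\<in>neg1_roots r. (1 / q) ^ (r * j)) = (\<Sum>q\<in>neg1_roots r. (-1) ^ j)"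
    by (intro sum.cong refl) (simp add: neg1_roots_def power_mult power_divide)
  also have "\<dots> = of_nat (card (neg1_roots r)) * (-1) ^ j" by simp
  also have "card (neg1_roots r) = r" unfolding neg1_roots_def using assms by (intro card_nth_roots) auto
  finally show ?thesis .
qed

text \<open>Sum the series of \<open>- ln_Gamma (1 - z / q)\<close> over \<open>q\<close>. The power
  sums leave only the indices \<open>n = r * j\<close>, with the factor \<open>r * (-1) ^ j\<close>,
  whose \<open>r\<close> cancels against the denominator \<open>n\<close>. For
  \<open>r \<ge> 2\<close> the index 1 is among those that drop out, and Euler's constant with
  it.\<close>

lemma ell_eq_sum:
  assumes r: "r \<ge> 1" and z: "norm z < 1"
  shows "ell r z = (\<Sum>q\<in>neg1_roots r. - ln_Gamma (1 - z / q))"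
proof (cases "r = 1")
  case True
  then show ?thesis using ell_1_eq[OF z] by simp
next
  case False
  then have r2: "r \<ge> 2" using r by simp
  define b where "b n = ell_coeff n * z ^ n * (\<Sum>q\<in>neg1_roots r. (1 / q) ^ n)" for n
  have "(\<lambda>n. \<Sum>q\<in>neg1_roots r. ell_coeff n * (- (- z / q)) ^ n) sums (\<Sum>q\<in>neg1_roots r. - ln_Gamma (1 + (- z / q)))"
  proof (rule sums_sum)
    fix q assume q: "q \<in> neg1_roots r"
    have "norm (- z / q) < 1" using norm_neg1_root[OF q] r z by (simp add: norm_divide)
    then show "(\<lambda>n. ell_coeff n * (- (- z / q)) ^ n) sums (- ln_Gamma (1 + (- z / q)))" by (rule ell_1_sums)
  qed
  moreover have "(\<Sum>q\<in>neg1_roots r. ell_coeff n * (- (- z / q)) ^ n) = b n" for n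
    by (simp add: b_def sum_distrib_left power_divide mult_ac)
  ultimately have b: "b sums (\<Sum>q\<in>neg1_roots r. - ln_Gamma (1 - z / q))" by simp
  have "(\<lambda>j. b (r * j)) sums (\<Sum>q\<in>neg1_roots r. - ln_Gamma (1 - z / q))"
  proof (subst sums_mono_reindex)
    show "strict_mono (\<lambda>j. r * j)" using r by (simp add: strict_mono_def)
    show "b n = 0" if "n \<notin> range (\<lambda>j. r * j)" for n
    proof -
      have "\<not> r dvd n" using that by (auto elim!: dvdE)
      then show ?thesis using sum_inverse_neg1_roots_power[of r n] r by (simp add: b_def)
    qed
  qed (rule b)
  then have "(\<lambda>j. b (r * (j + 1))) sums ((\<Sum>q\<in>neg1_roots r. - ln_Gamma (1 - z / q)) - (\<Sum>j<1. b (r * j)))"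
    by (rule sums_split_initial_segment)
  moreover have "b 0 = 0" by (simp add: b_def ell_coeff_def)
  ultimately have "(\<lambda>j. - b (r * (j + 1))) sums - (\<Sum>q\<in>neg1_roots r. - ln_Gamma (1 - z / q))"
    by (intro sums_minus) simp
  moreover have "- b (r * (j + 1)) = zeta_nat ((j + 1) * r) * (- (z ^ r)) ^ (j + 1) / of_nat (j + 1)" for j
  proof -
    have "r * (j + 1) \<noteq> 0" "r * (j + 1) \<noteq> 1" using r2 by auto
    then have "- b (r * (j + 1)) = zeta_nat (r * (j + 1)) / of_nat (r * (j + 1)) * z ^ (r * (j + 1)) * (of_nat r * (-1) ^ (j + 1))"
      unfolding b_def sum_inverse_neg1_roots_multiple[OF order_less_le_trans[OF zero_less_one r]] ell_coeff_def by simp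
    also have "z ^ (r * (j + 1)) = (z ^ r) ^ (j + 1)" by (rule power_mult)
    also have "zeta_nat (r * (j + 1)) / of_nat (r * (j + 1)) * (z ^ r) ^ (j + 1) * (of_nat r * (-1) ^ (j + 1))
       = zeta_nat ((j + 1) * r) * ((-1) ^ (j + 1) * (z ^ r) ^ (j + 1)) / of_nat (j + 1)"
    proof -
      have "x / (a * s) * y * (a * w) = x * (w * y) / s" if "a \<noteq> 0" for x a s y w :: complex
        using that by simp
      from this[of "of_nat r"] show ?thesis using r unfolding of_nat_mult mult.commute[of "j + 1" r] by simp
    qed
    also have "(-1) ^ (j + 1) * (z ^ r) ^ (j + 1) = (- (z ^ r)) ^ (j + 1)" by (rule power_minus[symmetric])
    finally show ?thesis .
  qed
  ultimately have "(\<lambda>j. zeta_nat ((j + 1) * r) * (- (z ^ r)) ^ (j + 1) / of_nat (j + 1)) sums - (\<Sum>q\<in>neg1_roots r. - ln_Gamma (1 - z / q))"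
    by (simp only:)
  from sums_unique[OF this] have "suminf (\<lambda>k. zeta_nat ((k + 1) * r) * (- (z ^ r)) ^ (k + 1) / of_nat (k + 1)) = - (\<Sum>q\<in>neg1_roots r. - ln_Gamma (1 - z / q))"
    by (rule sym)
  then show ?thesis using False by (simp only: ell_def) simp
qed

lemma one_minus_divide_notin_nonpos_Reals:
  assumes "q \<in> neg1_roots r" "r \<ge> 1" "norm z < 1"
  shows "1 - z / q \<notin> \<real>\<^sub>\<le>\<^sub>0"
proof -
  have "norm (z / q) < 1" using norm_neg1_root[OF assms(1)] assms(2,3) by (simp add: norm_divide)
  then have "\<bar>Re (z / q)\<bar> < 1" using abs_Re_le_cmod order_le_less_trans by blast
  then show ?thesis by (auto simp: complex_nonpos_Reals_iff simp del: Re_divide Im_divide)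
qed

lemma ell_holomorphic:
  assumes "r \<ge> 1"
  shows "ell r holomorphic_on ball 0 1"
proof -
  have "(\<lambda>z. \<Sum>q\<in>neg1_roots r. - ln_Gamma (1 - z / q)) holomorphic_on ball 0 1"
    using one_minus_divide_notin_nonpos_Reals[OF _ assms] neg1_root_nonzero
    by (auto intro!: analytic_imp_holomorphic analytic_intros)
  then show ?thesis
    by (rule holomorphic_transform) (use ell_eq_sum[OF assms] in auto)
qed

lemma exp_ell:
  assumes "r \<ge> 1" "norm z < 1"
  shows "exp (ell r z) = Efun r z"
proof -
  have "exp (- ln_Gamma (1 - z / q)) = rGamma (1 - z / q)" if "q \<in> neg1_roots r" for q
  proof -
    have "1 - z / q \<notin> \<int>\<^sub>\<le>\<^sub>0"
      using one_minus_divide_notin_nonpos_Reals[OF that assms] nonpos_Ints_subset_nonpos_Reals by blast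
    then have "exp (ln_Gamma (1 - z / q)) = Gamma (1 - z / q)" by (simp add: Gamma_complex_altdef)
    then show ?thesis by (simp add: exp_minus rGamma_inverse_Gamma)
  qed
  then show ?thesis using ell_eq_sum[OF assms] assms(1) by (simp add: Efun_def exp_sum)
qed

lemma ell_0: "r \<ge> 1 \<Longrightarrow> ell r 0 = 0"
  using ell_eq_sum[of r 0] ln_Gamma_complex_conv_fact[of 1] by simp

lemma hol_fun_ell_hol [simp]: "r \<ge> 1 \<Longrightarrow> z \<in> ball 0 1 \<Longrightarrow> hol_fun (ell_hol r) z = ell r z"
  unfolding ell_hol_def to_hol_def
  by (subst Abs_hol_disc_inverse) (auto intro: holomorphic_transform[OF ell_holomorphic])

lemma hol_fun_hol_exp [simp]: "z \<in> ball 0 1 \<Longrightarrow> hol_fun (hol_exp f) z = exp (hol_fun f z)"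
  by transfer simp

lemma hol_fun_exp_ell_hol [simp]: "r \<ge> 1 \<Longrightarrow> z \<in> ball 0 1 \<Longrightarrow> hol_fun (exp_ell_hol r) z = Efun r z"
proof -
  assume *: "r \<ge> 1" "z \<in> ball 0 1"
  have "hol_fun (exp_ell_hol r) z = exp (hol_fun (ell_hol r) z)"
    unfolding exp_ell_hol_def using *(2) by simp
  then show ?thesis using * exp_ell by simp
qed

section \<open>Holomorphic continuation across a boundary point of the disc\<close>

definition extends_at :: "complex \<Rightarrow> (complex \<Rightarrow> complex) \<Rightarrow> bool" where
  "extends_at p f \<longleftrightarrow> (\<exists>\<epsilon>>0. \<exists>g. g holomorphic_on ball p \<epsilon> \<and> (\<forall>z\<in>ball 0 1 \<inter> ball p \<epsilon>. f z = g z))"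

lemma extends_at_entire:
  assumes "g holomorphic_on UNIV" "\<And>z. z \<in> ball 0 1 \<Longrightarrow> f z = g z"
  shows "extends_at p f"
  unfolding extends_at_def
  by (intro exI[of _ 1] conjI exI[of _ g]) (use assms holomorphic_on_subset in auto)

lemma extends_at_binop:
  assumes "extends_at p f" "extends_at p g"
    and "\<And>S f g. f holomorphic_on S \<Longrightarrow> g holomorphic_on S \<Longrightarrow> (\<lambda>z. h (f z) (g z)) holomorphic_on S"
  shows "extends_at p (\<lambda>z. h (f z) (g z))"
proof -
  obtain \<epsilon> f' where f: "\<epsilon> > 0" "f' holomorphic_on ball p \<epsilon>" "\<forall>z\<in>ball 0 1 \<inter> ball p \<epsilon>. f z = f' z"
    using assms(1) unfolding extends_at_def by blast
  obtain \<epsilon>' g' where g: "\<epsilon>' > 0" "g' holomorphic_on ball p \<epsilon>'" "\<forall>z\<in>ball 0 1 \<inter> ball p \<epsilon>'. g z = g' z"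
    using assms(2) unfolding extends_at_def by blast
  have "f' holomorphic_on ball p (min \<epsilon> \<epsilon>')" "g' holomorphic_on ball p (min \<epsilon> \<epsilon>')"
    using f(2) g(2) by (auto elim: holomorphic_on_subset)
  from assms(3)[OF this] show ?thesis
    unfolding extends_at_def
    by (intro exI[of _ "min \<epsilon> \<epsilon>'"] conjI exI[of _ "\<lambda>z. h (f' z) (g' z)"]) (use f g in auto)
qed

lemma extends_at_polys:
  assumes "g \<in> polys I f" "\<And>i. i \<in> I \<Longrightarrow> extends_at p (f i)"
  shows "extends_at p g"
  using assms(1)
proof (rule polys_closed)
  show "extends_at p (\<lambda>_. c)" for c by (rule extends_at_entire[of "\<lambda>_. c"]) auto
  show "extends_at p (\<lambda>z. g z + h z)" if "extends_at p g" "extends_at p h" for g h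
    using that by (rule extends_at_binop) (rule holomorphic_on_add)
  show "extends_at p (\<lambda>z. g z * h z)" if "extends_at p g" "extends_at p h" for g h
    using that by (rule extends_at_binop) (rule holomorphic_on_mult)
qed (rule assms(2))

text \<open>\<open>F\<close> has a holomorphic logarithm near \<open>p\<close>. On the connected
  overlap with the disc it differs from \<open>f\<close> by a function whose exponential is 1; this
  function has derivative 0 and is constant.\<close>

lemma extends_at_logarithm:
  assumes f: "f holomorphic_on ball 0 1" and F: "F holomorphic_on UNIV"
    and exp: "\<And>z. z \<in> ball 0 1 \<Longrightarrow> exp (f z) = F z" and p: "norm p = 1" "F p \<noteq> 0"
  shows "extends_at p f"
proof -
  have "continuous_on UNIV F" using F by (rule holomorphic_on_imp_continuous_on)
  then have "isCont F p" by (simp add: continuous_on_eq_continuous_at)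
  then have "eventually (\<lambda>z. F z \<noteq> 0) (nhds p)"
    using p(2) by (metis isCont_def tendsto_at_iff_tendsto_nhds tendsto_imp_eventually_ne)
  then obtain \<epsilon> where \<epsilon>: "\<epsilon> > 0" "\<And>z. z \<in> ball p \<epsilon> \<Longrightarrow> F z \<noteq> 0"
    unfolding eventually_nhds_metric by (auto simp: dist_commute)
  have "F holomorphic_on ball p \<epsilon>" using F by (rule holomorphic_on_subset) auto
  then obtain g where g: "g holomorphic_on ball p \<epsilon>" "\<And>z. z \<in> ball p \<epsilon> \<Longrightarrow> exp (g z) = F z"
    using holomorphic_logarithm_exists[of "ball p \<epsilon>" F p] \<epsilon> by auto
  define W where "W = ball 0 1 \<inter> ball p \<epsilon>"
  have W: "open W" "connected W" unfolding W_def by (auto intro!: convex_connected convex_Int)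
  define h where "h z = f z - g z" for z
  have holo: "h holomorphic_on W"
    unfolding h_def W_def using f g by (intro holomorphic_intros) (auto elim: holomorphic_on_subset)
  have exph: "exp (h z) = 1" if "z \<in> W" for z
    using that exp[of z] g(2)[of z] \<epsilon>(2)[of z] by (simp add: h_def W_def exp_diff)
  have "(h has_field_derivative 0) (at z)" if z: "z \<in> W" for z
  proof -
    have d: "(h has_field_derivative deriv h z) (at z)" using holo W(1) z by (rule holomorphic_derivI)
    then have "((\<lambda>z. exp (h z)) has_field_derivative exp (h z) * deriv h z) (at z)"
      by (rule DERIV_chain2[OF DERIV_exp])
    moreover have "((\<lambda>z. exp (h z)) has_field_derivative 0) (at z)"
      by (rule DERIV_cong_ev[THEN iffD2, OF refl _ refl DERIV_const[of 1]])
         (use W(1) z exph in \<open>auto simp: eventually_nhds\<close>)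
    ultimately have "exp (h z) * deriv h z = 0" by (rule DERIV_unique)
    then show ?thesis using d by simp
  qed
  then have "h constant_on W"
    by (intro DERIV_zero_connected_constant_on[of W "{}"] W holomorphic_on_imp_continuous_on holo) auto
  then obtain c where c: "\<And>z. z \<in> W \<Longrightarrow> h z = c" unfolding constant_on_def by blast
  show ?thesis unfolding extends_at_def
    by (intro exI[of _ \<epsilon>] conjI exI[of _ "\<lambda>z. g z + c"] ballI)
       (use \<epsilon>(1) g(1) c in \<open>auto intro!: holomorphic_intros simp: W_def h_def algebra_simps\<close>)
qed

lemma real_powr_times_ln_tendsto_0:
  fixes c :: real
  assumes "c > 0"
  shows "((\<lambda>s. s powr c * ln s) \<longlongrightarrow> 0) (at_right 0)"
  using assms by real_asymp

text \<open>For the second limit, \<open>s * L^i\<close> is the \<open>i\<close>-th power of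
  \<open>s powr (1 / i) * L\<close>, which reduces it to \<open>s powr c * ln s\<close> tending to
  0.\<close>

lemma log_plus_bounded_limits:
  fixes h :: "real \<Rightarrow> complex"
  assumes h: "(h \<longlongrightarrow> h0) (at_right 0)"
  shows "filterlim (\<lambda>s. of_real (ln s) + h s) at_infinity (at_right 0)"
    and "((\<lambda>s. of_real s * (of_real (ln s) + h s) ^ i) \<longlongrightarrow> 0) (at_right 0)"
proof -
  have "filterlim (\<lambda>s. norm (complex_of_real (ln s))) at_top (at_right 0)"
    unfolding norm_of_real by real_asymp
  then have "filterlim (\<lambda>s. complex_of_real (ln s)) at_infinity (at_right 0)"
    by (rule filterlim_norm_at_top_imp_at_infinity)
  from tendsto_add_filterlim_at_infinity[OF h this]
  show "filterlim (\<lambda>s. of_real (ln s) + h s) at_infinity (at_right 0)"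
    by (simp add: add.commute)
  show "((\<lambda>s. of_real s * (of_real (ln s) + h s) ^ i) \<longlongrightarrow> 0) (at_right 0)"
  proof (cases "i = 0")
    case True
    have "((\<lambda>s. complex_of_real s) \<longlongrightarrow> of_real 0) (at_right 0)"
      by (intro tendsto_of_real tendsto_ident_at)
    then show ?thesis using True by simp
  next
    case False
    define c where "c = 1 / real i"
    have c: "c > 0" using False by (simp add: c_def)
    have "((\<lambda>s::real. s powr c) \<longlongrightarrow> 0) (at_right 0)" using c by real_asymp
    then have "((\<lambda>s. of_real (s powr c * ln s) + of_real (s powr c) * h s) \<longlongrightarrow> of_real 0 + of_real 0 * h0) (at_right 0)"
      by (intro tendsto_intros h real_powr_times_ln_tendsto_0[OF c])
    then have "((\<lambda>s. (of_real (s powr c * ln s) + of_real (s powr c) * h s) ^ i) \<longlongrightarrow> (of_real 0 + of_real 0 * h0) ^ i) (at_right 0)"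
      by (rule tendsto_power)
    moreover have "eventually (\<lambda>s. (of_real (s powr c * ln s) + of_real (s powr c) * h s) ^ i = of_real s * (of_real (ln s) + h s) ^ i) (at_right 0)"
      using eventually_at_right_less[of "0::real"]
    proof eventually_elim
      case (elim s)
      have "(s powr c) ^ i = s"
        using elim False by (simp add: c_def powr_realpow[symmetric] powr_powr)
      then have "(complex_of_real (s powr c)) ^ i = of_real s" by (metis of_real_power)
      moreover have "of_real (s powr c * ln s) + of_real (s powr c) * h s = of_real (s powr c) * (of_real (ln s) + h s)"
        by (simp add: algebra_simps)
      ultimately show ?case by (simp only: power_mult_distrib)
    qed
    ultimately show ?thesis using False by (simp add: filterlim_cong power_0_left)
  qed
qed

section \<open>The singular point \<open>p = exp (i * pi / R)\<close> of
  \<open>ell R\<close>\<close>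

context
  fixes R :: nat and p :: complex
  assumes R: "R \<ge> 1" and p_def: "p = cis (pi / real R)"
begin

lemma norm_p: "norm p = 1" and p0: "p \<noteq> 0"
  by (auto simp: p_def)

lemma p_root: "p \<in> neg1_roots R"
  using R by (simp add: p_def neg1_roots_def Complex.DeMoivre)

lemma p_power_ne: "0 < s \<Longrightarrow> s < R \<Longrightarrow> p ^ s \<noteq> -1"
proof
  assume s: "0 < s" "s < R" "p ^ s = -1"
  have "cis (- pi / real R) = inverse p" by (simp add: p_def)
  moreover have "p ^ (s * 2) = 1" unfolding power_mult s(3) by simp
  ultimately have "cis (- pi / real R) ^ (s * 2) = 1" by (simp add: power_inverse)
  then have "2 * R dvd s * 2" using cis_power_eq_1_iff[of R "s * 2"] R by simp
  then show False using s by (auto dest: dvd_imp_le)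
qed

lemma Efun_p_nonzero: "0 < s \<Longrightarrow> s < R \<Longrightarrow> Efun s p \<noteq> 0"
proof
  assume s: "0 < s" "s < R" "Efun s p = 0"
  then obtain q and n :: nat where q: "q \<in> neg1_roots s" "n \<ge> 1" "p = q * of_nat n"
    using Efun_eq_0_iff by blast
  then have "real n = 1" using norm_p norm_neg1_root[OF q(1) s(1)] by (simp add: norm_mult)
  then show False using q p_power_ne[OF s(1,2)] by (simp add: neg1_roots_def)
qed

lemma ell_extends_at: "0 < s \<Longrightarrow> s < R \<Longrightarrow> extends_at p (hol_fun (ell_hol s))"
  by (rule extends_at_logarithm[where F = "Efun s"])
     (auto intro!: hol_fun_holomorphic Efun_holomorphic norm_p exp_ell simp: Efun_p_nonzero)

text \<open>The factor of \<open>Efun R\<close> for \<open>q = p\<close> has a simple zero at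
  \<open>p\<close>, split off by
  \<open>rGamma (1 - z / p) = (1 - z / p) * rGamma (2 - z / p)\<close>. The rest is nonzero at
  \<open>p\<close>, because for \<open>q \<noteq> p\<close> of the same modulus \<open>p / q\<close>
  is no positive integer; so \<open>extends_at_logarithm\<close> applies to \<open>ell R\<close>
  minus the logarithm.\<close>

lemma ell_log_singularity:
  obtains \<epsilon> h where "\<epsilon> > 0" "h holomorphic_on ball p \<epsilon>"
    "\<And>z. z \<in> ball 0 1 \<inter> ball p \<epsilon> \<Longrightarrow> ell R z = Ln (1 - z / p) + h z"
proof -
  define F where "F z = rGamma (2 - z / p) * (\<Prod>q\<in>neg1_roots R - {p}. rGamma (1 - z / q))" for z
  define f where "f z = ell R z - Ln (1 - z / p)" for z
  have pos: "1 - z / p \<notin> \<real>\<^sub>\<le>\<^sub>0" if "z \<in> ball 0 1" for z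
    using one_minus_divide_notin_nonpos_Reals[OF p_root R] that by simp
  have "extends_at p f"
  proof (rule extends_at_logarithm[where F = F])
    show "f holomorphic_on ball 0 1"
      unfolding f_def using pos p0 by (intro holomorphic_intros ell_holomorphic R) auto
    show "F holomorphic_on UNIV"
      unfolding F_def using p0 neg1_root_nonzero by (intro holomorphic_intros) auto
    show "exp (f z) = F z" if z: "z \<in> ball 0 1" for z
    proof -
      have w0: "1 - z / p \<noteq> 0" using pos[OF z] by auto
      have "Efun R z = rGamma (1 - z / p) * (\<Prod>q\<in>neg1_roots R - {p}. rGamma (1 - z / q))"
        unfolding Efun_def using R p_root by (subst prod.remove[of _ p]) auto
      also have "rGamma (1 - z / p) = (1 - z / p) * rGamma (2 - z / p)"
        using rGamma_plus1[of "1 - z / p"] by (simp add: algebra_simps)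
      finally have "Efun R z = (1 - z / p) * F z" by (simp add: F_def)
      moreover have "exp (f z) = Efun R z / (1 - z / p)"
        unfolding f_def exp_diff using w0 exp_ell[OF R, of z] z by simp
      ultimately show ?thesis using w0 by (metis nonzero_mult_div_cancel_left)
    qed
    have "rGamma (1 - p / q) \<noteq> 0" if q: "q \<in> neg1_roots R - {p}" for q
    proof
      assume "rGamma (1 - p / q) = 0"
      then obtain n :: nat where n: "p = q * of_nat n"
        using rGamma_one_minus_eq_0_iff[of q p] neg1_root_nonzero[of q R] q by auto
      then have "real n = 1" using norm_p norm_neg1_root[of q R] q R by (simp add: norm_mult)
      then show False using n q by simp
    qed
    then show "F p \<noteq> 0" using p0 R by (simp add: F_def)
  qed (rule norm_p)
  then obtain \<epsilon> h where h: "\<epsilon> > 0" "h holomorphic_on ball p \<epsilon>" "\<forall>z\<in>ball 0 1 \<inter> ball p \<epsilon>. f z = h z"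
    unfolding extends_at_def by blast
  show ?thesis
    by (rule that[OF h(1,2)]) (use h(3) in \<open>auto simp: f_def algebra_simps\<close>)
qed

text \<open>Parametrised so that \<open>1 - radial s / p = s\<close>: on this path the logarithm is
  the real number \<open>ln s\<close>.\<close>

definition radial :: "real \<Rightarrow> complex" where "radial s = of_real (1 - s) * p"

lemma radial_in:
  assumes "0 < s" "s < 1" "s < \<epsilon>"
  shows "radial s \<in> ball 0 1 \<inter> ball p \<epsilon>"
proof -
  have "p - radial s = of_real s * p" by (simp add: radial_def algebra_simps)
  then have "dist p (radial s) = s" using assms norm_p unfolding dist_norm by (simp add: norm_mult)
  moreover have "norm (radial s) = 1 - s" using assms norm_p by (simp add: radial_def norm_mult del: of_real_diff)
  ultimately show ?thesis using assms by simp
qed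

lemma radial_tendsto: "(radial \<longlongrightarrow> p) (at_right 0)"
proof -
  have "((\<lambda>s. of_real (1 - s) * p) \<longlongrightarrow> of_real (1 - 0) * p) (at_right (0::real))"
    by (intro tendsto_intros)
  then show ?thesis by (simp add: radial_def[abs_def])
qed

lemma holomorphic_radial_tendsto:
  assumes "g holomorphic_on S" "open S" "p \<in> S"
  shows "((\<lambda>s. g (radial s)) \<longlongrightarrow> g p) (at_right 0)"
proof -
  have "isCont g p"
    using assms holomorphic_on_imp_continuous_on continuous_on_eq_continuous_at by blast
  then show ?thesis using radial_tendsto by (rule isCont_tendsto_compose)
qed

text \<open>Among the terms of lowest order at \<open>p\<close>, the one with the highest power of the logarithm
  dominates when \<open>p\<close> is approached radially.\<close>

theorem log_transcendental:
  assumes a: "\<And>j. a j holomorphic_on ball 0 1" "\<And>j. extends_at p (a j)"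
    and rel: "\<And>z. z \<in> ball 0 1 \<Longrightarrow> (\<Sum>j\<le>N. a j z * ell R z ^ j) = 0"
    and j: "j \<le> N" and z: "z \<in> ball 0 1"
  shows "a j z = 0"
proof -
  obtain \<epsilon>0 h where h: "\<epsilon>0 > 0" "h holomorphic_on ball p \<epsilon>0"
    "\<And>z. z \<in> ball 0 1 \<inter> ball p \<epsilon>0 \<Longrightarrow> ell R z = Ln (1 - z / p) + h z"
    using ell_log_singularity by blast
  have "\<forall>j. \<exists>\<epsilon> b. \<epsilon> > 0 \<and> b holomorphic_on ball p \<epsilon> \<and> (\<forall>z\<in>ball 0 1 \<inter> ball p \<epsilon>. a j z = b z)"
    using a(2) unfolding extends_at_def by blast
  from choice[OF this] obtain E where "\<forall>j. \<exists>b. E j > 0 \<and> b holomorphic_on ball p (E j) \<and> (\<forall>z\<in>ball 0 1 \<inter> ball p (E j). a j z = b z)"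
    by blast
  from choice[OF this] obtain b where Eb: "\<forall>j. E j > 0 \<and> b j holomorphic_on ball p (E j) \<and> (\<forall>z\<in>ball 0 1 \<inter> ball p (E j). a j z = b j z)"
    by blast
  define \<epsilon> where "\<epsilon> = Min (insert \<epsilon>0 (insert 1 (E ` {..N})))"
  have \<epsilon>: "\<epsilon> > 0" "\<epsilon> \<le> \<epsilon>0" "\<epsilon> \<le> 1" "\<And>j. j \<le> N \<Longrightarrow> \<epsilon> \<le> E j"
  proof -
    show "\<epsilon> > 0" unfolding \<epsilon>_def using h(1) Eb by (subst Min_gr_iff) auto
    show "\<epsilon> \<le> \<epsilon>0" "\<epsilon> \<le> 1" unfolding \<epsilon>_def by (rule Min_le; simp)+
    show "\<epsilon> \<le> E j" if "j \<le> N" for j unfolding \<epsilon>_def using that by (intro Min_le) auto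
  qed
  have b: "b j holomorphic_on ball p \<epsilon>" if "j \<le> N" for j
    using Eb \<epsilon>(4)[OF that] by (meson holomorphic_on_subset subset_ball)
  have ab: "a j z = b j z" if "j \<le> N" "z \<in> ball 0 1 \<inter> ball p \<epsilon>" for j z
    using Eb \<epsilon>(4)[OF that(1)] that(2) subset_ball by blast
  define L where "L s = complex_of_real (ln s) + h (radial s)" for s
  have hlim: "((\<lambda>s. h (radial s)) \<longlongrightarrow> h p) (at_right 0)"
    by (rule holomorphic_radial_tendsto[OF h(2)]) (use h(1) in auto)
  have L: "filterlim L at_infinity (at_right 0)" "((\<lambda>s. of_real s * L s ^ i) \<longlongrightarrow> 0) (at_right 0)" for i
    unfolding L_def by (rule log_plus_bounded_limits[OF hlim])+
  have ellL: "ell R (radial s) = L s" if "0 < s" "s < \<epsilon>" for s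
  proof -
    have "radial s \<in> ball 0 1 \<inter> ball p \<epsilon>0" using that \<epsilon> by (intro radial_in) auto
    then have "ell R (radial s) = Ln (1 - radial s / p) + h (radial s)" by (rule h(3))
    moreover have "1 - radial s / p = of_real s" using p0 by (simp add: radial_def)
    ultimately show ?thesis using that by (simp add: L_def Ln_of_real)
  qed
  \<comment> \<open>Coefficients that vanish identically near \<open>p\<close> have no order there
    and are left out.\<close>
  define J where "J = {j. j \<le> N \<and> (\<exists>w\<in>ball p \<epsilon>. b j w \<noteq> 0)}"
  have "J = {}"
  proof (rule ccontr)
    assume "J \<noteq> {}"
    have "finite J" by (simp add: J_def)
    have "\<exists>n g r. r > 0 \<and> g holomorphic_on cball p r \<and> (\<forall>w\<in>cball p r. b j w = g w * (w - p) ^ n \<and> g w \<noteq> 0)" if "j \<in> J" for j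
      using zorder_exist_zero[of "b j" "ball p \<epsilon>" p] b[of j] that \<epsilon>(1) unfolding J_def by fastforce
    then have "\<forall>j. \<exists>n g r. j \<in> J \<longrightarrow> r > 0 \<and> g holomorphic_on cball p r \<and> (\<forall>w\<in>cball p r. b j w = g w * (w - p) ^ n \<and> g w \<noteq> 0)"
      by blast
    from choice[OF this] obtain n where "\<forall>j. \<exists>g r. j \<in> J \<longrightarrow> r > 0 \<and> g holomorphic_on cball p r \<and> (\<forall>w\<in>cball p r. b j w = g w * (w - p) ^ n j \<and> g w \<noteq> 0)"
      by blast
    from choice[OF this] obtain g where "\<forall>j. \<exists>r. j \<in> J \<longrightarrow> r > 0 \<and> g j holomorphic_on cball p r \<and> (\<forall>w\<in>cball p r. b j w = g j w * (w - p) ^ n j \<and> g j w \<noteq> 0)"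
      by blast
    from choice[OF this] obtain r where g: "\<And>j. j \<in> J \<Longrightarrow> r j > 0" "\<And>j. j \<in> J \<Longrightarrow> g j holomorphic_on cball p (r j)"
      "\<And>j w. j \<in> J \<Longrightarrow> w \<in> cball p (r j) \<Longrightarrow> b j w = g j w * (w - p) ^ n j \<and> g j w \<noteq> 0"
      by blast
    define m where "m = Min (n ` J)"
    have m: "m \<le> n j" if "j \<in> J" for j unfolding m_def using \<open>finite J\<close> that by (intro Min_le) auto
    define k where "k = Max {j\<in>J. n j = m}"
    have "m \<in> n ` J" unfolding m_def using \<open>finite J\<close> \<open>J \<noteq> {}\<close> by (intro Min_in) auto
    then have "{j\<in>J. n j = m} \<noteq> {}" by auto
    then have "k \<in> {j\<in>J. n j = m}" unfolding k_def using \<open>finite J\<close> by (intro Max_in) auto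
    then have k: "k \<in> J" "n k = m" by auto
    have kmax: "n j > m" if "j \<in> J" "j > k" for j
    proof (rule ccontr)
      assume "\<not> n j > m"
      then have "j \<in> {j\<in>J. n j = m}" using m[OF that(1)] that(1) by auto
      then have "j \<le> k" unfolding k_def using \<open>finite J\<close> by (intro Max_ge) auto
      then show False using that(2) by simp
    qed
    \<comment> \<open>Term \<open>j\<close> of the relation divided by
      \<open>(- s * p)^m * L^k\<close>, the size of the expected dominant term;
      \<open>radial s - p\<close> equals \<open>- s * p\<close>.\<close>
    define T where "T j s = g j (radial s) * (- (of_real s * p)) ^ (n j - m) * (L s ^ j / L s ^ k)" for j s
    have Lne: "eventually (\<lambda>s. L s \<noteq> 0) (at_right 0)"
      using L(1) by (rule filterlim_at_infinity_imp_eventually_ne)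
    have glim: "((\<lambda>s. g j (radial s)) \<longlongrightarrow> g j p) (at_right 0)" if "j \<in> J" for j
      by (rule holomorphic_radial_tendsto[of _ "ball p (r j)"]) (use g(1)[OF that] holomorphic_on_subset[OF g(2)[OF that] ball_subset_cball] in auto)
    have slim: "((\<lambda>s. (- (of_real s * p)) ^ i) \<longlongrightarrow> (- (of_real 0 * p)) ^ i) (at_right (0::real))" for i
      by (intro tendsto_intros)
    \<comment> \<open>For \<open>j < k\<close> a negative power of \<open>L\<close> remains. For
      \<open>j > k\<close> the choice of \<open>k\<close> gives \<open>n j > m\<close>, and one
      factor \<open>s\<close> beats every power of \<open>L\<close>.\<close>
    have Tlim: "((\<lambda>s. T j s) \<longlongrightarrow> (if j = k then g k p else 0)) (at_right 0)" if j: "j \<in> J" for j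
    proof -
      consider "j = k" | "j < k" | "j > k" by linarith
      then show ?thesis
      proof cases
        case 1
        have "eventually (\<lambda>s. g k (radial s) = T j s) (at_right 0)"
          using Lne by eventually_elim (use 1 k in \<open>simp add: T_def\<close>)
        then show ?thesis using glim[OF k(1)] 1 by (auto elim: Lim_transform_eventually)
      next
        case 2
        have "((\<lambda>s. inverse (L s) ^ (k - j)) \<longlongrightarrow> 0 ^ (k - j)) (at_right 0)"
          by (intro tendsto_power filterlim_compose[OF tendsto_inverse_0 L(1)])
        then have "((\<lambda>s. g j (radial s) * (- (of_real s * p)) ^ (n j - m) * inverse (L s) ^ (k - j)) \<longlongrightarrow>
           g j p * (- (of_real 0 * p)) ^ (n j - m) * 0 ^ (k - j)) (at_right 0)"
          by (intro tendsto_mult glim j slim)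
        moreover have "eventually (\<lambda>s. g j (radial s) * (- (of_real s * p)) ^ (n j - m) * inverse (L s) ^ (k - j) = T j s) (at_right 0)"
          using Lne
        proof eventually_elim
          case (elim s)
          have "L s ^ k = L s ^ j * L s ^ (k - j)" using 2 by (simp flip: power_add)
          then show ?case using elim by (simp add: T_def power_inverse divide_inverse)
        qed
        ultimately have "(T j \<longlongrightarrow> g j p * (- (of_real 0 * p)) ^ (n j - m) * 0 ^ (k - j)) (at_right 0)"
          by (rule Lim_transform_eventually)
        then show ?thesis using 2 by (simp add: power_0_left)
      next
        case 3
        have n: "n j - m = Suc (n j - m - 1)" using kmax[OF j 3] by simp
        have "((\<lambda>s. g j (radial s) * (- (of_real s * p)) ^ (n j - m - 1) * (- p) * (of_real s * L s ^ (j - k))) \<longlongrightarrow>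
           g j p * (- (of_real 0 * p)) ^ (n j - m - 1) * (- p) * 0) (at_right 0)"
          by (intro tendsto_mult glim j slim L(2) tendsto_const)
        moreover have "eventually (\<lambda>s. g j (radial s) * (- (of_real s * p)) ^ (n j - m - 1) * (- p) * (of_real s * L s ^ (j - k)) = T j s) (at_right 0)"
          using Lne
        proof eventually_elim
          case (elim s)
          have "L s ^ j = L s ^ k * L s ^ (j - k)" using 3 by (simp flip: power_add)
          then have "L s ^ j / L s ^ k = L s ^ (j - k)" using elim by simp
          then show ?case unfolding T_def by (subst n) simp
        qed
        ultimately have "(T j \<longlongrightarrow> g j p * (- (of_real 0 * p)) ^ (n j - m - 1) * (- p) * 0) (at_right 0)"
          by (rule Lim_transform_eventually)
        then show ?thesis using 3 by simp
      qed
    qed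
    have lim: "((\<lambda>s. \<Sum>j\<in>J. T j s) \<longlongrightarrow> (\<Sum>j\<in>J. if j = k then g k p else 0)) (at_right 0)"
      by (intro tendsto_sum Tlim)
    have eq: "(\<Sum>j\<in>J. if j = k then g k p else 0) = g k p" using k(1) \<open>finite J\<close> by simp
    have ev: "eventually (\<lambda>s. (\<Sum>j\<in>J. T j s) = 0) (at_right 0)"
    proof -
      define \<delta> where "\<delta> = Min (insert \<epsilon> (r ` J))"
      have \<delta>: "\<delta> > 0" "\<delta> \<le> \<epsilon>" "\<And>j. j \<in> J \<Longrightarrow> \<delta> \<le> r j"
      proof -
        show "\<delta> > 0" unfolding \<delta>_def using \<epsilon>(1) g(1) \<open>finite J\<close> by (subst Min_gr_iff) auto
        show "\<delta> \<le> \<epsilon>" unfolding \<delta>_def using \<open>finite J\<close> by (intro Min_le) auto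
        show "\<delta> \<le> r j" if "j \<in> J" for j unfolding \<delta>_def using \<open>finite J\<close> that by (intro Min_le) auto
      qed
      have "eventually (\<lambda>s. s \<in> {0<..<\<delta>}) (at_right (0::real))"
        using \<delta>(1) by (rule eventually_at_right_real)
      then show ?thesis using Lne
      proof eventually_elim
        case (elim s)
        have s: "0 < s" "s < \<epsilon>" "s < 1" "\<And>j. j \<in> J \<Longrightarrow> s < r j" using elim(1) \<delta> \<epsilon>(3) by fastforce+
        have in1: "radial s \<in> ball 0 1 \<inter> ball p \<epsilon>" using s by (intro radial_in) auto
        have diff: "radial s - p = - (of_real s * p)" by (simp add: radial_def algebra_simps)
        have nz: "- (of_real s * p) \<noteq> 0" using s p0 by simp
        have "b j (radial s) * L s ^ j = T j s * ((- (of_real s * p)) ^ m * L s ^ k)" if j: "j \<in> J" for j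
        proof -
          have "radial s \<in> cball p (r j)" using radial_in[of s "r j"] s j by auto
          then have "b j (radial s) = g j (radial s) * (- (of_real s * p)) ^ n j"
            using g(3)[OF j] diff by metis
          moreover have "(- (of_real s * p)) ^ n j = (- (of_real s * p)) ^ (n j - m) * (- (of_real s * p)) ^ m"
            using m[OF j] by (simp only: power_add[symmetric]) simp
          ultimately show ?thesis using elim(2) by (simp add: T_def mult_ac)
        qed
        then have "(\<Sum>j\<in>J. T j s) * ((- (of_real s * p)) ^ m * L s ^ k) = (\<Sum>j\<in>J. b j (radial s) * L s ^ j)"
          by (simp add: sum_distrib_right)
        also have "\<dots> = (\<Sum>j\<le>N. b j (radial s) * L s ^ j)"
          using in1 by (intro sum.mono_neutral_left) (auto simp: J_def)
        also have "\<dots> = (\<Sum>j\<le>N. a j (radial s) * ell R (radial s) ^ j)"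
          using ab[OF _ in1] ellL[OF s(1,2)] by (intro sum.cong) auto
        also have "\<dots> = 0" using in1 by (intro rel) auto
        finally show ?case using nz elim(2) by simp
      qed
    qed
    have "g k p = 0"
      using tendsto_unique[OF trivial_limit_at_right_real lim tendsto_eventually[OF ev]] eq by simp
    moreover have "g k p \<noteq> 0" using g(3)[OF k(1), of p] g(1)[OF k(1)] by simp
    ultimately show False by simp
  qed
  then have "b j w = 0" if "w \<in> ball p \<epsilon>" for w using j that by (auto simp: J_def)
  then have W0: "a j w = 0" if "w \<in> ball 0 1 \<inter> ball p \<epsilon>" for w using ab[OF j that] that by simp
  show ?thesis
  proof (rule analytic_continuation_open[where f = "a j" and g = "\<lambda>_. 0" and s = "ball 0 1 \<inter> ball p \<epsilon>" and s' = "ball 0 1"])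
    show "ball 0 1 \<inter> ball p \<epsilon> \<noteq> {}" using radial_in[of "\<epsilon> / 2" \<epsilon>] \<epsilon> by auto
    show "a j holomorphic_on ball 0 1" by (rule a)
    show "a j w = 0" if "w \<in> ball 0 1 \<inter> ball p \<epsilon>" for w by (rule W0[OF that])
  qed (use z in \<open>auto intro: open_Int\<close>)
qed

end

section \<open>The theorem\<close>

lemma ell_transcendental:
  assumes R: "R \<ge> 1"
  shows "transcendental_on (ball 0 1) {1..<R} (\<lambda>i. hol_fun (ell_hol i)) (hol_fun (ell_hol R))"
  unfolding transcendental_on_def
proof (intro allI impI ballI)
  fix N A j and z :: complex
  assume A: "\<forall>j. A j \<in> polys {1..<R} (\<lambda>i. hol_fun (ell_hol i))"
    and rel: "\<forall>z\<in>ball 0 1. (\<Sum>j\<le>N. A j z * hol_fun (ell_hol R) z ^ j) = 0"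
    and j: "j \<le> N" and z: "z \<in> ball 0 1"
  show "A j z = 0"
  proof (rule log_transcendental[OF R refl _ _ _ j z])
    show "A j holomorphic_on ball 0 1" for j
      using A by (auto intro!: polys_holomorphic[of "A j"] hol_fun_holomorphic)
    show "extends_at (cis (pi / real R)) (A j)" for j
      by (rule extends_at_polys[OF A[rule_format]], rule ell_extends_at[OF R refl]) auto
    show "(\<Sum>j\<le>N. A j z * ell R z ^ j) = 0" if "z \<in> ball 0 1" for z
      using rel that R by simp
  qed
qed

lemma atLeastLessThan_1_Suc: "R \<ge> 1 \<Longrightarrow> {1..<Suc R} = insert R {1..<R}"
  by auto

lemma ell_indep: "indep_on (ball 0 1) {1..<R} (\<lambda>i. hol_fun (ell_hol i))"
proof (induction R)
  case (Suc R)
  show ?case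
  proof (cases "R = 0")
    case False
    then have "R \<ge> 1" by simp
    then show ?thesis
      unfolding atLeastLessThan_1_Suc[OF \<open>R \<ge> 1\<close>]
      using Suc ell_transcendental[of R] by (intro indep_on_insert) auto
  qed (simp add: indep_on_empty)
qed (simp add: indep_on_empty)

lemma Efun_indep: "indep_on UNIV {1..<R} Efun"
proof (induction R)
  case (Suc R)
  consider "R = 0" | "R = 1" | "R \<ge> 2" by linarith
  then show ?case
  proof cases
    case 1
    then show ?thesis by (simp add: indep_on_empty)
  next
    case 2
    then have "{1..<Suc R} = insert 1 {}" by auto
    then show ?thesis using Efun_1_transcendental by (auto intro: indep_on_insert indep_on_empty)
  next
    case 3
    then have "{1..<Suc R} = insert R {1..<R}" by auto
    then show ?thesis using Suc Efun_transcendental[OF 3] by (auto intro: indep_on_insert)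
  qed
qed (simp add: indep_on_empty)

lemma eq_0_entire:
  assumes "f holomorphic_on UNIV" "\<And>z. z \<in> ball 0 1 \<Longrightarrow> f z = 0"
  shows "f z = 0"
proof (rule analytic_continuation_open[where f = f and g = "\<lambda>_. 0" and s = "ball 0 1" and s' = UNIV])
  show "connected (UNIV :: complex set)" by (rule connected_UNIV)
  show "ball (0 :: complex) 1 \<noteq> {}" by simp
qed (use assms in simp_all)

text \<open>The transcendence argument lives on the whole plane, so a relation on the disc is first
  continued by the identity theorem.\<close>

lemma exp_ell_indep: "indep_on (ball 0 1) {1..<R} (\<lambda>i. hol_fun (exp_ell_hol i))"
  unfolding indep_on_def
proof (intro allI impI)
  fix M :: "(nat \<Rightarrow> nat) set" and c
  assume M: "finite M" "inj_on (\<lambda>m. restrict m {1..<R}) M"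
    and eq: "\<forall>z\<in>ball 0 1. (\<Sum>m\<in>M. c m * (\<Prod>i\<in>{1..<R}. hol_fun (exp_ell_hol i) z ^ m i)) = 0"
  have "(\<Sum>m\<in>M. c m * (\<Prod>i\<in>{1..<R}. Efun i z ^ m i)) = 0" for z
  proof (rule eq_0_entire[where f = "\<lambda>z. \<Sum>m\<in>M. c m * (\<Prod>i\<in>{1..<R}. Efun i z ^ m i)"])
    show "(\<lambda>z. \<Sum>m\<in>M. c m * (\<Prod>i\<in>{1..<R}. Efun i z ^ m i)) holomorphic_on UNIV"
      by (intro holomorphic_intros)
    show "(\<Sum>m\<in>M. c m * (\<Prod>i\<in>{1..<R}. Efun i z ^ m i)) = 0" if "z \<in> ball 0 1" for z
      using eq that by simp
  qed
  then show "\<forall>m\<in>M. c m = 0"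
    using Efun_indep[of R] M unfolding indep_on_def by blast
qed

section \<open>Linear and algebraic freeness from independence on the disc\<close>

definition indep_family :: "'i set \<Rightarrow> ('i \<Rightarrow> hol_disc) \<Rightarrow> bool" where
  "indep_family I f \<longleftrightarrow> (\<forall>S. finite S \<longrightarrow> S \<subseteq> I \<longrightarrow> (\<exists>J. finite J \<and> S \<subseteq> J \<and> indep_on (ball 0 1) J (\<lambda>i. hol_fun (f i))))"

lemma alg_free_indep_family: "indep_family I f \<Longrightarrow> alg_free I f"
  by (rule alg_freeI) (auto simp: indep_family_def)

text \<open>A linear relation with a constant is a polynomial relation of degree at most 1:
  \<open>None\<close> corresponds to the empty monomial and \<open>Some i\<close> to a single
  variable.\<close>

lemma free_from_one_indep_family:
  fixes f :: "'i \<Rightarrow> hol_disc"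
  assumes "indep_family I f"
  shows "free_from_one I f"
  unfolding free_from_one_def lin_free_def
proof (intro allI impI)
  fix J :: "'i option set" and c
  assume J: "finite J" "J \<subseteq> insert None (Some ` I)" and eq: "(\<Sum>j\<in>J. hol_scale (c j) (case_option 1 f j)) = 0"
  define S where "S = {i. Some i \<in> J}"
  have "S = the ` (J - {None})" by (force simp: S_def)
  then have "finite S" "S \<subseteq> I" using J by (auto simp: S_def)
  then obtain K where K: "finite K" "S \<subseteq> K" "indep_on (ball 0 1) K (\<lambda>i. hol_fun (f i))"
    using assms unfolding indep_family_def by blast
  define mon :: "'i option \<Rightarrow> 'i \<Rightarrow> nat" where
    "mon j k = (case j of None \<Rightarrow> 0 | Some i \<Rightarrow> if k = i then 1 else 0)" for j k
  have K_mem: "i \<in> K" if "Some i \<in> J" for i using that K(2) by (auto simp: S_def)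
  have inj: "i = j" if ij: "i \<in> J" "j \<in> J" "restrict (mon i) K = restrict (mon j) K" for i j
  proof -
    have e: "mon i k = mon j k" if "k \<in> K" for k using ij(3) that by (metis restrict_apply')
    show ?thesis
    proof (cases i)
      case None
      show ?thesis
      proof (cases j)
        case (Some b)
        then have "b \<in> K" using ij K_mem by simp
        then show ?thesis using e[of b] None Some by (simp add: mon_def)
      qed (use None in simp)
    next
      case (Some a)
      then have "a \<in> K" using ij K_mem by simp
      then show ?thesis using e[of a] Some by (cases j) (auto simp: mon_def split: if_splits)
    qed
  qed
  then have inj_mon: "inj_on mon J" by (metis inj_onI)
  define c' where "c' m = c (inv_into J mon m)" for m
  have "inj_on (\<lambda>m. restrict m K) (mon ` J)"
    by (rule inj_onI) (use inj in blast)
  moreover have "\<forall>z\<in>ball 0 1. (\<Sum>m\<in>mon ` J. c' m * (\<Prod>i\<in>K. hol_fun (f i) z ^ m i)) = 0"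
  proof
    fix z :: complex assume z: "z \<in> ball 0 1"
    have "(\<Sum>m\<in>mon ` J. c' m * (\<Prod>i\<in>K. hol_fun (f i) z ^ m i)) = (\<Sum>j\<in>J. c' (mon j) * (\<Prod>i\<in>K. hol_fun (f i) z ^ mon j i))"
      by (simp add: sum.reindex[OF inj_mon])
    also have "\<dots> = (\<Sum>j\<in>J. c j * hol_fun (case_option 1 f j) z)"
    proof (intro sum.cong refl)
      fix j assume j: "j \<in> J"
      have "(\<Prod>i\<in>K. hol_fun (f i) z ^ mon j i) = hol_fun (case_option 1 f j) z"
      proof (cases j)
        case None
        then show ?thesis using z by (simp add: mon_def)
      next
        case (Some a)
        have "(\<Prod>i\<in>K. hol_fun (f i) z ^ mon j i) = (\<Prod>i\<in>K. if i = a then hol_fun (f i) z else 1)"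
          using Some by (intro prod.cong) (auto simp: mon_def)
        also have "\<dots> = hol_fun (f a) z" using K_mem[of a] K(1) j Some by simp
        finally show ?thesis using Some by simp
      qed
      then show "c' (mon j) * (\<Prod>i\<in>K. hol_fun (f i) z ^ mon j i) = c j * hol_fun (case_option 1 f j) z"
        using inv_into_f_f[OF inj_mon j] by (simp add: c'_def)
    qed
    also have "\<dots> = hol_fun (\<Sum>j\<in>J. hol_scale (c j) (case_option 1 f j)) z" by simp
    finally show "(\<Sum>m\<in>mon ` J. c' m * (\<Prod>i\<in>K. hol_fun (f i) z ^ m i)) = 0" using eq by simp
  qed
  moreover have "finite (mon ` J)" using J(1) by simp
  ultimately have "\<forall>m\<in>mon ` J. c' m = 0" using K(3) unfolding indep_on_def by blast
  then show "\<forall>j\<in>J. c j = 0" using inv_into_f_f[OF inj_mon] by (simp add: c'_def)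
qed

lemma lin_free_of_free_from_one:
  fixes f :: "'i \<Rightarrow> hol_disc"
  assumes "free_from_one I f"
  shows "lin_free I f"
  unfolding lin_free_def
proof (intro allI impI)
  fix J and c :: "'i \<Rightarrow> complex"
  assume J: "finite J" "J \<subseteq> I" "(\<Sum>j\<in>J. hol_scale (c j) (f j)) = 0"
  define c' where "c' j = (case j of None \<Rightarrow> 0 | Some i \<Rightarrow> c i)" for j
  have "(\<Sum>j\<in>Some ` J. hol_scale (c' j) (case_option 1 f j)) = 0"
    using J(3) by (simp add: sum.reindex c'_def)
  moreover have "finite (Some ` J)" "Some ` J \<subseteq> insert None (Some ` I)" using J by auto
  ultimately have "\<forall>j\<in>Some ` J. c' j = 0"
    using assms unfolding free_from_one_def lin_free_def by blast
  then show "\<forall>j\<in>J. c j = 0" by (simp add: c'_def)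
qed

lemma indep_family_nat:
  fixes f :: "nat \<Rightarrow> hol_disc"
  assumes "\<And>R. indep_on (ball 0 1) {1..<R} (\<lambda>i. hol_fun (f i))"
  shows "indep_family {1..} f"
  unfolding indep_family_def
proof (intro allI impI)
  fix S :: "nat set" assume S: "finite S" "S \<subseteq> {1..}"
  then obtain R where "\<forall>n\<in>S. n < R" using finite_nat_set_iff_bounded by blast
  then have "S \<subseteq> {1..<R}" using S(2) by auto
  then show "\<exists>J. finite J \<and> S \<subseteq> J \<and> indep_on (ball 0 1) J (\<lambda>i. hol_fun (f i))" using assms by blast
qed

lemma ell_family: "indep_family {1..} ell_hol"
  by (rule indep_family_nat[OF ell_indep])

lemma exp_ell_family: "indep_family {1..} exp_ell_hol"
  by (rule indep_family_nat[OF exp_ell_indep])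

lemma infinite_range_Efun_disc:
  assumes "r \<ge> 1"
  shows "infinite (Efun r ` ball 0 1)"
proof
  assume fin: "finite (Efun r ` ball 0 1)"
  have "connected (Efun r ` ball 0 1)"
    by (intro connected_continuous_image holomorphic_on_imp_continuous_on Efun_holomorphic) simp
  then obtain x where x: "Efun r ` ball 0 1 = {x}"
    using fin connected_finite_iff_sing[of "Efun r ` ball 0 1"] by auto
  have "Efun r z - x = 0" for z
    by (rule eq_0_entire) (use x in \<open>auto intro!: holomorphic_intros\<close>)
  then have const: "Efun r z = x" for z by simp
  have "Efun r (cis (pi / r)) = 0"
    using p_root[OF assms refl] assms by (subst Efun_eq_0_iff) (auto intro!: bexI exI[of _ 1])
  moreover have "Efun r 0 \<noteq> 0" using assms by (intro Efun_nonzero_disc) auto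
  ultimately show False using const by metis
qed

lemma polys_empty: "g \<in> polys {} f \<Longrightarrow> \<exists>c. g = (\<lambda>_. c)"
  by (erule polys_closed) auto

text \<open>The exponential is adjoined first: it is transcendental over the constants, having
  infinitely many values. Polynomials in it are restrictions of entire functions, hence admissible
  coefficients in \<open>log_transcendental\<close> for \<open>ell r\<close>.\<close>

lemma ell_exp_ell_family:
  assumes r: "r \<ge> 1"
  shows "indep_family UNIV (\<lambda>b::bool. if b then exp_ell_hol r else ell_hol r)"
proof -
  define f where "f b = hol_fun (if b then exp_ell_hol r else ell_hol r)" for b :: bool
  have "transcendental_on (ball 0 1) {} f (f True)"
    unfolding transcendental_on_def
  proof (intro allI impI ballI)
    fix N A j and z :: complex
    assume A: "\<forall>j. A j \<in> polys {} f" and rel: "\<forall>z\<in>ball 0 1. (\<Sum>j\<le>N. A j z * f True z ^ j) = 0" and j: "j \<le> N"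
    have "\<forall>j. \<exists>c. A j = (\<lambda>_. c)" using A polys_empty by blast
    from choice[OF this] obtain c where c: "\<And>j. A j = (\<lambda>_. c j)" by blast
    have "c j = 0"
    proof (rule polynomial_infinite_zeros[OF infinite_range_Efun_disc[OF r] _ j])
      show "(\<Sum>j\<le>N. c j * y ^ j) = 0" if "y \<in> Efun r ` ball 0 1" for y
        using that rel r by (auto simp: c f_def)
    qed
    then show "A j z = 0" using c by simp
  qed
  then have 1: "indep_on (ball 0 1) {True} f"
    by (intro indep_on_insert indep_on_empty) auto
  have "transcendental_on (ball 0 1) {True} f (f False)"
    unfolding transcendental_on_def
  proof (intro allI impI ballI)
    fix N A j and z :: complex
    assume A: "\<forall>j. A j \<in> polys {True} f" and rel: "\<forall>z\<in>ball 0 1. (\<Sum>j\<le>N. A j z * f False z ^ j) = 0"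
      and j: "j \<le> N" and z: "z \<in> ball 0 1"
    show "A j z = 0"
    proof (rule log_transcendental[OF r refl _ _ _ j z])
      show "A j holomorphic_on ball 0 1" for j
        using A by (auto intro!: polys_holomorphic[of "A j"] hol_fun_holomorphic simp: f_def)
      have "extends_at (cis (pi / r)) (f True)"
        by (rule extends_at_entire[of "Efun r"]) (use r in \<open>auto intro!: Efun_holomorphic simp: f_def\<close>)
      then show "extends_at (cis (pi / r)) (A j)" for j
        using A by (intro extends_at_polys[of "A j" "{True}"]) auto
      show "(\<Sum>j\<le>N. A j z * ell r z ^ j) = 0" if "z \<in> ball 0 1" for z
        using rel that r by (simp add: f_def)
    qed
  qed
  then have "indep_on (ball 0 1) {False, True} f"
    using indep_on_insert[OF _ _ 1, of False] by simp
  then have "indep_on (ball 0 1) {False, True} (\<lambda>b. hol_fun (if b then exp_ell_hol r else ell_hol r))"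
    by (simp add: f_def[abs_def])
  moreover have "finite {False, True}" "S \<subseteq> {False, True}" for S by auto
  ultimately show ?thesis unfolding indep_family_def by blast
qed

text \<open>Expand \<open>P\<close> in powers of the last function \<open>ell R\<close>. Then
  \<open>P - G = 0\<close> is a relation for \<open>ell R\<close> whose coefficients continue across
  its singular point, so \<open>A 0 - G = 0\<close> on the disc. Thus \<open>G\<close> is a
  polynomial in fewer functions, and the induction goes down to constants.\<close>

lemma entire_polys_ell_constant:
  assumes "P \<in> polys {1..<R} (\<lambda>i. hol_fun (ell_hol i))" "G holomorphic_on UNIV"
    and "\<And>z. z \<in> ball 0 1 \<Longrightarrow> P z = G z"
  shows "\<exists>c. \<forall>z\<in>ball 0 1. P z = c"
  using assms
proof (induction R arbitrary: P)
  case 0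
  then have "P \<in> polys {} (\<lambda>i. hol_fun (ell_hol i))" by simp
  then obtain c where "P = (\<lambda>_. c)" using polys_empty by blast
  then show ?case by simp
next
  case (Suc R)
  show ?case
  proof (cases "R = 0")
    case True
    then have "P \<in> polys {} (\<lambda>i. hol_fun (ell_hol i))" using Suc.prems(1) by simp
    then obtain c where "P = (\<lambda>_. c)" using polys_empty by blast
    then show ?thesis by simp
  next
    case False
    then have R: "R \<ge> 1" by simp
    show ?thesis
    proof (rule polys_insert_expansion[OF Suc.prems(1)[unfolded atLeastLessThan_1_Suc[OF R]]])
    fix N A
    assume A: "\<And>j. A j \<in> polys {1..<R} (\<lambda>i. hol_fun (ell_hol i))"
      and A_eq: "\<And>z. P z = (\<Sum>j\<le>N. A j z * hol_fun (ell_hol R) z ^ j)"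
    define a where "a j z = (if j = 0 then A 0 z - G z else A j z)" for j z
    have Aholo: "A j holomorphic_on ball 0 1" for j
      by (rule polys_holomorphic[OF A]) (rule hol_fun_holomorphic)
    have Aext: "extends_at (cis (pi / R)) (A j)" for j
      by (rule extends_at_polys[OF A], rule ell_extends_at[OF R refl]) auto
    have Gholo: "G holomorphic_on ball 0 1"
      using Suc.prems(2) by (rule holomorphic_on_subset) simp
    have "a 0 z = 0" if z: "z \<in> ball 0 1" for z
    proof (rule log_transcendental[OF R refl _ _ _ _ z])
      show "a j holomorphic_on ball 0 1" for j
        unfolding a_def using Aholo Gholo by (cases "j = 0") (auto intro!: holomorphic_intros)
      show "extends_at (cis (pi / R)) (a j)" for j
      proof (cases "j = 0")
        case True
        have "extends_at (cis (pi / R)) (\<lambda>z. A 0 z - G z)"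
          by (rule extends_at_binop[OF Aext extends_at_entire[OF Suc.prems(2) refl] holomorphic_on_diff])
        then show ?thesis using True by (simp add: a_def[abs_def])
      qed (use Aext in \<open>simp add: a_def[abs_def]\<close>)
      show "(\<Sum>j\<le>N. a j z * ell R z ^ j) = 0" if z: "z \<in> ball 0 1" for z
      proof -
        have "(\<Sum>j\<le>N. a j z * ell R z ^ j) = (\<Sum>j\<le>N. A j z * ell R z ^ j - (if j = 0 then G z else 0))"
          by (intro sum.cong refl) (simp add: a_def algebra_simps)
        also have "\<dots> = P z - G z" using A_eq[of z] R z by (simp add: sum_subtractf)
        finally show ?thesis using Suc.prems(3)[OF z] by simp
      qed
      show "0 \<le> N" by simp
    qed
    then have A0: "A 0 z = G z" if "z \<in> ball 0 1" for z using that by (simp add: a_def)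
    then obtain c where "\<forall>z\<in>ball 0 1. A 0 z = c" using Suc.IH[OF A Suc.prems(2)] by blast
    then show ?thesis using A0 Suc.prems(3) by auto
    qed
  qed
qed

section \<open>The algebras generated by \<open>E_space\<close> and \<open>L_space\<close>\<close>

lemma is_subalgebra_restrictions:
  assumes const: "\<And>c. (\<lambda>_. c) \<in> X"
    and add: "\<And>F G. F \<in> X \<Longrightarrow> G \<in> X \<Longrightarrow> (\<lambda>z. F z + G z) \<in> X"
    and mult: "\<And>F G. F \<in> X \<Longrightarrow> G \<in> X \<Longrightarrow> (\<lambda>z. F z * G z) \<in> X"
  shows "is_subalgebra {f. \<exists>F\<in>X. \<forall>z\<in>ball 0 1. hol_fun f z = F z}" (is "is_subalgebra ?T")
proof -
  have "f + g \<in> ?T" if "f \<in> ?T" "g \<in> ?T" for f g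
  proof -
    from that obtain F G where "F \<in> X" "G \<in> X" "\<forall>z\<in>ball 0 1. hol_fun f z = F z"
      "\<forall>z\<in>ball 0 1. hol_fun g z = G z" by blast
    then show ?thesis by (intro CollectI bexI[of _ "\<lambda>z. F z + G z"] add) auto
  qed
  moreover have "f * g \<in> ?T" if "f \<in> ?T" "g \<in> ?T" for f g
  proof -
    from that obtain F G where "F \<in> X" "G \<in> X" "\<forall>z\<in>ball 0 1. hol_fun f z = F z"
      "\<forall>z\<in>ball 0 1. hol_fun g z = G z" by blast
    then show ?thesis by (intro CollectI bexI[of _ "\<lambda>z. F z * G z"] mult) auto
  qed
  moreover have "hol_scale c f \<in> ?T" if "f \<in> ?T" for c f
  proof -
    from that obtain F where "F \<in> X" "\<forall>z\<in>ball 0 1. hol_fun f z = F z" by blast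
    then show ?thesis by (intro CollectI bexI[of _ "\<lambda>z. c * F z"] mult const) auto
  qed
  moreover have "0 \<in> ?T" by (intro CollectI bexI[of _ "\<lambda>_. 0"] const) auto
  moreover have "1 \<in> ?T" by (intro CollectI bexI[of _ "\<lambda>_. 1"] const) auto
  ultimately show ?thesis unfolding is_subalgebra_def hol.subspace_def by blast
qed

lemma generated_algebra_span_subset:
  assumes "is_subalgebra T" "S \<subseteq> T"
  shows "generated_algebra (hol.span S) \<subseteq> T"
  unfolding generated_algebra_def
  by (rule hull_minimal[where S = is_subalgebra]) (use assms in \<open>auto simp: is_subalgebra_def dest: hol.span_minimal\<close>)

lemma scalar_in_generated_algebra: "hol_scale c 1 \<in> generated_algebra S"
  unfolding generated_algebra_def hull_def by (auto simp: is_subalgebra_def hol.subspace_scale)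

text \<open>Elements of the first algebra are restrictions of entire functions, elements of the
  second are polynomials in finitely many \<open>ell r\<close>, so
  \<open>entire_polys_ell_constant\<close> decides.\<close>

lemma generated_algebras_inter:
  "generated_algebra E_space \<inter> generated_algebra L_space = {hol_scale c 1 |c. True}"
proof
  show "{hol_scale c 1 |c. True} \<subseteq> generated_algebra E_space \<inter> generated_algebra L_space"
    using scalar_in_generated_algebra by blast
  show "generated_algebra E_space \<inter> generated_algebra L_space \<subseteq> {hol_scale c 1 |c. True}"
  proof
    fix f assume f: "f \<in> generated_algebra E_space \<inter> generated_algebra L_space"
    have "generated_algebra E_space \<subseteq> {f. \<exists>G\<in>{G. G holomorphic_on UNIV}. \<forall>z\<in>ball 0 1. hol_fun f z = G z}"
      unfolding E_space_def
    proof (rule generated_algebra_span_subset[OF is_subalgebra_restrictions], goal_cases)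
      case 4
      show ?case by (auto intro!: exI[of _ "Efun _"] Efun_holomorphic)
    qed (auto intro: holomorphic_intros)
    with f obtain G where G: "G holomorphic_on UNIV" "\<forall>z\<in>ball 0 1. hol_fun f z = G z" by blast
    define X where "X = (\<Union>R. polys {1..<R} (\<lambda>i. hol_fun (ell_hol i)))"
    have closed: "\<exists>R. F \<in> polys {1..<R} (\<lambda>i. hol_fun (ell_hol i)) \<and> G \<in> polys {1..<R} (\<lambda>i. hol_fun (ell_hol i))"
      if FG: "F \<in> X" "G \<in> X" for F G
    proof -
      from FG obtain R S where "F \<in> polys {1..<R} (\<lambda>i. hol_fun (ell_hol i))"
        "G \<in> polys {1..<S} (\<lambda>i. hol_fun (ell_hol i))" unfolding X_def by blast
      moreover have "{1..<R} \<subseteq> {1..<max R S}" "{1..<S} \<subseteq> {1..<max R S}" by auto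
      ultimately show ?thesis using polys_mono by blast
    qed
    have "generated_algebra L_space \<subseteq> {f. \<exists>P\<in>X. \<forall>z\<in>ball 0 1. hol_fun f z = P z}"
      unfolding L_space_def
    proof (rule generated_algebra_span_subset[OF is_subalgebra_restrictions])
      show "(\<lambda>_. c) \<in> X" for c unfolding X_def using polys_const by blast
      show "(\<lambda>z. F z + G z) \<in> X" if "F \<in> X" "G \<in> X" for F G
        using closed[OF that] polys_add unfolding X_def by blast
      show "(\<lambda>z. F z * G z) \<in> X" if "F \<in> X" "G \<in> X" for F G
        using closed[OF that] polys_mult unfolding X_def by blast
      have "hol_fun (ell_hol i) \<in> X" if "i \<ge> 1" for i
        using polys_gen[of i "{1..<Suc i}" "\<lambda>i. hol_fun (ell_hol i)"] that unfolding X_def by fastforce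
      then show "ell_hol ` {1..} \<subseteq> {f. \<exists>P\<in>X. \<forall>z\<in>ball 0 1. hol_fun f z = P z}" by fastforce
    qed
    with f obtain R P where P: "P \<in> polys {1..<R} (\<lambda>i. hol_fun (ell_hol i))" "\<forall>z\<in>ball 0 1. hol_fun f z = P z"
      unfolding X_def by blast
    obtain c where c: "\<forall>z\<in>ball 0 1. P z = c"
      using entire_polys_ell_constant[OF P(1) G(1)] G(2) P(2) by auto
    have "f - hol_scale c 1 = 0"
      unfolding hol_fun_zero_iff using c P(2) by (auto simp: minus_hol_disc.rep_eq)
    then show "f \<in> {hol_scale c 1 |c. True}" by auto
  qed
qed

text \<open>An element of both spaces is constant, and every element of \<open>L_space\<close>
  vanishes at 0.\<close>

lemma spaces_inter: "E_space \<inter> L_space = {0}"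
proof
  show "{0} \<subseteq> E_space \<inter> L_space"
    unfolding E_space_def L_space_def using hol.span_zero by blast
  show "E_space \<inter> L_space \<subseteq> {0}"
  proof
    fix f assume f: "f \<in> E_space \<inter> L_space"
    have "S \<subseteq> generated_algebra S" for S unfolding generated_algebra_def by (rule hull_subset)
    then have "f \<in> generated_algebra E_space \<inter> generated_algebra L_space" using f by blast
    then obtain c where c: "f = hol_scale c 1" unfolding generated_algebras_inter by blast
    have "hol.subspace {f. hol_fun f 0 = 0}" by (simp add: hol.subspace_def)
    then have "L_space \<subseteq> {f. hol_fun f 0 = 0}"
      unfolding L_space_def by (intro hol.span_minimal) (auto simp: ell_0)
    then have "hol_fun f 0 = 0" using f by auto
    then have "c = 0" unfolding c by simp
    then show "f \<in> {0}" using c by simp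
  qed
qed

section \<open>Zeros of \<open>Efun r\<close> and poles of its inverse\<close>

lemma neg1_roots_iff_G_set:
  assumes "r \<ge> 1"
  shows "- q \<in> G_set r \<longleftrightarrow> q \<in> neg1_roots r"
proof -
  obtain k where k: "r = Suc k" using assms by (cases r) auto
  have "(- q) ^ r = (-1) ^ (r - 1) \<longleftrightarrow> (-1) ^ k * (- (q ^ r)) = (-1) ^ k * 1"
    by (subst power_minus) (simp add: k)
  also have "\<dots> \<longleftrightarrow> - (q ^ r) = 1" by (subst mult_cancel_left) simp
  also have "\<dots> \<longleftrightarrow> q ^ r = -1" by (metis minus_minus)
  finally show ?thesis by (simp add: G_set_def neg1_roots_def)
qed

lemma Efun_zero_set:
  assumes "r \<ge> 1"
  shows "{z. Efun r z = 0} = (\<Union>\<omega>\<in>G_set r. neg_multiples \<omega>)"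
proof (intro equalityI subsetI)
  fix z assume "z \<in> {z. Efun r z = 0}"
  then obtain q and n :: nat where q: "q \<in> neg1_roots r" "n \<ge> 1" "z = q * of_nat n"
    using Efun_eq_0_iff[of r z] assms by auto
  have "z = (- q) * of_int (- int n)" using q by simp
  moreover have "- int n \<in> {..-1}" using q by simp
  ultimately have "z \<in> neg_multiples (- q)" unfolding neg_multiples_def by blast
  then show "z \<in> (\<Union>\<omega>\<in>G_set r. neg_multiples \<omega>)" using neg1_roots_iff_G_set[OF assms] q by blast
next
  fix z assume "z \<in> (\<Union>\<omega>\<in>G_set r. neg_multiples \<omega>)"
  then obtain \<omega> and n :: int where w: "\<omega> \<in> G_set r" "n \<le> -1" "z = \<omega> * of_int n"
    unfolding neg_multiples_def by auto
  have "- \<omega> \<in> neg1_roots r" using neg1_roots_iff_G_set[OF assms, of "- \<omega>"] w by simp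
  moreover have "z = (- \<omega>) * of_nat (nat (- n))" "nat (- n) \<ge> 1" using w by auto
  ultimately have "\<exists>q\<in>neg1_roots r. \<exists>n::nat. n \<ge> 1 \<and> z = q * of_nat n" by blast
  moreover have "r > 0" using assms by simp
  ultimately show "z \<in> {z. Efun r z = 0}" using Efun_eq_0_iff by simp
qed

lemma countable_Efun_zeros:
  assumes "r \<ge> 1"
  shows "countable {z. Efun r z = 0}"
proof -
  have "{z. Efun r z = 0} \<subseteq> (\<Union>q\<in>neg1_roots r. range (\<lambda>n. q * of_nat n))"
    using Efun_eq_0_iff[of r] assms by auto
  moreover have "countable (\<Union>q\<in>neg1_roots r. range (\<lambda>n. q * of_nat n))"
    by (rule countable_UN[OF countable_finite]) (use assms in auto)
  ultimately show ?thesis using countable_subset by blast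
qed

lemma isolated_zero_Efun_iff:
  assumes "r \<ge> 1"
  shows "isolated_zero (Efun r) z \<longleftrightarrow> Efun r z = 0"
proof -
  have cont: "isCont (Efun r) z"
    using holomorphic_on_imp_continuous_on[OF Efun_holomorphic[of r UNIV]]
    by (simp add: continuous_on_eq_continuous_at)
  have "eventually (\<lambda>w. Efun r w \<noteq> 0 \<and> w \<in> UNIV) (at z)"
    by (rule non_zero_neighbour_alt[of _ UNIV z 0])
       (use assms Efun_nonzero_disc[of r 0] in \<open>auto intro: Efun_holomorphic connected_UNIV\<close>)
  then have "eventually (\<lambda>w. Efun r w \<noteq> 0) (at z)" by simp
  moreover have "(Efun r \<midarrow>z\<rightarrow> 0) \<longleftrightarrow> Efun r z = 0"
    using cont LIM_unique unfolding isCont_def by metis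
  ultimately show ?thesis unfolding isolated_zero_def by blast
qed

text \<open>Elements of \<open>G_set r\<close> have modulus 1, so a common point forces equal
  absolute values of the two negative integers, hence equal integers and equal roots.\<close>

lemma disjoint_neg_multiples:
  assumes "r \<ge> 1"
  shows "disjoint_family_on neg_multiples (G_set r)"
  unfolding disjoint_family_on_def
proof (intro ballI impI)
  fix a b assume ab: "a \<in> G_set r" "b \<in> G_set r" "a \<noteq> b"
  show "neg_multiples a \<inter> neg_multiples b = {}"
  proof (rule ccontr)
    assume "neg_multiples a \<inter> neg_multiples b \<noteq> {}"
    then obtain m n :: int where mn: "m \<le> -1" "n \<le> -1" "a * of_int m = b * of_int n"
      unfolding neg_multiples_def by fastforce
    have "norm a = 1" "norm b = 1"
      using norm_neg1_root[of "- a" r] norm_neg1_root[of "- b" r] neg1_roots_iff_G_set[OF assms, of "- a"]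
        neg1_roots_iff_G_set[OF assms, of "- b"] ab assms by auto
    then have "\<bar>real_of_int m\<bar> = \<bar>real_of_int n\<bar>" using arg_cong[OF mn(3), of norm] by (simp add: norm_mult)
    then have "m = n" using mn by simp
    then show False using mn ab by simp
  qed
qed

theorem proposition2p8:
  shows
    "(\<comment> \<open>(1)\<close>
      lin_free {1..} ell_hol \<and> free_from_one {1..} ell_hol) \<and>
     (\<comment> \<open>(2)\<close>
      lin_free {1..} ell_hol \<and> free_from_one {1..} ell_hol \<and>
      lin_free {1..} exp_ell_hol \<and> free_from_one {1..} exp_ell_hol) \<and>
     (\<comment> \<open>(3)\<close>
      alg_free {1..} ell_hol \<and> alg_free {1..} exp_ell_hol) \<and>
     (\<forall>r\<ge>1.
      \<comment> \<open>(4)(a)\<close>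
      alg_free UNIV (\<lambda>b::bool. if b then exp_ell_hol r else ell_hol r) \<and>
      \<comment> \<open>(4)(b)\<close>
      ell r holomorphic_on ball 0 1 \<and>
      \<comment> \<open>(4)(c)\<close>
      disjoint_family_on neg_multiples (G_set r) \<and>
      (\<exists>F. F holomorphic_on UNIV \<and> (\<forall>z\<in>ball 0 1. F z = exp (ell r z)) \<and>
         countable {z. F z = 0} \<and> (\<forall>z. F z = 0 \<longrightarrow> isolated_zero F z) \<and>
         {z. F z = 0} = (\<Union>\<omega>\<in>G_set r. neg_multiples \<omega>)) \<and>
      (\<exists>H. H meromorphic_on UNIV \<and> (\<forall>z\<in>ball 0 1. H z = exp (- ell r z)) \<and>
         countable {z. is_pole H z} \<and> discrete {z. is_pole H z} \<and>
         {z. is_pole H z} = (\<Union>\<omega>\<in>G_set r. neg_multiples \<omega>))) \<and>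
     (\<comment> \<open>(5)\<close>
      E_space \<inter> L_space = {0} \<and>
      generated_algebra E_space \<inter> generated_algebra L_space = {hol_scale c 1 |c. True})"
proof -
  have entire: "\<exists>F. F holomorphic_on UNIV \<and> (\<forall>z\<in>ball 0 1. F z = exp (ell r z)) \<and>
         countable {z. F z = 0} \<and> (\<forall>z. F z = 0 \<longrightarrow> isolated_zero F z) \<and>
         {z. F z = 0} = (\<Union>\<omega>\<in>G_set r. neg_multiples \<omega>)" if r: "r \<ge> 1" for r
  proof (rule exI[of _ "Efun r"], intro conjI)
    show "Efun r holomorphic_on UNIV" by (rule Efun_holomorphic)
    show "\<forall>z\<in>ball 0 1. Efun r z = exp (ell r z)" using exp_ell[OF r] by simp
    show "countable {z. Efun r z = 0}" by (rule countable_Efun_zeros[OF r])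
    show "\<forall>z. Efun r z = 0 \<longrightarrow> isolated_zero (Efun r) z" using isolated_zero_Efun_iff[OF r] by blast
    show "{z. Efun r z = 0} = (\<Union>\<omega>\<in>G_set r. neg_multiples \<omega>)" by (rule Efun_zero_set[OF r])
  qed
  have meromorphic: "\<exists>H. H meromorphic_on UNIV \<and> (\<forall>z\<in>ball 0 1. H z = exp (- ell r z)) \<and>
         countable {z. is_pole H z} \<and> discrete {z. is_pole H z} \<and>
         {z. is_pole H z} = (\<Union>\<omega>\<in>G_set r. neg_multiples \<omega>)" if r: "r \<ge> 1" for r
  proof (rule exI[of _ "\<lambda>z. inverse (Efun r z)"], intro conjI)
    have poles: "{z. is_pole (\<lambda>z. inverse (Efun r z)) z} = {z. Efun r z = 0}"
      by (simp add: is_pole_inverse_iff isolated_zero_Efun_iff[OF r])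
    have analytic: "Efun r analytic_on UNIV"
      by (simp add: analytic_on_open Efun_holomorphic)
    then show "(\<lambda>z. inverse (Efun r z)) meromorphic_on UNIV"
      by (intro meromorphic_on_inverse analytic_on_imp_meromorphic_on)
    show "\<forall>z\<in>ball 0 1. inverse (Efun r z) = exp (- ell r z)" using exp_ell[OF r] by (simp add: exp_minus)
    show "countable {z. is_pole (\<lambda>z. inverse (Efun r z)) z}"
      unfolding poles by (rule countable_Efun_zeros[OF r])
    show "discrete {z. is_pole (\<lambda>z. inverse (Efun r z)) z}"
      unfolding poles
    proof (rule discreteI)
      fix x assume x: "x \<in> {z. Efun r z = 0}"
      then have "eventually (\<lambda>w. Efun r w \<noteq> 0) (at x)"
        using isolated_zero_Efun_iff[OF r] unfolding isolated_zero_def by blast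
      then show "x isolated_in {z. Efun r z = 0}"
        using x unfolding isolated_in_islimpt_iff by (simp add: islimpt_iff_eventually)
    qed
    show "{z. is_pole (\<lambda>z. inverse (Efun r z)) z} = (\<Union>\<omega>\<in>G_set r. neg_multiples \<omega>)"
      unfolding poles by (rule Efun_zero_set[OF r])
  qed
  show ?thesis
    by (intro conjI allI impI entire meromorphic disjoint_neg_multiples ell_holomorphic
      alg_free_indep_family ell_exp_ell_family ell_family exp_ell_family
      free_from_one_indep_family lin_free_of_free_from_one spaces_inter generated_algebras_inter)
qed

end
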